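(* Let $f$ be a fixed holomorphic Hecke cusp form of (even) weight $k\ge 12$ for $SL_2(\mathbb{Z})$. Let $p,q,r$ be distinct odd primes. Then $$M_f(p,r;q)- M_f(-q,r;p) - M_f(-p,q;r) = \sum_{j=1}^{\frac{k}{2}-1} \frac{1}{j!} \frac{\Gamma(\frac{k}{2}+j)}{\Gamma(\frac{k}{2}-j)} \left(\frac{2\pi i q}{pr}\right)^{-j} \left(L\left(\tfrac12 +j, f , -\frac{\overline{p}q}{r}\right) + (-1)^j i^k L\left(\tfrac12 +j, f , \frac{q\overline{r}}{p}\right)\right).$$ The $L$-series values on the right hand side are in the region of absolute convergence of $L(s,f,\alpha)$. Moreover, if $pr<Cq$ for a constant $C$, then $M_f(p,r;q)- M_f(-q,r;p) - M_f(-p,q;r) = O\left(\frac{pr}{q}\right)$, where the implied constant may depend on $f$ and $C$.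
   Context: Notation: $e(x)=e^{2\pi i x}$. $\lambda_f(n)$ denotes the Hecke eigenvalues of $f$, normalized so that $L(s,f)=\sum_{n\ge1}\lambda_f(n)n^{-s}$ (analytically continued) has critical line $\Re(s)=\frac12$; thus $f(z)=\sum_{n\ge 1}\lambda_f(n)n^{\frac{k-1}{2}}e(nz)$ with $\lambda_f(1)=1$. For a Dirichlet character $\chi$, $L(s,f\otimes\chi)$ is the (entire) analytic continuation of $\sum_{n\ge1}\lambda_f(n)\chi(n)n^{-s}$. For $\chi$ modulo $q$, $\tau(\chi)=\sum_{n \bmod q}\chi(n)e(n/q)$ is the Gauss sum, and $\phi$ is Euler's function. For a prime $q$, put $c_f(q)=\lambda_f(q)q^{\frac12}-2$, and for integers $a,b$ coprime to $q$ define $$M_f(a,b;q)=\frac{1}{\phi(q)}\left(\ \sum^{*}_{\chi \bmod q}\tau(\chi)L\left(\tfrac12,f\otimes\overline{\chi}\right)\chi(a)\overline{\chi}(b)+c_f(q)L\left(\tfrac12,f\right)\right),$$ where $\sum^*$ means the sum is over primitive characters modulo $q$. For $\alpha\in\mathbb{Q}$, $L(s,f,\alpha)=\sum_{n\ge1}\lambda_f(n)e(n\alpha)n^{-s}$ for $\Re(s)>1$, continued analytically to an entire function. In a fraction $\frac{\overline{a}c}{b}$ with $(a,b)=1$, $\overline{a}$ denotes any integer with $a\overline{a}\equiv1 \pmod b$ (so in $-\frac{\overline{p}q}{r}$ the inverse is modulo $r$, and in $\frac{q\overline{r}}{p}$ it is modulo $p$). *)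

theory Defs
  imports
    "HOL-Complex_Analysis.Complex_Analysis"
    "HOL-Number_Theory.Number_Theory"
begin

text \<open>Usually written \<open>e(x)\<close>; the letter \<open>e\<close> is left free for variables.\<close>
definition ee :: "complex \<Rightarrow> complex" where
  "ee x = exp (2 * of_real pi * \<i> * x)"


subsection \<open>Holomorphic Hecke cusp forms for the full modular group\<close>

definition upper_half_plane :: "complex set" where
  "upper_half_plane = {z. Im z > 0}"

definition modular_invariant :: "nat \<Rightarrow> (complex \<Rightarrow> complex) \<Rightarrow> bool" where
  "modular_invariant k f \<longleftrightarrow>
     (\<forall>a b c d :: int. a * d - b * c = 1 \<longrightarrow>
        (\<forall>z\<in>upper_half_plane.
           f ((of_int a * z + of_int b) / (of_int c * z + of_int d)) =
             (of_int c * z + of_int d) ^ k * f z))"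

definition has_fourier_expansion :: "(complex \<Rightarrow> complex) \<Rightarrow> (nat \<Rightarrow> complex) \<Rightarrow> bool" where
  "has_fourier_expansion f a \<longleftrightarrow>
     (\<forall>z\<in>upper_half_plane. (\<lambda>n. a n * ee (of_nat n * z)) sums f z)"

definition cusp_form :: "nat \<Rightarrow> (complex \<Rightarrow> complex) \<Rightarrow> bool" where
  "cusp_form k f \<longleftrightarrow>
     f holomorphic_on upper_half_plane \<and> modular_invariant k f \<and>
     (\<exists>a. has_fourier_expansion f a \<and> a 0 = 0)"

text \<open>
  The Hecke operator \<open>T\<^sub>n\<close> in weight \<open>k\<close>, for \<open>n > 0\<close>:
  \<open>(T\<^sub>n f)(z) = n\<^bsup>k-1\<^esup> \<Sum>\<^bsub>ad = n\<^esub> d\<^bsup>-k\<^esup> \<Sum>\<^bsub>0 \<le> b < d\<^esub> f((az + b)/d)\<close>.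
  With this scaling its eigenvalue on a normalized eigenform is the \<open>n\<close>-th Fourier coefficient.
\<close>
definition hecke_operator :: "nat \<Rightarrow> nat \<Rightarrow> (complex \<Rightarrow> complex) \<Rightarrow> complex \<Rightarrow> complex" where
  "hecke_operator k n f z =
     of_nat n ^ (k - 1) *
       (\<Sum>d | d dvd n. (\<Sum>b<d. f ((of_nat (n div d) * z + of_nat b) / of_nat d)) / of_nat d ^ k)"

text \<open>A normalized simultaneous eigenform: the first Fourier coefficient is 1.\<close>
definition hecke_cusp_form :: "nat \<Rightarrow> (complex \<Rightarrow> complex) \<Rightarrow> bool" where
  "hecke_cusp_form k f \<longleftrightarrow>
     cusp_form k f \<and>
     (\<exists>a. has_fourier_expansion f a \<and> a 1 = 1) \<and>
     (\<forall>n>0. \<exists>\<mu>. \<forall>z\<in>upper_half_plane. hecke_operator k n f z = \<mu> * f z)"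

text \<open>
  \<open>\<lambda>\<^sub>f(n)\<close>: the eigenvalue of \<open>T\<^sub>n\<close> divided by \<open>n\<^bsup>(k-1)/2\<^esup>\<close>, which puts the critical line
  of \<open>L(s,f)\<close> at real part 1/2.
\<close>
definition hecke_eigenvalue :: "nat \<Rightarrow> (complex \<Rightarrow> complex) \<Rightarrow> nat \<Rightarrow> complex" where
  "hecke_eigenvalue k f n =
     (THE l. \<forall>z\<in>upper_half_plane.
        hecke_operator k n f z = l * of_real (real n powr ((real k - 1) / 2)) * f z)"


subsection \<open>Dirichlet characters\<close>

text \<open>Characters are called \<open>\<psi>\<close> because HOL-Analysis reserves the letter chi as a binder.\<close>

definition dirichlet_character :: "nat \<Rightarrow> (int \<Rightarrow> complex) \<Rightarrow> bool" where
  "dirichlet_character q \<psi> \<longleftrightarrow>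
     (\<forall>m n. \<psi> (m * n) = \<psi> m * \<psi> n) \<and>
     (\<forall>m. \<psi> (m + int q) = \<psi> m) \<and>
     (\<forall>m. \<psi> m \<noteq> 0 \<longleftrightarrow> coprime m (int q))"

text \<open>Primitive: no proper divisor \<open>d\<close> of \<open>q\<close> is an induced modulus.\<close>
definition primitive_character :: "nat \<Rightarrow> (int \<Rightarrow> complex) \<Rightarrow> bool" where
  "primitive_character q \<psi> \<longleftrightarrow>
     dirichlet_character q \<psi> \<and>
     (\<forall>d. d dvd q \<and> d < q \<longrightarrow>
        (\<exists>a. coprime a (int q) \<and> [a = 1] (mod int d) \<and> \<psi> a \<noteq> 1))"

definition gauss_sum :: "nat \<Rightarrow> (int \<Rightarrow> complex) \<Rightarrow> complex" where
  "gauss_sum q \<psi> = (\<Sum>n\<in>{0..<int q}. \<psi> n * ee (of_int n / of_nat q))"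


subsection \<open>L-functions\<close>

text \<open>The coefficient \<open>a 0\<close> plays no role: the series starts at \<open>n = 1\<close>.\<close>
definition dirichlet_term :: "(nat \<Rightarrow> complex) \<Rightarrow> complex \<Rightarrow> nat \<Rightarrow> complex" where
  "dirichlet_term a s n = a (Suc n) * of_nat (Suc n) powr (-s)"

text \<open>
  The entire function continuing \<open>\<Sum>\<^bsub>n \<ge> 1\<^esub> a(n) n\<^bsup>-s\<^esup>\<close> from the half-plane \<open>Re s > 1\<close>.
  Such a function is unique if it exists; nothing is specified if there is none.
\<close>
definition entire_L :: "(nat \<Rightarrow> complex) \<Rightarrow> complex \<Rightarrow> complex" where
  "entire_L a =
     (THE F. F holomorphic_on UNIV \<and> (\<forall>s. Re s > 1 \<longrightarrow> dirichlet_term a s sums F s))"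

definition L_form :: "nat \<Rightarrow> (complex \<Rightarrow> complex) \<Rightarrow> complex \<Rightarrow> complex" where
  "L_form k f = entire_L (hecke_eigenvalue k f)"

definition L_twist :: "nat \<Rightarrow> (complex \<Rightarrow> complex) \<Rightarrow> (int \<Rightarrow> complex) \<Rightarrow> complex \<Rightarrow> complex" where
  "L_twist k f \<psi> = entire_L (\<lambda>n. hecke_eigenvalue k f n * \<psi> (int n))"

definition additive_coeff :: "nat \<Rightarrow> (complex \<Rightarrow> complex) \<Rightarrow> rat \<Rightarrow> nat \<Rightarrow> complex" where
  "additive_coeff k f \<alpha> n = hecke_eigenvalue k f n * ee (of_nat n * of_rat \<alpha>)"

definition L_additive :: "nat \<Rightarrow> (complex \<Rightarrow> complex) \<Rightarrow> rat \<Rightarrow> complex \<Rightarrow> complex" where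
  "L_additive k f \<alpha> = entire_L (additive_coeff k f \<alpha>)"

definition abs_convergence_region :: "(nat \<Rightarrow> complex) \<Rightarrow> complex set" where
  "abs_convergence_region a = {s. summable (\<lambda>n. norm (dirichlet_term a s n))}"


subsection \<open>The twisted first moment\<close>

definition c_moment :: "nat \<Rightarrow> (complex \<Rightarrow> complex) \<Rightarrow> nat \<Rightarrow> complex" where
  "c_moment k f q = hecke_eigenvalue k f q * of_real (sqrt (real q)) - 2"

definition M_moment :: "nat \<Rightarrow> (complex \<Rightarrow> complex) \<Rightarrow> int \<Rightarrow> int \<Rightarrow> nat \<Rightarrow> complex" where
  "M_moment k f a b q =
     1 / of_nat (totient q) *
       ((\<Sum>\<psi> | primitive_character q \<psi>.
           gauss_sum q \<psi> * L_twist k f (\<lambda>n. cnj (\<psi> n)) (1/2) * \<psi> a * cnj (\<psi> b))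
        + c_moment k f q * L_form k f (1/2))"

end

theory Submission
  imports Defs "HOL-Probability.Sinc_Integral" "HOL-Real_Asymp.Real_Asymp"
begin

text \<open>
  Put \<open>m = k/2 - 1\<close>. For rational \<open>x\<close> the function \<open>f\<close> decays rapidly at both ends of the vertical
  line above \<open>x\<close>, so the entire function \<open>L(s,f,x)\<close> is a Mellin transform along that line, and
  \<open>L(1/2 + j, f, x)\<close> is a constant times \<open>\<integral> f(x + iy) y\<^bsup>m+j\<^esup> dy\<close>. For \<open>j = 0\<close> this is the
  integral of \<open>f(z) (z - x)\<^sup>m dz\<close> from the cusp \<open>x\<close> to the cusp \<open>i\<infinity>\<close>. The theorem combines
  two facts.

  The first is that each twisted moment is a single additive twist:
  \<open>M\<^sub>f(a,b;q) = L(1/2, f, t/q)\<close> whenever \<open>t a \<equiv> b\<close> modulo \<open>q\<close> (\<open>M_moment_eq\<close>). Orthogonality of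
  characters turns the sum over all characters into the additive character \<open>n \<mapsto> e(tn/q)\<close>, except that
  the multiples of \<open>q\<close> and the principal character have to be corrected. The Hecke relation at
  \<open>q\<close> expresses the correction through \<open>L(1/2,f)\<close>, and \<open>c\<^sub>f(q)\<close> is exactly the factor that cancels it.

  The second is a relation between three integrals over the sides of an ideal triangle with cusps
  \<open>i\<infinity>\<close>, \<open>\<beta>\<close> and \<open>\<beta>'\<close>, where \<open>\<beta>\<close> has denominator \<open>r\<close>, \<open>\<beta>'\<close> has denominator \<open>p\<close> and
  \<open>\<beta>' - \<beta> = \<delta> = q/(pr)\<close>. The form
  \<open>f(z) (z - \<beta>)\<^sup>m (z - \<beta>')\<^sup>m dz\<close> has a primitive on the upper half-plane, so its integrals over the three
  sides add up to zero. Along the vertical line above \<open>\<beta>\<close> one has \<open>z - \<beta>' = (z - \<beta>) - \<delta>\<close>, and the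
  binomial theorem produces the values \<open>L(1/2 + j, f, \<beta>)\<close> for \<open>0 \<le> j \<le> m\<close>; the same holds for \<open>\<beta>'\<close>.
  The polynomial has degree \<open>k - 2\<close>, so an element of \<open>SL\<^sub>2(\<int>)\<close> that maps \<open>i\<infinity>\<close> to \<open>\<beta>'\<close> and a cusp
  \<open>t/q\<close> to \<open>\<beta>\<close> turns the third side into a vertical line on which the form is a constant times
  \<open>f(z) (z - t/q)\<^sup>m dz\<close> (\<open>moment_three_term\<close>). For the right \<open>t\<close> this integral is \<open>M\<^sub>f(p,r;q)\<close>; the terms with
  \<open>j = 0\<close> are \<open>M\<^sub>f(-p,q;r)\<close> and, after the functional equation (\<open>additive_functional_equation\<close>),
  \<open>M\<^sub>f(-q,r;p)\<close>. The terms with \<open>j \<ge> 1\<close> form the right-hand side.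

  The series have to converge in all of \<open>Re s > 1\<close>. Hecke's bound for \<open>f\<close> and Bessel's inequality
  show that the Fourier coefficients satisfy \<open>\<Sum>\<^bsub>n \<le> X\<^esub> |a(n)|\<^sup>2 = O(X\<^sup>k)\<close>, which is enough
  (\<open>lam_summable\<close>). The absolute convergence also bounds
  \<open>L(1/2 + j, f, x)\<close> for \<open>j \<ge> 1\<close> uniformly in \<open>x\<close>, and then the \<open>j\<close>-th term of the reciprocity
  relation is \<open>O((pr/q)\<^sup>j)\<close>.
\<close>
section \<open>Analytic continuation of Dirichlet series\<close>

text \<open>
  The relation whose unique solution \<open>entire_L\<close> selects. As a relation it can be combined linearly
  before the definite description is evaluated.
\<close>
definition continues :: "(nat \<Rightarrow> complex) \<Rightarrow> (complex \<Rightarrow> complex) \<Rightarrow> bool" where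
  "continues a F \<longleftrightarrow>
     F holomorphic_on UNIV \<and> (\<forall>s. Re s > 1 \<longrightarrow> dirichlet_term a s sums F s)"

lemma continues_unique:
  assumes "continues a F" "continues a G"
  shows "F = G"
proof
  fix s
  have *: "F z = G z" if "Re z > 1" for z
    using assms that unfolding continues_def by (meson sums_unique2)
  show "F s = G s"
    by (rule analytic_continuation_open[of "{z. Re z > 1}" UNIV F G])
       (use assms * in \<open>auto simp: continues_def open_halfspace_Re_gt intro!: exI[of _ 2]\<close>)
qed

lemma entire_L_eq: "continues a F \<Longrightarrow> entire_L a = F"
  unfolding entire_L_def
  by (rule the_equality) (auto simp: continues_def[symmetric] intro: continues_unique)

lemma continues_entire_L: "continues a F \<Longrightarrow> continues a (entire_L a)"
  by (simp add: entire_L_eq)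

lemma continues_cong:
  assumes "\<And>n. n > 0 \<Longrightarrow> a n = b n"
  shows "continues a = continues b"
proof -
  have "dirichlet_term a = dirichlet_term b"
    using assms by (auto simp: dirichlet_term_def fun_eq_iff)
  thus ?thesis unfolding continues_def[abs_def] by simp
qed

lemma entire_L_cong:
  assumes "\<And>n. n > 0 \<Longrightarrow> a n = b n"
  shows "entire_L a = entire_L b"
  unfolding entire_L_def continues_def[symmetric] by (simp add: continues_cong[OF assms])

lemma continues_sum:
  assumes "finite I" "\<And>i. i \<in> I \<Longrightarrow> continues (a i) (F i)"
  shows "continues (\<lambda>n. \<Sum>i\<in>I. c i * a i n) (\<lambda>s. \<Sum>i\<in>I. c i * F i s)"
  unfolding continues_def
proof (intro conjI allI impI)
  show "(\<lambda>s. \<Sum>i\<in>I. c i * F i s) holomorphic_on UNIV"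
    using assms by (auto intro!: holomorphic_intros simp: continues_def)
next
  fix s :: complex assume s: "Re s > 1"
  have "(\<lambda>n. \<Sum>i\<in>I. c i * dirichlet_term (a i) s n) sums (\<Sum>i\<in>I. c i * F i s)"
    using assms s by (intro sums_sum sums_mult) (auto simp: continues_def)
  moreover have "(\<Sum>i\<in>I. c i * dirichlet_term (a i) s n) =
      dirichlet_term (\<lambda>n. \<Sum>i\<in>I. c i * a i n) s n" for n
    by (simp add: dirichlet_term_def sum_distrib_right mult.assoc)
  ultimately show "dirichlet_term (\<lambda>n. \<Sum>i\<in>I. c i * a i n) s sums (\<Sum>i\<in>I. c i * F i s)"
    by simp
qed

lemma sums_multiples:
  fixes h :: "nat \<Rightarrow> complex"
  assumes "d > 0"
  shows "(\<lambda>n. if d dvd n then h (n div d) else 0) sums S \<longleftrightarrow> h sums S"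
proof -
  have "strict_mono ((*) d)" using assms by (intro strict_monoI) simp
  moreover have "\<And>n. n \<notin> range ((*) d) \<Longrightarrow> (if d dvd n then h (n div d) else 0) = 0" by auto
  ultimately have "(\<lambda>n. if d dvd d * n then h (d * n div d) else 0) sums S \<longleftrightarrow>
      (\<lambda>n. if d dvd n then h (n div d) else 0) sums S"
    by (rule sums_mono_reindex)
  thus ?thesis using assms by simp
qed

lemma dirichlet_term_sums_iff:
  "dirichlet_term a s sums S \<longleftrightarrow> (\<lambda>n. a n * of_nat n powr (-s)) sums S"
  using sums_Suc_iff[of "\<lambda>n. a n * of_nat n powr (-s)" S] by (simp add: dirichlet_term_def[abs_def])

lemma dirichlet_term_dilate:
  assumes "d > 0" "dirichlet_term a s sums S"
  shows "dirichlet_term (\<lambda>n. if d dvd n then a (n div d) else 0) s sums (of_nat d powr (-s) * S)"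
proof -
  let ?h = "\<lambda>n. a n * of_nat n powr (-s)"
  have "(\<lambda>n. if d dvd n then ?h (n div d) else 0) sums S"
    using assms(2) sums_multiples[OF assms(1), of ?h S] by (simp add: dirichlet_term_sums_iff)
  hence "(\<lambda>n. of_nat d powr (-s) * (if d dvd n then ?h (n div d) else 0)) sums (of_nat d powr (-s) * S)"
    by (rule sums_mult)
  also have "(\<lambda>n. of_nat d powr (-s) * (if d dvd n then ?h (n div d) else 0)) =
      (\<lambda>n. (if d dvd n then a (n div d) else 0) * of_nat n powr (-s))"
  proof
    fix n
    show "of_nat d powr (-s) * (if d dvd n then ?h (n div d) else 0) =
        (if d dvd n then a (n div d) else 0) * of_nat n powr (-s)"
    proof (cases "d dvd n")
      case True
      then obtain m where m: "n = d * m" by auto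
      have "complex_of_nat (d * m) powr (-s) = of_nat d powr (-s) * of_nat m powr (-s)"
        unfolding of_nat_mult by (rule powr_times_real) auto
      thus ?thesis using assms(1) m by (simp del: of_nat_mult)
    qed simp
  qed
  finally show ?thesis by (simp only: dirichlet_term_sums_iff)
qed

lemma continues_dilate:
  assumes "d > 0" "continues a F"
  shows "continues (\<lambda>n. if d dvd n then a (n div d) else 0) (\<lambda>s. of_nat d powr (-s) * F s)"
  using assms dirichlet_term_dilate[OF assms(1)]
  by (auto simp: continues_def intro!: holomorphic_intros)


section \<open>The additive character\<close>

lemma ee_add: "ee (x + y) = ee x * ee y"
  by (simp add: ee_def exp_add ring_distribs)

lemma ee_of_nat_mult: "ee (of_nat n * z) = ee z ^ n"
  unfolding ee_def exp_of_nat_mult[symmetric] by (simp add: mult_ac)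

lemma ee_of_int [simp]: "ee (of_int n) = 1"
proof -
  have "exp ((2 * complex_of_real (of_int n) * of_real pi) * \<i>) = 1"
    using exp_integer_2pi[of "of_int n"] by simp
  thus ?thesis by (simp add: ee_def mult_ac)
qed

lemma norm_ee: "norm (ee z) = exp (- 2 * pi * Im z)"
  by (simp add: ee_def)

lemma ee_eq_1_iff: "ee (of_real x) = 1 \<longleftrightarrow> x \<in> \<int>"
proof
  assume "ee (of_real x) = 1"
  then obtain n :: int where "2 * pi * x = of_int (2 * n) * pi"
    unfolding ee_def exp_eq_1 by auto
  hence "x = of_int n" by simp
  thus "x \<in> \<int>" by simp
next
  assume "x \<in> \<int>"
  then obtain n where "x = of_int n" by (rule Ints_cases)
  thus "ee (of_real x) = 1" by simp
qed

lemma ee_cong_mod: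
  assumes "[x = y] (mod int q)" "q > 0"
  shows "ee (of_int x / of_nat q) = ee (of_int y / of_nat q)"
proof -
  obtain t where t: "x = y + int q * t" using assms(1) by (metis cong_iff_lin cong_sym)
  have "of_int x / of_nat q = of_int y / complex_of_nat q + of_int t"
    using assms(2) by (simp add: t field_simps)
  thus ?thesis by (simp add: ee_add)
qed

lemma sum_ee:
  assumes "d > 0"
  shows "(\<Sum>b<d. ee (of_int m * of_nat b / of_nat d)) = (if int d dvd m then of_nat d else 0)"
proof -
  define w where "w = ee (of_int m / of_nat d)"
  have "(\<Sum>b<d. ee (of_int m * of_nat b / of_nat d)) = (\<Sum>b<d. w ^ b)"
    unfolding w_def ee_of_nat_mult[symmetric] by (simp add: mult_ac)
  also have "\<dots> = (if int d dvd m then of_nat d else 0)"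
  proof (cases "int d dvd m")
    case True
    then obtain l where "m = int d * l" by auto
    hence "w = 1" using assms by (simp add: w_def)
    thus ?thesis using True by simp
  next
    case False
    have "w \<noteq> 1"
    proof
      assume "w = 1"
      hence "ee (of_real (of_int m / of_nat d)) = 1" by (simp add: w_def)
      then obtain l where "of_int m / real d = of_int l" unfolding ee_eq_1_iff by (rule Ints_cases)
      hence "of_int m = real_of_int (int d * l)" using assms by (simp add: field_simps)
      hence "m = int d * l" by (simp only: of_int_eq_iff)
      thus False using False by simp
    qed
    moreover have "w ^ d = 1"
      unfolding w_def ee_of_nat_mult[symmetric] using assms by simp
    ultimately show ?thesis using False by (simp add: geometric_sum)
  qed
  finally show ?thesis .
qed


section \<open>Fourier coefficients and Hecke relations\<close>

text \<open>
  A Fourier expansion only determines the power series on the punctured disc, so the constant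
  coefficient is found as a limit at \<open>0\<close>; dividing by \<open>w\<close> then reduces each coefficient to the constant one.
\<close>
lemma powser_zero_coeffs:
  fixes c :: "nat \<Rightarrow> complex"
  assumes "\<And>w. w \<noteq> 0 \<Longrightarrow> norm w < 1 \<Longrightarrow> (\<lambda>n. c n * w ^ n) sums 0"
  shows "c n = 0"
  using assms
proof (induction n arbitrary: c)
  have c0: "c 0 = 0" if "\<And>w. w \<noteq> 0 \<Longrightarrow> norm w < 1 \<Longrightarrow> (\<lambda>n. c n * w ^ n) sums 0" for c :: "nat \<Rightarrow> complex"
  proof -
    have "((\<lambda>_::complex. 0) \<longlongrightarrow> c 0) (at 0)"
      by (rule powser_limit_0_strong[of 1]) (use that in auto)
    thus ?thesis by (simp add: tendsto_const_iff)
  qed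
  {
    case 0
    thus ?case using c0 by blast
  next
    case (Suc n)
    show ?case
    proof (rule Suc.IH)
      fix w :: complex assume w: "w \<noteq> 0" "norm w < 1"
      have "(\<lambda>n. c (Suc n) * w ^ Suc n) sums 0"
        using Suc.prems[OF w] c0[OF Suc.prems] by (subst sums_Suc_iff) simp
      from sums_mult[OF this, of "inverse w"] show "(\<lambda>n. c (Suc n) * w ^ n) sums 0"
        using w by (simp add: field_simps)
    qed
  }
qed

lemma ee_surj:
  assumes "w \<noteq> 0" "norm w < 1"
  obtains z where "z \<in> upper_half_plane" "ee z = w"
proof
  define z where "z = Ln w / (2 * of_real pi * \<i>)"
  show "ee z = w" using assms by (simp add: z_def ee_def)
  have "norm (ee z) < 1" using \<open>ee z = w\<close> assms by simp
  hence "0 < pi * Im z" by (simp add: norm_ee)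
  thus "z \<in> upper_half_plane" by (simp add: zero_less_mult_iff upper_half_plane_def)
qed

lemma fourier_unique:
  assumes "has_fourier_expansion f a" "has_fourier_expansion f b"
  shows "a = b"
proof
  fix n
  have "a n - b n = 0"
  proof (rule powser_zero_coeffs)
    fix w :: complex assume "w \<noteq> 0" "norm w < 1"
    then obtain z where z: "z \<in> upper_half_plane" "ee z = w" using ee_surj by blast
    have "(\<lambda>n. a n * ee (of_nat n * z) - b n * ee (of_nat n * z)) sums (f z - f z)"
      using assms z unfolding has_fourier_expansion_def by (intro sums_diff) auto
    thus "(\<lambda>n. (a n - b n) * w ^ n) sums 0"
      using z by (simp add: ee_of_nat_mult ring_distribs)
  qed
  thus "a n = b n" by simp
qed

lemma fourier_cong:
  assumes "\<And>z. z \<in> upper_half_plane \<Longrightarrow> f z = g z"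
  shows "has_fourier_expansion f a \<longleftrightarrow> has_fourier_expansion g a"
  using assms by (simp add: has_fourier_expansion_def)

lemma fourier_cmult:
  "has_fourier_expansion f a \<Longrightarrow> has_fourier_expansion (\<lambda>z. c * f z) (\<lambda>n. c * a n)"
  unfolding has_fourier_expansion_def by (auto simp: mult.assoc intro: sums_mult)

text \<open>
  Averaging over the translates \<open>b/d\<close> removes every Fourier coefficient whose index is not a multiple
  of \<open>d\<close>; the term with index \<open>d l\<close> is left in position \<open>e l\<close>.
\<close>
lemma hecke_inner_expansion:
  assumes f: "has_fourier_expansion f a" and "d > 0" "e > 0" and z: "z \<in> upper_half_plane"
  shows "(\<lambda>N. (if e dvd N then of_nat d * a (d * (N div e)) else 0) * ee (of_nat N * z))
           sums (\<Sum>b<d. f ((of_nat e * z + of_nat b) / of_nat d))"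
proof -
  let ?S = "\<Sum>b<d. f ((of_nat e * z + of_nat b) / of_nat d)"
  let ?w = "\<lambda>b. (of_nat e * z + of_nat b) / of_nat d"
  define h where "h = (\<lambda>l. of_nat d * a (d * l) * ee (of_nat (e * l) * z))"
  have "(\<lambda>m. \<Sum>b<d. a m * ee (of_nat m * (?w b)))
          sums ?S"
  proof (rule sums_sum)
    fix b assume "b \<in> {..<d}"
    have "?w b \<in> upper_half_plane"
      using assms by (simp add: upper_half_plane_def)
    thus "(\<lambda>m. a m * ee (of_nat m * (?w b)))
            sums f (?w b)"
      using f unfolding has_fourier_expansion_def by blast
  qed
  also have "(\<lambda>m. \<Sum>b<d. a m * ee (of_nat m * (?w b))) =
             (\<lambda>m. if d dvd m then h (m div d) else 0)"
  proof
    fix m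
    have "(\<Sum>b<d. a m * ee (of_nat m * (?w b))) =
        (\<Sum>b<d. a m * ee (of_nat m * of_nat e * z / of_nat d) * ee (of_int (int m) * of_nat b / of_nat d))"
      by (intro sum.cong refl) (simp add: ee_add[symmetric] add_divide_distrib ring_distribs mult_ac add_ac)
    also have "\<dots> = a m * ee (of_nat m * of_nat e * z / of_nat d) * (if d dvd m then of_nat d else 0)"
      unfolding sum_distrib_left[symmetric] sum_ee[OF \<open>d > 0\<close>] by simp
    also have "\<dots> = (if d dvd m then h (m div d) else 0)"
      using \<open>d > 0\<close> \<open>e > 0\<close> by (auto simp: h_def mult_ac elim!: dvdE)
    finally show "(\<Sum>b<d. a m * ee (of_nat m * (?w b))) =
        (if d dvd m then h (m div d) else 0)" .
  qed
  finally have "h sums ?S"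
    using sums_multiples[OF \<open>d > 0\<close>] by blast
  hence "(\<lambda>N. if e dvd N then h (N div e) else 0) sums ?S"
    using sums_multiples[OF \<open>e > 0\<close>] by blast
  moreover have "(if e dvd N then h (N div e) else 0) =
      (if e dvd N then of_nat d * a (d * (N div e)) else 0) * ee (of_nat N * z)" for N
    using \<open>e > 0\<close> by (auto simp: h_def mult_ac elim!: dvdE)
  ultimately show ?thesis by simp
qed

text \<open>
  The Fourier coefficients of \<open>T\<^sub>n f\<close>. With \<open>e = n/d\<close> the sum becomes the familiar
  \<open>\<Sum> e\<^bsup>k-1\<^esup> a(nN/e\<^sup>2)\<close> over the common divisors \<open>e\<close> of \<open>n\<close> and \<open>N\<close>.
\<close>
definition hecke_transform :: "nat \<Rightarrow> nat \<Rightarrow> (nat \<Rightarrow> complex) \<Rightarrow> nat \<Rightarrow> complex" where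
  "hecke_transform k n a N = of_nat n ^ (k - 1) * (\<Sum>d | d dvd n.
           (if n div d dvd N then of_nat d * a (d * (N div (n div d))) else 0) / of_nat d ^ k)"

lemma hecke_fourier:
  assumes "has_fourier_expansion f a" "n > 0"
  shows "has_fourier_expansion (hecke_operator k n f) (hecke_transform k n a)"
  unfolding has_fourier_expansion_def
proof
  fix z assume z: "z \<in> upper_half_plane"
  have "(\<lambda>N. of_nat n ^ (k - 1) * (\<Sum>d | d dvd n.
              (if n div d dvd N then of_nat d * a (d * (N div (n div d))) else 0) * ee (of_nat N * z) / of_nat d ^ k))
        sums hecke_operator k n f z"
    unfolding hecke_operator_def using assms
    by (intro sums_mult sums_sum sums_divide hecke_inner_expansion z)
       (auto intro!: Nat.gr0I simp: dvd_div_eq_0_iff)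
  thus "(\<lambda>N. hecke_transform k n a N * ee (of_nat N * z)) sums hecke_operator k n f z"
    by (simp add: hecke_transform_def sum_distrib_right sum_distrib_left mult_ac)
qed

text \<open>
  The two expansions in the definition of a Hecke cusp form, one with \<open>a(0) = 0\<close> and one with
  \<open>a(1) = 1\<close>, coincide by uniqueness. The locale fixes their common coefficients \<open>a\<close>.
\<close>
locale eigenform =
  fixes k :: nat and f :: "complex \<Rightarrow> complex" and a :: "nat \<Rightarrow> complex"
  assumes even_k: "even k" and k_pos: "k \<ge> 2"
    and holo: "f holomorphic_on upper_half_plane"
    and modular: "modular_invariant k f"
    and fourier: "has_fourier_expansion f a"
    and a_0: "a 0 = 0" and a_1: "a 1 = 1"
    and hecke: "\<And>n. n > 0 \<Longrightarrow> \<exists>\<mu>. \<forall>z\<in>upper_half_plane. hecke_operator k n f z = \<mu> * f z"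

lemma hecke_cusp_form_eigenform:
  assumes "even k" "k \<ge> 2" "hecke_cusp_form k f"
  obtains a where "eigenform k f a"
proof -
  from assms(3) obtain a where a: "has_fourier_expansion f a" "a 1 = 1"
    and cf: "cusp_form k f"
    and h: "\<forall>n>0. \<exists>\<mu>. \<forall>z\<in>upper_half_plane. hecke_operator k n f z = \<mu> * f z"
    by (auto simp: hecke_cusp_form_def)
  from cf obtain b where b: "has_fourier_expansion f b" "b 0 = 0" by (auto simp: cusp_form_def)
  have "a = b" by (rule fourier_unique[OF a(1) b(1)])
  hence "eigenform k f a"
    using assms a b h cf by (auto simp: eigenform_def cusp_form_def)
  thus ?thesis by (rule that)
qed

context eigenform
begin

text \<open>
  This is \<open>hecke_eigenvalue k f\<close> on positive arguments. At \<open>n = 0\<close> the equation that defines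
  \<open>hecke_eigenvalue\<close> reads \<open>0 = 0\<close> and determines nothing.
\<close>
definition lam :: "nat \<Rightarrow> complex" where
  "lam n = a n / of_real (real n powr ((real k - 1) / 2))"

text \<open>
  In the first Fourier coefficient of \<open>T\<^sub>n f\<close> only the divisor \<open>d = n\<close> contributes, and it contributes
  \<open>a(n)\<close>. Since \<open>a(1) = 1\<close>, this is the eigenvalue.
\<close>
lemma hecke_coeff:
  assumes "n > 0"
  shows "hecke_transform k n a N = a n * a N"
    and "z \<in> upper_half_plane \<Longrightarrow> hecke_operator k n f z = a n * f z"
proof -
  obtain \<mu> where \<mu>: "\<forall>z\<in>upper_half_plane. hecke_operator k n f z = \<mu> * f z" using hecke[OF assms] by blast
  have "has_fourier_expansion (hecke_operator k n f) (\<lambda>N. \<mu> * a N)"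
    using fourier_cmult[OF fourier, of \<mu>] \<mu>
      fourier_cong[of "hecke_operator k n f" "\<lambda>z. \<mu> * f z"] by simp
  from fun_cong[OF fourier_unique[OF hecke_fourier[OF fourier assms, of k] this]]
  have *: "hecke_transform k n a N = \<mu> * a N" for N .
  have "(\<Sum>d | d dvd n. (if n div d dvd 1 then of_nat d * a (d * (1 div (n div d))) else 0) / of_nat d ^ k) =
        (\<Sum>d\<in>{n}. of_nat d * a d / of_nat d ^ k)"
  proof (intro sum.mono_neutral_cong_right ballI)
    fix d assume "d \<in> {d. d dvd n} - {n}"
    then obtain e where e: "n = d * e" "e \<noteq> 1" by auto
    hence "n div d = e" using assms by simp
    thus "(if n div d dvd 1 then of_nat d * a (d * (1 div (n div d))) else 0) / of_nat d ^ k = 0"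
      using e by simp
  qed (use assms in auto)
  hence "\<mu> = of_nat n ^ (k - 1) * (of_nat n * a n / of_nat n ^ k)" using *[of 1, unfolded hecke_transform_def] a_1 by simp
  also have "\<dots> = a n" using assms k_pos by (cases k) auto
  finally show "hecke_transform k n a N = a n * a N"
    "z \<in> upper_half_plane \<Longrightarrow> hecke_operator k n f z = a n * f z"
    using * \<mu> by auto
qed

lemma hecke_relation:
  assumes "prime q"
  shows "a q * a m = a (q * m) + (if q dvd m then of_nat q ^ (k - 1) * a (m div q) else 0)"
proof -
  have q: "q > 1" using assms prime_gt_1_nat by blast
  have "{d. d dvd q} = {1, q}" using assms by (auto simp: prime_nat_iff)
  hence "a q * a m = of_nat q ^ (k - 1) * (\<Sum>d\<in>{1,q}.
           (if q div d dvd m then of_nat d * a (d * (m div (q div d))) else 0) / of_nat d ^ k)"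
    using hecke_coeff(1)[of q m] q by (simp add: hecke_transform_def)
  also have "\<dots> = of_nat q ^ (k - 1) * ((if q dvd m then a (m div q) else 0) + of_nat q * a (q * m) / of_nat q ^ k)"
    using q by simp
  also have "\<dots> = a (q * m) + (if q dvd m then of_nat q ^ (k - 1) * a (m div q) else 0)"
  proof -
    have "(of_nat q :: complex) ^ (k - 1) * (of_nat q * x / of_nat q ^ k) = x" for x
      using q k_pos by (cases k) auto
    thus ?thesis by (simp add: distrib_left)
  qed
  finally show ?thesis .
qed

lemma f_nonzero: "\<exists>z\<in>upper_half_plane. f z \<noteq> 0"
proof (rule ccontr)
  assume "\<not> ?thesis"
  hence "has_fourier_expansion f (\<lambda>_. 0)" by (auto simp: has_fourier_expansion_def)
  from fourier_unique[OF fourier this] show False using a_1 by simp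
qed

lemma hecke_eigenvalue_eq: "n > 0 \<Longrightarrow> hecke_eigenvalue k f n = lam n"
  unfolding hecke_eigenvalue_def
proof (rule the_equality)
  assume n: "n > 0"
  thus "\<forall>z\<in>upper_half_plane. hecke_operator k n f z = lam n * of_real (real n powr ((real k - 1) / 2)) * f z"
    by (simp add: hecke_coeff(2) lam_def)
  fix l assume "\<forall>z\<in>upper_half_plane. hecke_operator k n f z = l * of_real (real n powr ((real k - 1) / 2)) * f z"
  moreover obtain z where "z \<in> upper_half_plane" "f z \<noteq> 0" using f_nonzero by blast
  ultimately have "a n * f z = l * of_real (real n powr ((real k - 1) / 2)) * f z"
    using hecke_coeff(2)[OF n, of z] by simp
  thus "l = lam n" using n \<open>f z \<noteq> 0\<close> by (simp add: lam_def)
qed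

lemma lam_hecke_relation:
  assumes "prime q" "m > 0"
  shows "lam (q * m) = lam q * lam m - (if q dvd m then lam (m div q) else 0)"
proof -
  define w where "w = (\<lambda>n::nat. complex_of_real (real n powr ((real k - 1) / 2)))"
  have q: "q > 0" using assms prime_gt_0_nat by blast
  have w_mult: "w (x * y) = w x * w y" for x y by (simp add: w_def powr_mult)
  have w_nz: "w x \<noteq> 0" if "x > 0" for x using that by (simp add: w_def)
  have "real q powr ((real k - 1) / 2) * real q powr ((real k - 1) / 2) =
        real q powr ((real k - 1) / 2 + (real k - 1) / 2)" by (rule powr_add[symmetric])
  also have "(real k - 1) / 2 + (real k - 1) / 2 = real (k - 1)" using k_pos by (simp add: of_nat_diff)
  also have "real q powr real (k - 1) = real q ^ (k - 1)" by (rule powr_realpow) (use q in simp)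
  finally have "complex_of_real (real q powr ((real k - 1) / 2) * real q powr ((real k - 1) / 2)) =
      of_real (real q ^ (k - 1))" by (rule arg_cong)
  hence wq: "w q * w q = of_nat q ^ (k - 1)"
    unfolding w_def of_real_mult of_real_power by simp
  have lam: "lam n = a n / w n" for n by (simp add: lam_def w_def)
  show ?thesis
  proof (cases "q dvd m")
    case True
    then obtain l where l: "m = q * l" by auto
    with assms have "l > 0" by auto
    have "a (q * m) = a q * a m - of_nat q ^ (k - 1) * a l"
      using hecke_relation[OF assms(1), of m] l q by simp
    hence "lam (q * m) = a q * a m / (w q * w m) - (w q * w q) * a l / (w q * (w q * w l))"
      unfolding lam w_mult wq l by (simp add: diff_divide_distrib)
    also have "(w q * w q) * a l / (w q * (w q * w l)) = lam l"
      using w_nz[OF q] by (simp add: lam)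
    finally show ?thesis using True l q by (simp add: lam)
  next
    case False
    have "a (q * m) = a q * a m" using hecke_relation[OF assms(1), of m] False by simp
    thus ?thesis using False by (simp add: lam w_mult)
  qed
qed

end


section \<open>Growth of the Fourier coefficients\<close>

lemma of_int_det:
  assumes "a * d - b * c = (1::int)"
  shows "of_int a * of_int d - of_int b * of_int c = (1 :: 'a :: ring_1)"
  using assms by (metis of_int_1 of_int_diff of_int_mult)

lemma det_mult:
  assumes "A * d - b * C = (1::int)" "t * v - u * q = 1"
  shows "(A * t + b * q) * (C * u + d * v) - (A * u + b * v) * (C * t + d * q) = 1"
proof -
  have "(A * t + b * q) * (C * u + d * v) - (A * u + b * v) * (C * t + d * q) = (A * d - b * C) * (t * v - u * q)"
    by (simp add: algebra_simps)
  thus ?thesis using assms by simp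
qed

lemma det_coprime:
  assumes "t * v - u * q = (1::int)"
  shows "coprime t q"
proof (rule coprimeI)
  fix c assume "c dvd t" "c dvd q"
  hence "c dvd t * v - u * q" by (intro dvd_diff dvd_mult dvd_mult2) auto
  thus "is_unit c" using assms by simp
qed

lemma power_le_fact_exp:
  assumes "x \<ge> (0::real)"
  shows "x ^ n \<le> fact n * exp x"
proof -
  have "x ^ n /\<^sub>R fact n \<le> exp x"
    using sum_le_suminf[of "\<lambda>n. x ^ n /\<^sub>R fact n" "{n}"] summable_exp_generic[of x] assms
    by (simp add: exp_def)
  thus ?thesis by (simp add: field_simps)
qed
lemma Im_moebius:
  assumes "a * d - b * c = (1::int)" "of_int c * z + of_int d \<noteq> 0"
  shows "Im ((of_int a * z + of_int b) / (of_int c * z + of_int d)) =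
           Im z / (norm (of_int c * z + of_int d))\<^sup>2"
proof -
  have "Im ((of_int a * z + of_int b) * cnj (of_int c * z + of_int d)) = Im z"
    using of_int_det[OF assms(1), where 'a = real] by (simp add: algebra_simps)
  thus ?thesis
    unfolding complex_div_cnj[of "of_int a * z + of_int b"] of_real_power[symmetric] Im_divide_of_real by simp
qed

lemma denominator_nonzero:
  assumes "a * d - b * c = (1::int)" "z \<in> upper_half_plane"
  shows "of_int c * z + of_int d \<noteq> 0"
proof
  assume *: "of_int c * z + of_int d = 0"
  hence "Im (of_int c * z + of_int d) = 0" by simp
  hence "c = 0" using assms(2) by (simp add: upper_half_plane_def)
  with * assms(1) show False by auto
qed

text \<open>
  A substitute for reduction to a fundamental domain. With \<open>N\<close> the ceiling of \<open>1/\<surd>y\<close>, Dirichlet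
  approximation gives a fraction \<open>h/c\<close> with \<open>c \<le> N\<close> and \<open>|c x - h| < 1/N\<close>. Then
  \<open>|c z - h|\<^sup>2 \<le> y + 4 y\<close>, and a matrix with lower row \<open>(c, -h)\<close> divides the imaginary part \<open>y\<close>
  by \<open>|c z - h|\<^sup>2\<close>.
\<close>
lemma exists_high_translate:
  assumes "0 < Im z" "Im z \<le> 1"
  obtains a b c d :: int where "a * d - b * c = 1"
    "1 / 5 \<le> Im ((of_int a * z + of_int b) / (of_int c * z + of_int d))"
proof -
  define y where "y = Im z"
  define N where "N = nat \<lceil>1 / sqrt y\<rceil>"
  have y: "0 < y" "y \<le> 1" using assms by (auto simp: y_def)
  have N: "1 / sqrt y \<le> real N" "real N \<le> 1 / sqrt y + 1"
    unfolding N_def using y by (auto intro!: of_nat_ceiling) 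
  have "0 < 1 / sqrt y" using y by simp
  hence N0: "N > 0" using N(1) by (cases N) auto
  obtain h c where hc: "coprime h c" "0 < c" "c \<le> int N" "\<bar>of_int c * Re z - of_int h\<bar> < 1 / N"
    using Dirichlet_approx_coprime[OF N0] by blast
  obtain u v where uv: "u * h + v * c = 1" using hc(1) by (metis bezout_int coprime_iff_gcd_eq_1)
  define w where "w = of_int c * z + of_int (- h)"
  have det: "(-u) * (-h) - (-v) * c = 1" using uv by simp
  have "z \<in> upper_half_plane" using assms by (simp add: upper_half_plane_def)
  from denominator_nonzero[OF det this] have w0: "w \<noteq> 0" by (simp add: w_def)
  have "1 / real N \<le> sqrt y" using N(1) y N0 by (simp add: field_simps)
  hence "\<bar>of_int c * Re z - of_int h\<bar> \<le> sqrt y" using hc(4) by simp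
  hence 1: "(of_int c * Re z - of_int h)\<^sup>2 \<le> y"
    using y power_mono[of "\<bar>of_int c * Re z - of_int h\<bar>" "sqrt y" 2] by simp
  have "real N * sqrt y \<le> (1 / sqrt y + 1) * sqrt y" using N y by (intro mult_right_mono) auto
  also have "\<dots> = 1 + sqrt y" using y by (simp add: field_simps)
  also have "\<dots> \<le> 2" using y by simp
  finally have "of_int c * sqrt y \<le> 2" using hc(3) y
    by (smt (verit, best) mult_right_mono of_int_le_iff of_int_of_nat_eq real_sqrt_ge_zero)
  hence "(of_int c * sqrt y)\<^sup>2 \<le> 2\<^sup>2" using hc(2) y by (intro power_mono) auto
  hence "(of_int c)\<^sup>2 * y \<le> 4" using y by (simp add: power_mult_distrib)
  hence 2: "(of_int c)\<^sup>2 * y * y \<le> 4 * y" using y by (intro mult_right_mono) auto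
  have "(norm w)\<^sup>2 = (of_int c * Re z - of_int h)\<^sup>2 + (of_int c * y)\<^sup>2"
    by (simp add: cmod_power2 w_def y_def)
  also have "\<dots> \<le> 5 * y" using 1 2 by (simp add: power2_eq_square mult_ac)
  finally have "1 / 5 \<le> y / (norm w)\<^sup>2" using w0 by (simp add: field_simps)
  also have "\<dots> = Im ((of_int (-u) * z + of_int (-v)) / (of_int c * z + of_int (-h)))"
    using Im_moebius[OF det, of z] w0 by (simp add: w_def y_def)
  finally show ?thesis using det by (rule that[rotated])
qed

lemma finite_parseval:
  fixes b :: "nat \<Rightarrow> complex"
  assumes "M > 0"
  shows "(\<Sum>j<M. (norm (\<Sum>n<M. b n * ee (of_nat n * of_nat j / of_nat M)))\<^sup>2) = of_nat M * (\<Sum>n<M. (norm (b n))\<^sup>2)"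
proof -
  have cnj_ee: "cnj (ee (of_nat n * of_nat j / of_nat M)) = ee (- (of_nat n * of_nat j / of_nat M))" for n j
    by (simp add: ee_def exp_cnj)
  have "complex_of_real (\<Sum>j<M. (norm (\<Sum>n<M. b n * ee (of_nat n * of_nat j / of_nat M)))\<^sup>2) =
      (\<Sum>j<M. \<Sum>n<M. \<Sum>m<M. b n * cnj (b m) * ee (of_int (int n - int m) * of_nat j / of_nat M))"
    unfolding of_real_sum complex_norm_square cnj_sum sum_product
    by (intro sum.cong refl)
       (simp add: cnj_ee ee_add[symmetric] diff_divide_distrib ring_distribs mult_ac)
  also have "\<dots> = (\<Sum>n<M. \<Sum>m<M. \<Sum>j<M. b n * cnj (b m) * ee (of_int (int n - int m) * of_nat j / of_nat M))"
    by (rule trans[OF sum.swap], rule sum.cong[OF refl], rule sum.swap)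
  also have "\<dots> = (\<Sum>n<M. \<Sum>m<M. if m = n then b n * cnj (b m) * of_nat M else 0)"
  proof (intro sum.cong refl)
    fix n m assume nm: "n \<in> {..<M}" "m \<in> {..<M}"
    have "int M dvd int n - int m \<longleftrightarrow> m = n"
    proof
      assume "int M dvd int n - int m"
      hence "[int n = int m] (mod int M)" by (simp add: cong_iff_dvd_diff)
      hence "[n = m] (mod M)" by (simp only: cong_int_iff)
      thus "m = n" using nm by (simp add: cong_def)
    qed auto
    thus "(\<Sum>j<M. b n * cnj (b m) * ee (of_int (int n - int m) * of_nat j / of_nat M)) =
          (if m = n then b n * cnj (b m) * of_nat M else 0)"
      unfolding sum_distrib_left[symmetric] sum_ee[OF assms] by simp
  qed
  also have "\<dots> = (\<Sum>n<M. b n * cnj (b n) * of_nat M)"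
    by (intro sum.cong refl) (simp add: sum.delta)
  also have "\<dots> = of_real (of_nat M * (\<Sum>n<M. (norm (b n))\<^sup>2))"
    unfolding of_real_mult of_real_sum complex_norm_square sum_distrib_left by (simp add: mult_ac)
  finally show ?thesis by (simp only: of_real_eq_iff)
qed

text \<open>
  Bessel's inequality without integrals. At the points \<open>j/M\<close> Parseval's identity is exact for a
  trigonometric polynomial with \<open>M\<close> terms, the tail of the series changes the values by at most
  \<open>T M\<close>, and \<open>M\<close> tends to infinity.
\<close>
lemma bessel_sup:
  fixes b :: "nat \<Rightarrow> complex"
  assumes b: "summable (\<lambda>n. norm (b n))"
    and S: "\<And>x::real. norm (\<Sum>n. b n * ee (of_nat n * of_real x)) \<le> S"
  shows "(\<Sum>n<N. (norm (b n))\<^sup>2) \<le> S\<^sup>2"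
proof -
  define T where "T = (\<lambda>M. \<Sum>n. norm (b (n + M)))"
  have T: "T \<longlonglongrightarrow> 0" unfolding T_def by (rule suminf_exist_split2[OF b])
  have "(\<Sum>n<N. (norm (b n))\<^sup>2) \<le> (S + T M)\<^sup>2" if M: "M \<ge> N" "M > 0" for M
  proof -
    have bound: "norm (\<Sum>n<M. b n * ee (of_nat n * of_nat j / of_nat M)) \<le> S + T M" for j
    proof -
      define x where "x = real j / real M"
      define g where "g = (\<lambda>n. b n * ee (of_nat n * of_real x))"
      have ng: "norm (g n) = norm (b n)" for n by (simp add: g_def norm_mult norm_ee)
      hence sg: "summable (\<lambda>n. norm (g n))" using b by simp
      have "(\<Sum>n. g n) = (\<Sum>n. g (n + M)) + (\<Sum>n<M. g n)"
        by (rule suminf_split_initial_segment) (use sg summable_norm_cancel in blast)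
      hence "norm (\<Sum>n<M. g n) = norm ((\<Sum>n. g n) - (\<Sum>n. g (n + M)))" by simp
      also have "\<dots> \<le> norm (\<Sum>n. g n) + norm (\<Sum>n. g (n + M))" by (rule norm_triangle_ineq4)
      also have "norm (\<Sum>n. g (n + M)) \<le> (\<Sum>n. norm (g (n + M)))"
        by (rule summable_norm) (use sg summable_ignore_initial_segment in blast)
      also have "\<dots> = T M" by (simp add: ng T_def)
      finally show ?thesis using S[of x] by (simp add: g_def x_def)
    qed
    have "of_nat M * (\<Sum>n<N. (norm (b n))\<^sup>2) \<le> of_nat M * (\<Sum>n<M. (norm (b n))\<^sup>2)"
      using M by (intro mult_left_mono sum_mono2) auto
    also have "\<dots> = (\<Sum>j<M. (norm (\<Sum>n<M. b n * ee (of_nat n * of_nat j / of_nat M)))\<^sup>2)"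
      by (rule finite_parseval[OF M(2), symmetric])
    also have "\<dots> \<le> (\<Sum>j<M. (S + T M)\<^sup>2)"
      by (intro sum_mono power_mono bound) auto
    finally show ?thesis using M by simp
  qed
  moreover have "(\<lambda>M. (S + T M)\<^sup>2) \<longlonglongrightarrow> (S + 0)\<^sup>2" by (intro tendsto_intros T)
  ultimately show ?thesis
    by (intro Lim_bounded2[of _ "S\<^sup>2" "max N 1"]) auto
qed

text \<open>
  On the block \<open>2\<^sup>J \<le> n < 2\<^bsup>J+1\<^esup>\<close> the weight is at most \<open>2\<^bsup>-J \<tau>\<^esup>\<close> and the sum of the \<open>b n\<close> is at most
  \<open>C 2\<^bsup>(J+1) \<kappa>\<^esup>\<close>, so the blocks are dominated by a geometric series with ratio \<open>2\<^bsup>\<kappa> - \<tau>\<^esup> < 1\<close>.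
\<close>
lemma summable_dyadic:
  fixes b :: "nat \<Rightarrow> real"
  assumes nonneg: "\<And>n. b n \<ge> 0" and C: "\<And>X::nat. X > 0 \<Longrightarrow> (\<Sum>n=1..X. b n) \<le> C * real X powr \<kappa>"
    and "\<kappa> \<ge> 0" "\<tau> > \<kappa>"
  shows "summable (\<lambda>n. b (Suc n) * real (Suc n) powr (-\<tau>))"
proof -
  define g where "g = (\<lambda>n. b n * real n powr (-\<tau>))"
  define \<rho> where "\<rho> = 2 powr (\<kappa> - \<tau>)"
  have \<rho>: "0 < \<rho>" "\<rho> < 1" using assms(4) by (auto simp: \<rho>_def intro: powr_less_one)
  have g0: "g n \<ge> 0" for n using nonneg by (simp add: g_def)
  have C0: "C \<ge> 0" using C[of 1] nonneg[of 1] by simp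
  have block: "(\<Sum>n=2^J..<2^Suc J. g n) \<le> C * 2 powr \<kappa> * \<rho> ^ J" for J
  proof -
    have "(\<Sum>n=2^J..<2^Suc J. g n) \<le> (\<Sum>n=2^J..<2^Suc J. b n * real (2^J) powr (-\<tau>))"
    proof (intro sum_mono)
      fix n :: nat assume n: "n \<in> {2^J..<2^Suc J}"
      have "real n powr (-\<tau>) \<le> real (2^J) powr (-\<tau>)"
        using n assms by (intro powr_mono2') (auto simp: of_nat_le_iff simp del: of_nat_power)
      thus "g n \<le> b n * real (2^J) powr (-\<tau>)" unfolding g_def by (intro mult_left_mono nonneg)
    qed
    also have "\<dots> = (\<Sum>n=2^J..<2^Suc J. b n) * real (2^J) powr (-\<tau>)" by (simp add: sum_distrib_right)
    also have "\<dots> \<le> (\<Sum>n=1..2^Suc J. b n) * real (2^J) powr (-\<tau>)"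
      by (intro mult_right_mono sum_mono2) (use nonneg in \<open>auto simp: Suc_leI\<close>)
    also have "\<dots> \<le> (C * real (2^Suc J) powr \<kappa>) * real (2^J) powr (-\<tau>)"
      by (intro mult_right_mono C) auto
    also have "real (2^Suc J) powr \<kappa> = 2 powr \<kappa> * 2 powr (\<kappa> * J)"
      by (simp add: powr_mult powr_powr mult_ac flip: powr_realpow)
    also have "real (2^J) powr (-\<tau>) = 2 powr (- \<tau> * J)"
      by (simp add: powr_powr mult_ac flip: powr_realpow)
    also have "C * (2 powr \<kappa> * 2 powr (\<kappa> * J)) * 2 powr (- \<tau> * J) = C * 2 powr \<kappa> * 2 powr ((\<kappa> - \<tau>) * J)"
      by (simp add: left_diff_distrib powr_diff powr_minus field_simps)
    also have "2 powr ((\<kappa> - \<tau>) * J) = \<rho> ^ J"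
      unfolding \<rho>_def by (simp add: powr_powr flip: powr_realpow)
    finally show ?thesis by (simp add: mult.assoc)
  qed
  have part: "(\<Sum>n=1..<2^J. g n) \<le> C * 2 powr \<kappa> * (\<Sum>j<J. \<rho> ^ j)" for J
  proof (induction J)
    case (Suc J)
    have "(\<Sum>n=1..<2^Suc J. g n) = (\<Sum>n=1..<2^J. g n) + (\<Sum>n=2^J..<2^Suc J. g n)"
      by (rule sum.atLeastLessThan_concat[symmetric]) auto
    also have "\<dots> \<le> C * 2 powr \<kappa> * (\<Sum>j<J. \<rho> ^ j) + C * 2 powr \<kappa> * \<rho> ^ J"
      by (intro add_mono Suc.IH block)
    finally show ?case by (simp add: distrib_left)
  qed auto
  show ?thesis
  proof (rule summableI_nonneg_bounded)
    fix N
    have sub: "{1..<Suc N} \<subseteq> {1..<2 ^ N}"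
      using Suc_leI[OF less_exp[of N]] by (meson atLeastLessThan_iff less_le_trans subsetI)
    have "(\<Sum>n<N. b (Suc n) * real (Suc n) powr (-\<tau>)) = (\<Sum>n=1..<Suc N. g n)"
      using sum.shift_bounds_Suc_ivl[of g 0 N] by (simp only: lessThan_atLeast0 One_nat_def g_def)
    also have "\<dots> \<le> (\<Sum>n=1..<2^N. g n)"
      by (rule sum_mono2[OF _ sub]) (use g0 in auto)
    also have "\<dots> \<le> C * 2 powr \<kappa> * (\<Sum>j<N. \<rho> ^ j)" by (rule part)
    also have "\<dots> \<le> C * 2 powr \<kappa> * (1 / (1 - \<rho>))"
    proof (intro mult_left_mono)
      have "(\<Sum>j<N. \<rho> ^ j) \<le> (\<Sum>j. \<rho> ^ j)" by (rule sum_le_suminf) (use \<rho> in auto)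
      thus "(\<Sum>j<N. \<rho> ^ j) \<le> 1 / (1 - \<rho>)" using \<rho> by (simp add: suminf_geometric)
    qed (use C0 in auto)
    finally show "(\<Sum>n<N. b (Suc n) * real (Suc n) powr (-\<tau>)) \<le> C * 2 powr \<kappa> * (1 / (1 - \<rho>))" .
  qed (use nonneg in auto)
qed

context eigenform
begin

lemma fourier_abs_summable:
  assumes "y > 0"
  shows "summable (\<lambda>n. norm (a n) * exp (- 2 * pi * y) ^ n)"
proof -
  define x where "x = ee (\<i> * of_real (y / 2))"
  have "\<i> * of_real (y / 2) \<in> upper_half_plane" using assms by (simp add: upper_half_plane_def)
  hence "summable (\<lambda>n. a n * x ^ n)"
    using fourier unfolding has_fourier_expansion_def x_def ee_of_nat_mult by (meson sums_summable)
  from powser_insidea[OF this, of "of_real (exp (- 2 * pi * y))"] show ?thesis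
    using assms by (simp add: x_def norm_ee norm_mult norm_power)
qed

text \<open>
  The constant coefficient vanishes, so one factor \<open>|e(z)|\<close> can be taken out of the whole series; what
  remains is largest at \<open>Im z = y\<^sub>0\<close>.
\<close>
lemma decay:
  assumes "y0 > 0"
  obtains B where "B \<ge> 0" "\<And>z. Im z \<ge> y0 \<Longrightarrow> norm (f z) \<le> B * exp (- 2 * pi * Im z)"
proof
  define r where "r = exp (- 2 * pi * y0)"
  define B where "B = (\<Sum>n. norm (a n) * r ^ n) / r"
  have r: "r > 0" by (simp add: r_def)
  have sm: "summable (\<lambda>n. norm (a n) * r ^ n)" unfolding r_def by (rule fourier_abs_summable[OF assms])
  show "B \<ge> 0" unfolding B_def using r by (intro divide_nonneg_nonneg suminf_nonneg sm) auto
  fix z assume z: "Im z \<ge> y0"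
  define w where "w = exp (- 2 * pi * Im z)"
  have w: "0 < w" "w \<le> r" using z by (auto simp: w_def r_def)
  have zu: "z \<in> upper_half_plane" using z assms by (simp add: upper_half_plane_def)
  have norm_t: "norm (a n * ee (of_nat n * z)) = norm (a n) * w ^ n" for n
    unfolding ee_of_nat_mult by (simp add: norm_mult norm_power norm_ee w_def)
  have le: "norm (a n) * w ^ n \<le> norm (a n) * r ^ n * (w / r)" for n
  proof (cases n)
    case 0 thus ?thesis by (simp add: a_0)
  next
    case (Suc m)
    have "w ^ m \<le> r ^ m" using w by (intro power_mono) auto
    hence "norm (a n) * w * w ^ m \<le> norm (a n) * w * r ^ m" using w by (intro mult_left_mono) auto
    thus ?thesis using Suc r by (simp add: mult_ac)
  qed
  have sm': "summable (\<lambda>n. norm (a n) * r ^ n * (w / r))" by (rule summable_mult2[OF sm])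
  have smw: "summable (\<lambda>n. norm (a n * ee (of_nat n * z)))" unfolding norm_t
    by (rule summable_comparison_test'[OF sm', of 0]) (use le w in auto)
  have "f z = (\<Sum>n. a n * ee (of_nat n * z))"
    using fourier zu unfolding has_fourier_expansion_def by (simp add: sums_unique)
  hence "norm (f z) \<le> (\<Sum>n. norm (a n * ee (of_nat n * z)))" using summable_norm[OF smw] by simp
  also have "\<dots> \<le> (\<Sum>n. norm (a n) * r ^ n * (w / r))"
    using smw unfolding norm_t by (intro suminf_le le sm')
  also have "\<dots> = B * w" using suminf_mult2[OF sm, of "w / r"] by (simp add: B_def)
  finally show "norm (f z) \<le> B * exp (- 2 * pi * Im z)" by (simp add: w_def)
qed

lemma f_transform:
  assumes "a' * d - b * c = (1::int)" "z \<in> upper_half_plane"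
  shows "f ((of_int a' * z + of_int b) / (of_int c * z + of_int d)) = (of_int c * z + of_int d) ^ k * f z"
  using modular[unfolded modular_invariant_def, rule_format, OF assms] .

text \<open>
  The function \<open>|f(z)| (Im z)\<^bsup>k/2\<^esup>\<close> is invariant under \<open>SL\<^sub>2(\<int>)\<close>, so it suffices to bound it where
  \<open>Im z \<ge> 1/5\<close>, and there \<open>f\<close> decays exponentially.
\<close>
lemma hecke_bound:
  obtains C where "C \<ge> 0" "\<And>z. z \<in> upper_half_plane \<Longrightarrow> norm (f z) * Im z ^ (k div 2) \<le> C"
proof -
  define K where "K = k div 2"
  have k: "k = 2 * K" using even_k by (auto simp: K_def)
  obtain B where B: "B \<ge> 0" "\<And>z. Im z \<ge> 1/5 \<Longrightarrow> norm (f z) \<le> B * exp (- 2 * pi * Im z)"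
    using decay[of "1/5"] by auto
  have high: "norm (f z) * Im z ^ K \<le> B * fact K" if "Im z \<ge> 1/5" for z
  proof -
    have y: "Im z > 0" using that by simp
    have "Im z ^ K \<le> fact K * exp (Im z)" using y by (intro power_le_fact_exp) simp
    also have "exp (Im z) \<le> exp (2 * pi * Im z)"
      using y pi_gt3 by simp
    finally have 1: "Im z ^ K \<le> fact K * exp (2 * pi * Im z)" by simp
    have "norm (f z) * Im z ^ K \<le> (B * exp (- 2 * pi * Im z)) * (fact K * exp (2 * pi * Im z))"
      using B that y 1 by (intro mult_mono) auto
    also have "\<dots> = B * fact K" by (simp add: exp_minus)
    finally show ?thesis .
  qed
  have "norm (f z) * Im z ^ K \<le> B * fact K" if z: "z \<in> upper_half_plane" for z
  proof (cases "Im z \<le> 1")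
    case True
    have y: "0 < Im z" using z by (simp add: upper_half_plane_def)
    obtain a' b c d where det: "a' * d - b * c = (1::int)"
      and hi: "1 / 5 \<le> Im ((of_int a' * z + of_int b) / (of_int c * z + of_int d))"
      by (rule exists_high_translate[OF y True])
    define j where "j = of_int c * z + of_int d"
    define w where "w = (of_int a' * z + of_int b) / j"
    have j: "j \<noteq> 0" unfolding j_def by (rule denominator_nonzero[OF det z])
    have "norm (f w) = norm j ^ k * norm (f z)"
      using f_transform[OF det z] by (simp add: w_def j_def norm_mult norm_power)
    moreover have "Im w = Im z / (norm j)\<^sup>2"
      using Im_moebius[OF det, of z] j by (simp add: w_def j_def)
    ultimately have "norm (f w) * Im w ^ K = norm (f z) * Im z ^ K"
      using j by (simp add: power_divide k power_mult)
    thus ?thesis using high[of w] hi by (simp add: w_def j_def)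
  qed (use high[of z] in auto)
  thus ?thesis using that[of "B * fact K"] B(1) by (auto simp: K_def)
qed

text \<open>
  Bessel's inequality on the horizontal line at height \<open>1/X\<close>: there \<open>|f|\<close> is \<open>O(X\<^bsup>k/2\<^esup>)\<close>, while
  the factor \<open>e\<^bsup>-2\<pi>n/X\<^esup>\<close> stays above \<open>e\<^bsup>-2\<pi>\<^esup>\<close> for \<open>n \<le> X\<close>.
\<close>
lemma mean_square:
  obtains C where "\<And>X::nat. X > 0 \<Longrightarrow> (\<Sum>n=1..X. (norm (a n))\<^sup>2) \<le> C * real X powr real k"
proof -
  define K where "K = k div 2"
  have k: "k = 2 * K" using even_k by (auto simp: K_def)
  obtain C where C: "C \<ge> 0" "\<And>z. z \<in> upper_half_plane \<Longrightarrow> norm (f z) * Im z ^ K \<le> C"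
    using hecke_bound by (auto simp: K_def)
  have "(\<Sum>n=1..X. (norm (a n))\<^sup>2) \<le> (C\<^sup>2 * exp (4 * pi)) * real X powr real k" if X: "X > 0" for X :: nat
  proof -
    define y where "y = 1 / real X"
    have y: "y > 0" using X by (simp add: y_def)
    define b where "b = (\<lambda>n. a n * of_real (exp (- 2 * pi * y) ^ n))"
    have nb: "norm (b n) = norm (a n) * exp (- 2 * pi * y) ^ n" for n by (simp add: b_def norm_mult norm_power)
    have bes: "(\<Sum>n<Suc X. (norm (b n))\<^sup>2) \<le> (C * real X ^ K)\<^sup>2"
    proof (rule bessel_sup)
      show "summable (\<lambda>n. norm (b n))" unfolding nb by (rule fourier_abs_summable[OF y])
      fix x :: real
      define z where "z = Complex x y"
      have z: "z \<in> upper_half_plane" using y by (simp add: z_def upper_half_plane_def)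
      have ee_z: "ee z = ee (of_real x) * of_real (exp (- 2 * pi * y))"
      proof -
        have "z = of_real x + \<i> * of_real y" by (simp add: z_def complex_eq_iff)
        moreover have "ee (\<i> * of_real y) = of_real (exp (- 2 * pi * y))"
          by (simp add: ee_def exp_of_real[symmetric] mult_ac)
        ultimately show ?thesis by (simp add: ee_add)
      qed
      have "b n * ee (of_nat n * of_real x) = a n * ee (of_nat n * z)" for n
        unfolding ee_of_nat_mult ee_z b_def by (simp add: power_mult_distrib)
      moreover have "(\<lambda>n. a n * ee (of_nat n * z)) sums f z"
        using fourier z unfolding has_fourier_expansion_def by blast
      ultimately have "(\<Sum>n. b n * ee (of_nat n * of_real x)) = f z" by (simp add: sums_iff)
      moreover have "norm (f z) \<le> C * real X ^ K"
        using C(2)[OF z] X by (simp add: z_def y_def power_divide field_simps)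
      ultimately show "norm (\<Sum>n. b n * ee (of_nat n * of_real x)) \<le> C * real X ^ K" by simp
    qed
    have "(\<Sum>n=1..X. (norm (a n))\<^sup>2) \<le> (\<Sum>n=1..X. exp (4 * pi) * (norm (b n))\<^sup>2)"
    proof (intro sum_mono)
      fix n assume n: "n \<in> {1..X}"
      have "exp (- 2 * pi * y) ^ n = exp (- (2 * pi * y * real n))" by (simp add: exp_of_nat_mult[symmetric] mult_ac)
      also have "\<dots> \<ge> exp (- (2 * pi))"
      proof -
        have "y * real n \<le> 1" using n X by (simp add: y_def)
        hence "2 * pi * (y * real n) \<le> 2 * pi * 1" by (intro mult_left_mono) auto
        thus ?thesis by (simp add: mult_ac)
      qed
      finally have "norm (b n) \<ge> norm (a n) * exp (- (2 * pi))" unfolding nb by (intro mult_left_mono) auto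
      hence "(norm (a n) * exp (- (2 * pi)))\<^sup>2 \<le> (norm (b n))\<^sup>2" by (intro power_mono) auto
      hence "exp (4 * pi) * (norm (a n) * exp (- (2 * pi)))\<^sup>2 \<le> exp (4 * pi) * (norm (b n))\<^sup>2"
        by (intro mult_left_mono) auto
      moreover have "exp (4 * pi) * (norm (a n) * exp (- (2 * pi)))\<^sup>2 = (norm (a n))\<^sup>2"
        by (simp add: power_mult_distrib exp_double[symmetric] exp_minus field_simps)
      ultimately show "(norm (a n))\<^sup>2 \<le> exp (4 * pi) * (norm (b n))\<^sup>2" by simp
    qed
    also have "\<dots> \<le> exp (4 * pi) * (\<Sum>n<Suc X. (norm (b n))\<^sup>2)"
      unfolding sum_distrib_left[symmetric] by (intro mult_left_mono sum_mono2) auto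
    also have "\<dots> \<le> exp (4 * pi) * (C * real X ^ K)\<^sup>2" by (intro mult_left_mono bes) auto
    also have "\<dots> = (C\<^sup>2 * exp (4 * pi)) * real X ^ k"
      by (simp add: k power_mult_distrib power_mult[symmetric] mult_ac)
    also have "real X ^ k = real X powr real k" by (rule powr_realpow[symmetric]) (use X in simp)
    finally show ?thesis .
  qed
  thus ?thesis using that by blast
qed

text \<open>
  The mean square controls the first power because \<open>x \<le> x\<^sup>2 + 1\<close>. In this way the series converges
  absolutely on all of \<open>Re s > 1\<close> without Deligne's bound; Hecke's bound for the single
  coefficients would only give \<open>Re s > 3/2\<close>.
\<close>
lemma lam_summable:
  assumes "\<sigma> > 1"
  shows "summable (\<lambda>n. norm (lam (Suc n)) * real (Suc n) powr (-\<sigma>))"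
proof -
  let ?A = "\<lambda>n. (norm (a (Suc n)))\<^sup>2 * real (Suc n) powr (-(real k - 1 + \<sigma>))"
  obtain C where C: "\<And>X::nat. X > 0 \<Longrightarrow> (\<Sum>n=1..X. (norm (a n))\<^sup>2) \<le> C * real X powr real k"
    using mean_square by blast
  have "summable (\<lambda>n. ?A n)"
    by (rule summable_dyadic[of "\<lambda>n. (norm (a n))\<^sup>2" C "real k"]) (use C assms in auto)
  moreover have "summable (\<lambda>n. real (Suc n) powr (-\<sigma>))"
    using assms by (subst summable_Suc_iff) (simp add: summable_real_powr_iff)
  ultimately have "summable (\<lambda>n. ?A n + real (Suc n) powr (-\<sigma>))"
    by (rule summable_add)
  thus ?thesis
  proof (rule summable_comparison_test'[of _ 0])
    fix n :: nat
    define x where "x = norm (lam (Suc n))"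
    have "x\<^sup>2 * real (Suc n) powr (-\<sigma>) = (norm (a (Suc n)))\<^sup>2 * (real (Suc n) powr (- (real k - 1)) * real (Suc n) powr (-\<sigma>))"
      by (simp add: x_def lam_def norm_divide power_divide powr_minus field_simps power2_eq_square flip: powr_add)
    also have "real (Suc n) powr (- (real k - 1)) * real (Suc n) powr (-\<sigma>) = real (Suc n) powr (-(real k - 1 + \<sigma>))"
      by (simp flip: powr_add)
    finally have "?A n = x\<^sup>2 * real (Suc n) powr (-\<sigma>)" by simp
    moreover have "x \<le> x\<^sup>2 + 1" using sum_power2_ge_zero[of "x - 1" x] by (simp add: power2_eq_square algebra_simps)
    hence "x * real (Suc n) powr (-\<sigma>) \<le> (x\<^sup>2 + 1) * real (Suc n) powr (-\<sigma>)" by (intro mult_right_mono) auto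
    ultimately show "norm (norm (lam (Suc n)) * real (Suc n) powr (-\<sigma>)) \<le>
        ?A n + real (Suc n) powr (-\<sigma>)"
      by (simp add: x_def distrib_right)
  qed
qed

end


section \<open>Mellin transforms of rapidly decaying functions\<close>

text \<open>
  The exponent \<open>N\<close> runs over all real numbers, so that large \<open>N\<close> express decay at \<open>0\<close> and very negative
  \<open>N\<close> express decay at infinity.
\<close>
definition rapid_decay :: "(real \<Rightarrow> complex) \<Rightarrow> bool" where
  "rapid_decay g \<longleftrightarrow>
     continuous_on {0<..} g \<and> (\<forall>N. \<exists>K. \<forall>y>0. norm (g y) \<le> K * y powr N)"

definition mellin :: "(real \<Rightarrow> complex) \<Rightarrow> complex \<Rightarrow> complex" where
  "mellin g s = (LINT y:{0<..}|lborel. g y * of_real y powr (s - 1))"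

lemma powr_eq_exp: "y > 0 \<Longrightarrow> complex_of_real y powr s = exp (s * of_real (ln y))"
  by (simp add: powr_def Ln_of_real)

text \<open>
  One dominating function serves a whole vertical strip: there \<open>y\<^bsup>Re s - 1\<^esup> \<le> y\<^sup>R + y\<^bsup>-R\<^esup>\<close>, and
  each of the four products with \<open>1\<close> and \<open>y\<^sup>2\<close> is absorbed by one power in \<open>rapid_decay\<close>.
\<close>
lemma rapid_decay_dominated:
  assumes "rapid_decay g"
  obtains K where "K \<ge> 0" "\<And>s y. y > 0 \<Longrightarrow> \<bar>Re s - 1\<bar> \<le> R \<Longrightarrow>
    norm (g y * of_real y powr (s - 1)) \<le> K * inverse (1 + y\<^sup>2)"
proof -
  obtain K where K: "\<And>N y. y > 0 \<Longrightarrow> norm (g y) \<le> K N * y powr N"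
    using assms unfolding rapid_decay_def by metis
  have K': "norm (g y) * y powr (- N) \<le> K N" if "y > 0" for y N
  proof -
    have "norm (g y) * y powr (- N) \<le> K N * y powr N * y powr (- N)"
      using K[OF that, of N] by (intro mult_right_mono) auto
    also have "\<dots> = K N" using that by (simp add: powr_minus)
    finally show ?thesis .
  qed
  define L where "L = K (- R) + K R + K (- (R + 2)) + K (- (2 - R))"
  have *: "norm (g y * of_real y powr (s - 1)) \<le> L * inverse (1 + y\<^sup>2)"
    if y: "y > 0" and s: "\<bar>Re s - 1\<bar> \<le> R" for s y
  proof -
    have "y powr (Re s - 1) \<le> y powr R + y powr (- R)"
    proof (cases "y \<ge> 1")
      case True
      hence "y powr (Re s - 1) \<le> y powr R" using s by (intro powr_mono) auto
      thus ?thesis by (simp add: add_increasing2)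
    next
      case False
      hence "y powr (Re s - 1) \<le> y powr (- R)" using s y by (intro powr_mono') auto
      thus ?thesis by (simp add: add_increasing)
    qed
    hence "norm (g y) * y powr (Re s - 1) * (1 + y\<^sup>2) \<le> norm (g y) * (y powr R + y powr (- R)) * (1 + y\<^sup>2)"
      by (intro mult_right_mono mult_left_mono) auto
    also have "y\<^sup>2 = y powr 2" using y by simp
    also have "norm (g y) * (y powr R + y powr (- R)) * (1 + y powr 2) =
        norm (g y) * y powr (- (- R)) + norm (g y) * y powr (- R) +
        norm (g y) * y powr (- (- (R + 2))) + norm (g y) * y powr (- (- (2 - R)))"
      using y by (simp add: powr_add powr_diff powr_minus field_simps)
    also have "\<dots> \<le> L" unfolding L_def by (intro add_mono K'[OF y])
    finally have "norm (g y) * y powr (Re s - 1) * (1 + y\<^sup>2) \<le> L" using y by simp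
    moreover have "norm (g y * of_real y powr (s - 1)) = norm (g y) * y powr (Re s - 1)"
      using y by (simp add: norm_mult norm_powr_real_powr)
    moreover have "1 + y\<^sup>2 > 0" by (simp add: add_pos_nonneg)
    ultimately show ?thesis by (simp add: field_simps)
  qed
  have "K N \<ge> 0" for N using order_trans[OF norm_ge_zero K[of 1 N]] by simp
  hence "L \<ge> 0" by (simp add: L_def)
  thus ?thesis using * by (rule that)
qed

lemma integrable_inverse_square:
  "set_integrable lborel {0<..} (\<lambda>y::real. inverse (1 + y\<^sup>2))"
  by (rule set_integrable_subset[OF integrable_inverse_1_plus_square]) auto

lemma rapid_decay_integrable:
  assumes "rapid_decay g"
  shows "set_integrable lborel {0<..} (\<lambda>y. g y * of_real y powr (s - 1))"
proof -
  obtain K where K: "K \<ge> 0" "\<And>s' y. y > 0 \<Longrightarrow> \<bar>Re s' - 1\<bar> \<le> \<bar>Re s - 1\<bar> \<Longrightarrow>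
    norm (g y * of_real y powr (s' - 1)) \<le> K * inverse (1 + y\<^sup>2)"
    using rapid_decay_dominated[OF assms, of "\<bar>Re s - 1\<bar>"] by blast
  show ?thesis
  proof (rule set_integrable_bound)
    show "set_integrable lborel {0<..} (\<lambda>y. K * inverse (1 + y\<^sup>2))"
      by (intro set_integrable_mult_right integrable_inverse_square)
    have "continuous_on {0<..} (\<lambda>y. g y * exp ((s - 1) * of_real (ln y)))"
      using assms unfolding rapid_decay_def by (auto intro!: continuous_intros)
    hence "continuous_on {0<..} (\<lambda>y. g y * of_real y powr (s - 1))"
      by (rule continuous_on_eq) (simp add: powr_eq_exp)
    hence "(\<lambda>y. indicat_real {0<..} y *\<^sub>R (g y * of_real y powr (s - 1))) \<in> borel_measurable borel"
      by (rule borel_measurable_continuous_on_indicator[rotated]) simp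
    thus "set_borel_measurable lborel {0<..} (\<lambda>y. g y * of_real y powr (s - 1))"
      by (simp add: set_borel_measurable_def)
    show "AE y in lborel. y \<in> {0<..} \<longrightarrow> norm (g y * of_real y powr (s - 1)) \<le> norm (K * inverse (1 + y\<^sup>2))"
    proof (rule AE_I2, rule impI)
      fix y :: real assume "y \<in> {0<..}"
      hence "norm (g y * of_real y powr (s - 1)) \<le> K * inverse (1 + y\<^sup>2)" by (intro K(2)) auto
      also have "\<dots> \<le> norm (K * inverse (1 + y\<^sup>2))" by simp
      finally show "norm (g y * of_real y powr (s - 1)) \<le> norm (K * inverse (1 + y\<^sup>2))" .
    qed
  qed
qed

lemma UN_expanding_intervals: "(\<Union>n. {1 / real (Suc n)..real (Suc n)}) = {0<..}"
proof (intro equalityI subsetI)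
  fix y assume "y \<in> (\<Union>n. {1 / real (Suc n)..real (Suc n)})"
  then obtain n where n: "1 / real (Suc n) \<le> y" by auto
  moreover have "0 < 1 / real (Suc n)" by simp
  ultimately show "y \<in> {0<..}" unfolding greaterThan_iff by linarith
next
  fix y :: real assume y: "y \<in> {0<..}"
  obtain n where n: "max y (1 / y) < real n" using reals_Archimedean2 by blast
  hence "1 / y < real (Suc n)" "y < real (Suc n)" by auto
  hence "1 / real (Suc n) \<le> y" "y \<le> real (Suc n)" using y by (auto simp: field_simps)
  thus "y \<in> (\<Union>n. {1 / real (Suc n)..real (Suc n)})" by (intro UN_I[of n]) auto
qed

lemma incseq_expanding_intervals: "incseq (\<lambda>n. {1 / real (Suc n)..real (Suc n)})"
  by (rule incseq_SucI) (auto simp: field_simps)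

text \<open>
  The integrals over \<open>[1/(n+1), n+1]\<close> are holomorphic by differentiation under the integral sign, and
  by domination they converge uniformly on every disc of radius \<open>1\<close>.
\<close>
lemma mellin_holomorphic:
  assumes g: "rapid_decay g"
  shows "mellin g holomorphic_on UNIV"
proof -
  define A where "A = (\<lambda>n. {1 / real (Suc n)..real (Suc n)})"
  define F where "F = (\<lambda>n s. integral (A n) (\<lambda>y. g y * of_real y powr (s - 1)))"
  define h where "h = (\<lambda>y::real. inverse (1 + y\<^sup>2))"
  define err where "err = (\<lambda>n. (LINT y:{0<..}|lborel. h y) - (LINT y:A n|lborel. h y))"
  have A_sub: "A n \<subseteq> {0<..}" for n using UN_expanding_intervals by (auto simp: A_def)
  have h_int: "set_integrable lborel {0<..} h" unfolding h_def by (rule integrable_inverse_square)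
  have U: "(\<Union>n. A n) = {0<..}" by (simp only: A_def UN_expanding_intervals)
  have "(\<lambda>n. LINT y:A n|lborel. h y) \<longlonglongrightarrow> (LINT y:(\<Union>n. A n)|lborel. h y)"
  proof (rule set_integral_cont_up)
    show "A n \<in> sets lborel" for n by (simp add: A_def)
    show "incseq A" by (simp only: A_def incseq_expanding_intervals)
    show "set_integrable lborel (\<Union>n. A n) h" unfolding U by (rule h_int)
  qed
  hence "err \<longlonglongrightarrow> (LINT y:{0<..}|lborel. h y) - (LINT y:{0<..}|lborel. h y)"
    unfolding err_def U by (intro tendsto_intros)
  hence err: "err \<longlonglongrightarrow> 0" by simp
  show ?thesis
  proof (rule holomorphic_uniform_sequence[of UNIV F])
    fix n
    have "(\<lambda>s. integral (cbox (1 / real (Suc n)) (real (Suc n))) (\<lambda>y. g y * exp ((s - 1) * of_real (ln y))))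
            holomorphic_on UNIV"
    proof (rule leibniz_rule_holomorphic)
      fix s :: complex and t :: real
      show "((\<lambda>s. g t * exp ((s - 1) * of_real (ln t))) has_field_derivative
              g t * (exp ((s - 1) * of_real (ln t)) * of_real (ln t))) (at s within UNIV)"
        by (auto intro!: derivative_eq_intros)
    next
      fix s :: complex
      have "continuous_on (A n) (\<lambda>y. g y * exp ((s - 1) * of_real (ln y)))"
        using continuous_on_subset[OF _ A_sub[of n]] g A_sub[of n] unfolding rapid_decay_def
        by (auto intro!: continuous_intros)
      thus "(\<lambda>y. g y * exp ((s - 1) * of_real (ln y))) integrable_on cbox (1 / real (Suc n)) (real (Suc n))"
        unfolding A_def by (intro integrable_continuous) (simp add: cbox_interval)
    next
      have "continuous_on (UNIV \<times> A n) (\<lambda>p. g (snd p) * (exp ((fst p - 1) * of_real (ln (snd p))) * of_real (ln (snd p))))"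
        using A_sub[of n] g unfolding rapid_decay_def
        by (auto intro!: continuous_intros continuous_on_compose2[of "{0<..}" g])
      thus "continuous_on (UNIV \<times> cbox (1 / real (Suc n)) (real (Suc n)))
              (\<lambda>(s, t). g t * (exp ((s - 1) * of_real (ln t)) * of_real (ln t)))"
        by (simp add: A_def cbox_interval case_prod_beta)
    qed auto
    moreover have "integral (cbox (1 / real (Suc n)) (real (Suc n))) (\<lambda>y. g y * exp ((s - 1) * of_real (ln y))) = F n s" for s
      unfolding F_def cbox_interval A_def
      by (rule integral_cong) (use A_sub[of n] in \<open>auto simp: A_def powr_eq_exp subset_iff\<close>)
    ultimately show "F n holomorphic_on UNIV" by simp
  next
    fix s0 :: complex
    define R where "R = \<bar>Re s0 - 1\<bar> + 1"
    obtain K where K: "K \<ge> 0" "\<And>s y. y > 0 \<Longrightarrow> \<bar>Re s - 1\<bar> \<le> R \<Longrightarrow>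
        norm (g y * of_real y powr (s - 1)) \<le> K * h y"
      using rapid_decay_dominated[OF g, of R] unfolding h_def by blast
    have diff: "dist (F n s) (mellin g s) \<le> K * err n" if s: "s \<in> cball s0 1" for n s
    proof -
      define \<phi> where "\<phi> = (\<lambda>y. g y * of_real y powr (s - 1))"
      have "\<bar>Re s - Re s0\<bar> \<le> 1" using s abs_Re_le_cmod[of "s - s0"] by (simp add: dist_norm norm_minus_commute)
      hence R: "\<bar>Re s - 1\<bar> \<le> R" by (simp add: R_def)
      have int: "set_integrable lborel {0<..} \<phi>" unfolding \<phi>_def by (rule rapid_decay_integrable[OF g])
      have sub: "set_integrable lborel (A n) \<psi>" "set_integrable lborel ({0<..} - A n) \<psi>"
        if "set_integrable lborel {0<..} \<psi>" for \<psi> :: "real \<Rightarrow> 'x::{banach, second_countable_topology}"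
        using set_integrable_subset[OF that] A_sub[of n] by (auto simp: A_def)
      have split: "(LINT y:{0<..}|lborel. \<psi> y) = (LINT y:A n|lborel. \<psi> y) + (LINT y:{0<..} - A n|lborel. \<psi> y)"
        if "set_integrable lborel {0<..} \<psi>" for \<psi> :: "real \<Rightarrow> 'x::{banach, second_countable_topology}"
        using set_integral_Un[OF _ sub[OF that]] A_sub[of n] by (simp add: Un_absorb1)
      have "F n s = (LINT y:A n|lborel. \<phi> y)"
        using set_borel_integral_eq_integral(2)[OF sub(1)[OF int]] by (simp add: F_def \<phi>_def)
      hence "dist (F n s) (mellin g s) = norm (LINT y:{0<..} - A n|lborel. \<phi> y)"
        using split[OF int] by (simp add: mellin_def \<phi>_def[symmetric] dist_norm)
      also have "\<dots> \<le> (LINT y:{0<..} - A n|lborel. norm (\<phi> y))"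
        by (rule set_integral_norm_bound) (rule sub(2)[OF int])
      also have "\<dots> \<le> (LINT y:{0<..} - A n|lborel. K * h y)"
        using K(2) R by (intro set_integral_mono set_integrable_norm set_integrable_mult_right sub(2) int h_int)
          (auto simp: \<phi>_def)
      also have "\<dots> = K * err n" using split[OF h_int] by (simp add: err_def)
      finally show ?thesis .
    qed
    have lim: "(\<lambda>n. K * err n) \<longlonglongrightarrow> 0" using tendsto_mult_right_zero[OF err] by simp
    have "uniform_limit (cball s0 1) F (mellin g) sequentially"
    proof (rule uniform_limitI)
      fix e :: real assume "e > 0"
      with lim have "\<forall>\<^sub>F n in sequentially. K * err n < e" by (rule order_tendstoD)
      thus "\<forall>\<^sub>F n in sequentially. \<forall>s\<in>cball s0 1. dist (F n s) (mellin g s) < e"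
        by (rule eventually_mono) (intro ballI, rule le_less_trans[OF diff])
    qed
    thus "\<exists>d>0. cball s0 d \<subseteq> UNIV \<and> uniform_limit (cball s0 d) F (mellin g) sequentially"
      by (intro exI[of _ 1]) auto
  qed auto
qed

text \<open>Euler's integral after the substitution \<open>t = c y\<close>.\<close>
lemma Gamma_integral_scaled:
  assumes "Re s > 0" "c > 0"
  shows "set_integrable lborel {0<..} (\<lambda>y. of_real y powr (s - 1) * of_real (exp (- c * y)))"
    and "(LINT y:{0<..}|lborel. of_real y powr (s - 1) * of_real (exp (- c * y))) = Gamma s * of_real c powr (- s)"
proof -
  define F where "F = (\<lambda>y::real. indicat_real {0<..} y *\<^sub>R (of_real y powr (s - 1) / complex_of_real (exp y)))"
  define G where "G = (\<lambda>y::real. indicat_real {0<..} y *\<^sub>R (of_real y powr (s - 1) * complex_of_real (exp (- c * y))))"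
  have "continuous_on {0<..} (\<lambda>y. exp ((s - 1) * of_real (ln y)) / complex_of_real (exp y))"
    by (auto intro!: continuous_intros)
  hence "continuous_on {0<..} (\<lambda>y. of_real y powr (s - 1) / complex_of_real (exp y))"
    by (rule continuous_on_eq) (simp add: powr_eq_exp)
  hence "F \<in> borel_measurable borel" unfolding F_def
    by (rule borel_measurable_continuous_on_indicator[rotated]) simp
  hence F_int: "integrable lborel F"
    using absolutely_integrable_Gamma_integral'[OF assms(1)] integrable_completion[of F lborel]
    unfolding F_def set_integrable_def by simp
  have F_val: "integral\<^sup>L lborel F = Gamma s"
    using set_borel_integral_eq_integral(2)[of "{0<..}" "\<lambda>y. of_real y powr (s - 1) / complex_of_real (exp y)"]
      F_int integral_unique[OF Gamma_integral_complex'[OF assms(1)]]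
    unfolding F_def set_integrable_def set_lebesgue_integral_def by simp
  have cp: "of_real c powr s = of_real c powr (s - 1) * complex_of_real c"
    using assms(2) powr_add[of "complex_of_real c" "s - 1" 1] by simp
  have FG: "F (0 + c * y) = of_real c powr (s - 1) * G y" for y
  proof (cases "y > 0")
    case True
    have "complex_of_real (c * y) powr (s - 1) = of_real c powr (s - 1) * of_real y powr (s - 1)"
      unfolding of_real_mult by (rule powr_times_real) (use assms True in auto)
    thus ?thesis using True assms by (simp add: F_def G_def exp_minus divide_inverse mult_ac)
  next
    case False
    hence "\<not> 0 < c * y" using assms by (simp add: zero_less_mult_iff)
    thus ?thesis using False by (simp add: F_def G_def)
  qed
  have nz: "complex_of_real c powr (s - 1) \<noteq> 0" using assms by simp
  have "integrable lborel (\<lambda>y. F (0 + c * y))"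
    using F_int lborel_integrable_real_affine_iff[of c F 0] assms by simp
  hence "integrable lborel (\<lambda>y. of_real c powr (s - 1) * G y)" unfolding FG .
  hence "integrable lborel (\<lambda>y. inverse (of_real c powr (s - 1)) * (of_real c powr (s - 1) * G y))"
    by (rule integrable_mult_right)
  moreover have "(\<lambda>y. inverse (of_real c powr (s - 1)) * (of_real c powr (s - 1) * G y)) = G"
    unfolding mult.assoc[symmetric] left_inverse[OF nz] by simp
  ultimately have G_int: "integrable lborel G" by (simp only:)
  thus "set_integrable lborel {0<..} (\<lambda>y. of_real y powr (s - 1) * of_real (exp (- c * y)))"
    by (simp add: set_integrable_def G_def)
  have "Gamma s = c *\<^sub>R integral\<^sup>L lborel (\<lambda>y. F (0 + c * y))"
    using lborel_integral_real_affine[of c F 0] assms F_val by simp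
  also have "\<dots> = of_real c * (of_real c powr (s - 1) * integral\<^sup>L lborel G)"
    unfolding FG by (simp add: scaleR_conv_of_real)
  also have "\<dots> = of_real c powr s * integral\<^sup>L lborel G" by (simp add: cp)
  finally show "(LINT y:{0<..}|lborel. of_real y powr (s - 1) * of_real (exp (- c * y))) = Gamma s * of_real c powr (- s)"
    unfolding set_lebesgue_integral_def G_def[symmetric] using assms by (simp add: powr_minus field_simps)
qed

lemma exp_decay_bound:
  assumes "y0 > 0"
  obtains K where "K \<ge> 0" "\<And>y. y \<ge> y0 \<Longrightarrow> exp (- 2 * pi * y) \<le> K * y powr N"
proof
  define M where "M = nat \<lceil>\<bar>N\<bar>\<rceil>"
  have M: "- (N + real M) \<le> 0" unfolding M_def by linarith
  define K where "K = fact M * y0 powr (- (N + real M))"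
  show "K \<ge> 0" by (simp add: K_def)
  fix y assume y: "y \<ge> y0"
  hence y_pos: "y > 0" using assms by simp
  have "1 = y powr real M * y powr (- (N + real M)) * y powr N"
    using y_pos by (simp flip: powr_add)
  also have "\<dots> \<le> (fact M * exp (2 * pi * y)) * y0 powr (- (N + real M)) * y powr N"
  proof (intro mult_right_mono mult_mono)
    have "y powr real M = y ^ M" using y_pos by (simp add: powr_realpow)
    also have "\<dots> \<le> fact M * exp y" using y_pos by (intro power_le_fact_exp) simp
    also have "exp y \<le> exp (2 * pi * y)" using y_pos pi_gt3 by simp
    finally show "y powr real M \<le> fact M * exp (2 * pi * y)" by simp
    show "y powr (- (N + real M)) \<le> y0 powr (- (N + real M))"
      using M y assms by (intro powr_mono2') auto
  qed auto
  also have "\<dots> = exp (2 * pi * y) * (K * y powr N)" by (simp add: K_def)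
  finally have "exp (- 2 * pi * y) * 1 \<le> exp (- 2 * pi * y) * (exp (2 * pi * y) * (K * y powr N))"
    by (intro mult_left_mono) auto
  also have "\<dots> = K * y powr N" by (simp add: exp_minus)
  finally show "exp (- 2 * pi * y) \<le> K * y powr N" by simp
qed


section \<open>The additive twists\<close>

definition moebius :: "int \<Rightarrow> int \<Rightarrow> int \<Rightarrow> int \<Rightarrow> complex \<Rightarrow> complex" where
  "moebius A b C d z = (of_int A * z + of_int b) / (of_int C * z + of_int d)"

text \<open>
  A matrix with first column \<open>(A, C)\<close> maps the vertical line above \<open>-d/C\<close> to the one above \<open>A/C\<close> and
  reverses it, exchanging the end at the real axis with the end at infinity.
\<close>
lemma moebius_cusp_line:
  assumes "A * d - b * C = 1" "C > 0" "u > 0"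
  shows "of_int C * (- of_int d / of_int C + \<i> * of_real u) + of_int d = \<i> * of_int C * of_real u"
    and "moebius A b C d (- of_int d / of_int C + \<i> * of_real u) =
           of_int A / of_int C + \<i> * of_real (1 / (of_int C ^ 2 * u))"
proof -
  define w where "w = - of_int d / of_int C + \<i> * complex_of_real u"
  have C: "(of_int C :: complex) \<noteq> 0" using assms(2) by simp
  have j: "of_int C * w + of_int d = \<i> * of_int C * of_real u" using C by (simp add: w_def field_simps)
  note det = of_int_det[OF assms(1), where 'a = complex]
  have "of_int A * w + of_int b = \<i> * of_int A * of_real u - (of_int A * of_int d - of_int b * of_int C) / of_int C"
    using C by (simp add: w_def field_simps)
  also have "\<dots> = (of_int A / of_int C + \<i> * of_real (1 / (of_int C ^ 2 * u))) * (\<i> * of_int C * of_real u)"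
    unfolding det using C assms(3) by (simp add: field_simps power2_eq_square)
  finally have "moebius A b C d w = of_int A / of_int C + \<i> * of_real (1 / (of_int C ^ 2 * u))"
    unfolding moebius_def j using C assms(3) by simp
  with j show "of_int C * (- of_int d / of_int C + \<i> * of_real u) + of_int d = \<i> * of_int C * of_real u"
    "moebius A b C d (- of_int d / of_int C + \<i> * of_real u) =
       of_int A / of_int C + \<i> * of_real (1 / (of_int C ^ 2 * u))"
    by (simp_all only: w_def)
qed

context eigenform
begin

lemma vertical_line_continuous:
  "continuous_on {0<..} (\<lambda>y::real. f (of_real x + \<i> * of_real y))"
  using holomorphic_on_imp_continuous_on[OF holo]
  by (rule continuous_on_compose2) (auto intro!: continuous_intros simp: upper_half_plane_def)

lemma cusp_line_transform:
  assumes "A * d - b * C = 1" "C > 0" "u > 0"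
  shows "f (of_int A / of_int C + \<i> * of_real (1 / (of_int C ^ 2 * u))) =
           (\<i> * of_int C * of_real u) ^ k * f (- of_int d / of_int C + \<i> * of_real u)"
proof -
  have "- of_int d / of_int C + \<i> * complex_of_real u \<in> upper_half_plane"
    using assms(3) Im_divide_of_real[of "- of_int d" "of_int C"] by (simp add: upper_half_plane_def)
  from f_transform[OF assms(1) this, folded moebius_def] show ?thesis
    unfolding moebius_cusp_line[OF assms] .
qed

text \<open>
  Decay at infinity is the exponential decay of \<open>f\<close>. The reversal of the line carries it over to the
  end at the real axis, where the automorphy factor only costs a power of \<open>y\<close>.
\<close>
lemma rapid_decay_cusp_line:
  fixes A C :: int
  assumes "coprime A C" "C > 0"
  shows "rapid_decay (\<lambda>y. f (of_int A / of_int C + \<i> * of_real y))"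
  unfolding rapid_decay_def
proof (intro conjI allI)
  show "continuous_on {0<..} (\<lambda>y. f (of_int A / of_int C + \<i> * of_real y))"
    using vertical_line_continuous[of "of_int A / of_int C"] by simp
  fix N :: real
  obtain d b' where db: "A * d + C * b' = 1" using assms(1)
    by (metis bezout_int coprime_iff_gcd_eq_1 mult.commute)
  define b where "b = - b'"
  have det: "A * d - b * C = 1" using db by (simp add: b_def mult.commute)
  define c where "c = real_of_int C"
  have c: "c > 0" using assms(2) by (simp add: c_def)
  obtain B where B: "B \<ge> 0" "\<And>z. Im z \<ge> min 1 (1 / c\<^sup>2) \<Longrightarrow> norm (f z) \<le> B * exp (- 2 * pi * Im z)"
    using decay[of "min 1 (1 / c\<^sup>2)"] c by auto
  obtain K1 where K1: "K1 \<ge> 0" "\<And>y. y \<ge> 1 / c\<^sup>2 \<Longrightarrow> exp (- 2 * pi * y) \<le> K1 * y powr N"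
    using exp_decay_bound[of "1 / c\<^sup>2" N] c by auto
  \<comment> \<open>For small \<open>y = 1/(c\<^sup>2 u)\<close> the power \<open>y\<^sup>N\<close> is a multiple of \<open>u\<^bsup>-N\<^esup>\<close>, and \<open>u\<^bsup>-k\<^esup>\<close> offsets the automorphy factor.\<close>
  obtain K2 where K2: "K2 \<ge> 0" "\<And>u. u \<ge> 1 \<Longrightarrow> exp (- 2 * pi * u) \<le> K2 * u powr (- N - real k)"
    using exp_decay_bound[of 1 "- N - real k"] by auto
  define L where "L = B * K1 + c ^ k * B * K2 * (c\<^sup>2) powr N"
  have "norm (f (of_int A / of_int C + \<i> * of_real y)) \<le> L * y powr N" if y: "y > 0" for y
  proof (cases "y \<ge> 1 / c\<^sup>2")
    case True
    have "Im (of_int A / of_int C + \<i> * complex_of_real y) = y"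
      using Im_divide_of_real[of "of_int A" "of_int C"] by simp
    hence "norm (f (of_int A / of_int C + \<i> * of_real y)) \<le> B * exp (- 2 * pi * y)"
      using B(2)[of "of_int A / of_int C + \<i> * of_real y"] True by simp
    also have "\<dots> \<le> B * (K1 * y powr N)" by (intro mult_left_mono K1(2) True B(1))
    also have "\<dots> \<le> L * y powr N"
      using c B(1) K2(1) by (simp add: L_def distrib_right)
    finally show ?thesis .
  next
    case False
    define u where "u = 1 / (c\<^sup>2 * y)"
    have u: "u \<ge> 1" using False y c by (simp add: u_def field_simps)
    have yu: "y = 1 / (c\<^sup>2 * u)" using c y by (simp add: u_def field_simps)
    have "norm (f (of_int A / of_int C + \<i> * of_real y)) =
        norm ((\<i> * of_int C * of_real u) ^ k * f (- of_int d / of_int C + \<i> * of_real u))"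
      using cusp_line_transform[OF det assms(2), of u] u unfolding yu c_def by simp
    also have "\<dots> = (c * u) ^ k * norm (f (- of_int d / of_int C + \<i> * of_real u))"
      using u c by (simp add: norm_mult norm_power c_def)
    also have "\<dots> \<le> (c * u) ^ k * (B * exp (- 2 * pi * u))"
    proof (intro mult_left_mono)
      have "Im (- of_int d / of_int C + \<i> * complex_of_real u) = u"
        using Im_divide_of_real[of "- of_int d" "of_int C"] by simp
      thus "norm (f (- of_int d / of_int C + \<i> * of_real u)) \<le> B * exp (- 2 * pi * u)"
        using B(2)[of "- of_int d / of_int C + \<i> * of_real u"] u by simp
    qed (use c u in auto)
    also have "\<dots> \<le> (c * u) ^ k * (B * (K2 * u powr (- N - real k)))"
      using c u by (intro mult_left_mono K2(2) B(1)) auto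
    also have "\<dots> = c ^ k * B * K2 * (u powr real k * u powr (- N - real k))"
      using u by (simp add: power_mult_distrib powr_realpow mult_ac)
    also have "u powr real k * u powr (- N - real k) = u powr (- N)" by (simp flip: powr_add)
    also have "u powr (- N) = (c\<^sup>2) powr N * y powr N"
      using c y by (simp add: u_def powr_divide powr_mult powr_minus field_simps)
    also have "c ^ k * B * K2 * ((c\<^sup>2) powr N * y powr N) = (c ^ k * B * K2 * (c\<^sup>2) powr N) * y powr N"
      by (simp only: mult.assoc)
    also have "\<dots> \<le> L * y powr N"
      using K1(1) B(1) by (intro mult_right_mono) (auto simp: L_def)
    finally show ?thesis .
  qed
  thus "\<exists>K. \<forall>y>0. norm (f (of_int A / of_int C + \<i> * of_real y)) \<le> K * y powr N" by blast
qed

text \<open>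
  Termwise integration of the Fourier series. The integrals of the absolute values are a constant times
  \<open>|\<lambda>\<^sub>f(n)| n\<^bsup>- Re s\<^esup>\<close>, which is where \<open>Re s > 1\<close> enters. The shift from \<open>s\<close> to \<open>s'\<close>
  undoes the normalization of the eigenvalues.
\<close>
lemma mellin_series:
  fixes x :: real
  assumes "Re s > 1"
  defines "s' \<equiv> s + (of_nat k - 1) / 2"
  shows "dirichlet_term (\<lambda>n. lam n * ee (of_nat n * of_real x)) s sums
           (rGamma s' * of_real (2 * pi) powr s' * mellin (\<lambda>y. f (of_real x + \<i> * of_real y)) s')"
proof -
  let ?\<Phi> = "\<lambda>y. indicat_real {0<..} y *\<^sub>R (f (of_real x + \<i> * of_real y) * of_real y powr (s' - 1))"
  let ?c = "rGamma s' * of_real (2 * pi) powr s'"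
  let ?M = "mellin (\<lambda>y. f (of_real x + \<i> * of_real y)) s'"
  let ?\<gamma> = "Re (Gamma (of_real (Re s')))"
  define \<kappa> where "\<kappa> = (real k - 1) / 2"
  have \<kappa>: "\<kappa> > 0" using k_pos by (simp add: \<kappa>_def)
  have s': "s' = s + of_real \<kappa>" by (simp add: s'_def \<kappa>_def)
  have Re_s': "Re s' > 0" using assms(1) \<kappa> by (simp add: s')
  define c where "c = (\<lambda>n. 2 * pi * real (Suc n))"
  have c: "c n > 0" for n by (simp add: c_def)
  define \<alpha> where "\<alpha> = (\<lambda>n. a (Suc n) * ee (of_nat (Suc n) * of_real x))"
  have n\<alpha>: "norm (\<alpha> n) = norm (a (Suc n))" for n by (simp add: \<alpha>_def norm_mult norm_ee)
  define E where "E = (\<lambda>n y. indicat_real {0<..} y *\<^sub>R (of_real y powr (s' - 1) * complex_of_real (exp (- c n * y))))"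
  define F where "F = (\<lambda>n y. \<alpha> n * E n y)"
  have E_int: "integrable lborel (E n)" for n
    using Gamma_integral_scaled(1)[OF Re_s' c] unfolding E_def set_integrable_def .
  hence F_int: "integrable lborel (F n)" for n unfolding F_def by (rule integrable_mult_right)
  have E_val: "integral\<^sup>L lborel (E n) = Gamma s' * of_real (c n) powr (- s')" for n
    using Gamma_integral_scaled(2)[OF Re_s' c] unfolding E_def set_lebesgue_integral_def .
  have norm_powr: "norm (complex_of_real t powr z) = t powr Re z" if "t > 0" for t z
    using that by (simp add: norm_powr_real_powr)
  have lamS: "a (Suc n) = lam (Suc n) * of_real (real (Suc n) powr \<kappa>)" for n
    unfolding lam_def \<kappa>_def by (simp del: of_nat_Suc)
  have series_at: "(\<lambda>n. F n y) sums ?\<Phi> y"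
    "summable (\<lambda>n. norm (F n y))" for y
  proof -
    have *: "(\<lambda>n. F n y) sums ?\<Phi> y \<and>
        summable (\<lambda>n. norm (F n y))"
    proof (cases "y > 0")
      case True
      define z where "z = of_real x + \<i> * complex_of_real y"
      have "z \<in> upper_half_plane" using True by (simp add: z_def upper_half_plane_def)
      hence "(\<lambda>n. a n * ee (of_nat n * z)) sums f z" using fourier unfolding has_fourier_expansion_def by blast
      hence 1: "(\<lambda>n. a (Suc n) * ee (of_nat (Suc n) * z)) sums f z"
        using sums_Suc_iff[of "\<lambda>n. a n * ee (of_nat n * z)" "f z"] by (simp add: a_0 del: of_nat_Suc)
      have ee_z: "ee (of_nat (Suc n) * z) = ee (of_nat (Suc n) * of_real x) * of_real (exp (- c n * y))" for n
      proof -
        have "of_nat (Suc n) * z = of_nat (Suc n) * of_real x + \<i> * of_real (real (Suc n) * y)"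
          by (simp add: z_def ring_distribs mult_ac)
        moreover have "ee (\<i> * of_real (real (Suc n) * y)) = of_real (exp (- c n * y))"
          unfolding ee_def exp_of_real[symmetric] c_def by (rule arg_cong[of _ _ exp]) (simp add: complex_eq_iff)
        ultimately show ?thesis by (simp only: ee_add)
      qed
      have F: "F n y = a (Suc n) * ee (of_nat (Suc n) * z) * of_real y powr (s' - 1)" for n
        using True unfolding F_def E_def \<alpha>_def ee_z by (simp del: of_nat_Suc)
      have "summable (\<lambda>n. norm (a (Suc n)) * exp (- 2 * pi * y) ^ Suc n)"
        using fourier_abs_summable[OF True] by (subst summable_Suc_iff)
      hence "summable (\<lambda>n. norm (a (Suc n)) * exp (- 2 * pi * y) ^ Suc n * norm (of_real y powr (s' - 1)))"
        by (rule summable_mult2)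
      moreover have "norm (F n y) = norm (a (Suc n)) * exp (- 2 * pi * y) ^ Suc n * norm (of_real y powr (s' - 1))" for n
        unfolding F ee_of_nat_mult by (simp add: norm_mult norm_power norm_ee z_def)
      ultimately have "summable (\<lambda>n. norm (F n y))" by (simp only:)
      moreover have "(\<lambda>n. F n y) sums (f z * of_real y powr (s' - 1))" unfolding F by (rule sums_mult2[OF 1])
      ultimately show ?thesis using True by (simp add: z_def)
    qed (simp add: F_def E_def)
    show "(\<lambda>n. F n y) sums ?\<Phi> y"
      using * by (rule conjunct1)
    show "summable (\<lambda>n. norm (F n y))" using * by (rule conjunct2)
  qed
  have norm_F: "(\<integral>y. norm (F n y) \<partial>lborel) =
      norm (lam (Suc n)) * real (Suc n) powr (- Re s) * (?\<gamma> * (2 * pi) powr (- Re s'))" for n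
  proof -
    define G where "G = (\<lambda>y. indicat_real {0<..} y *\<^sub>R (complex_of_real y powr (of_real (Re s') - 1) * complex_of_real (exp (- c n * y))))"
    have "Re (complex_of_real (Re s')) > 0" using Re_s' by simp
    note G = Gamma_integral_scaled[OF this c[of n]]
    have "norm (F n y) = norm (\<alpha> n) * Re (G y)" for y
    proof (cases "y > 0")
      case True
      have "complex_of_real y powr (of_real (Re s') - 1) = of_real (y powr (Re s' - 1))"
        using powr_of_real[of y "Re s' - 1"] True by simp
      hence "G y = of_real (y powr (Re s' - 1) * exp (- c n * y))" using True by (simp add: G_def)
      thus ?thesis using True by (simp add: F_def E_def norm_mult norm_powr)
    qed (simp add: F_def E_def G_def)
    hence "(\<integral>y. norm (F n y) \<partial>lborel) = norm (\<alpha> n) * (\<integral>y. Re (G y) \<partial>lborel)" by simp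
    also have "(\<integral>y. Re (G y) \<partial>lborel) = Re (integral\<^sup>L lborel G)"
      by (rule integral_Re) (use G(1) in \<open>simp add: G_def set_integrable_def\<close>)
    also have "integral\<^sup>L lborel G = Gamma (of_real (Re s')) * of_real (c n) powr (- of_real (Re s'))"
      using G(2) by (simp add: G_def set_lebesgue_integral_def)
    also have "of_real (c n) powr (- complex_of_real (Re s')) = of_real (c n powr (- Re s'))"
      using powr_of_real[of "c n" "- Re s'"] c[of n] by simp
    also have "Re (Gamma (of_real (Re s')) * complex_of_real (c n powr (- Re s'))) =
        ?\<gamma> * c n powr (- Re s')" by simp
    also have "norm (\<alpha> n) = norm (lam (Suc n)) * real (Suc n) powr \<kappa>"
      unfolding n\<alpha> lamS by (simp add: norm_mult)
    also have "c n powr (- Re s') = (2 * pi) powr (- Re s') * (real (Suc n) powr (- Re s) * real (Suc n) powr (- \<kappa>))"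
      unfolding c_def by (simp add: powr_mult s' flip: powr_add)
    also have "norm (lam (Suc n)) * real (Suc n) powr \<kappa> * (?\<gamma> *
        ((2 * pi) powr (- Re s') * (real (Suc n) powr (- Re s) * real (Suc n) powr (- \<kappa>)))) =
        norm (lam (Suc n)) * real (Suc n) powr (- Re s) * (?\<gamma> * (2 * pi) powr (- Re s'))
        * (real (Suc n) powr \<kappa> * real (Suc n) powr (- \<kappa>))" by (simp only: mult_ac)
    also have "real (Suc n) powr \<kappa> * real (Suc n) powr (- \<kappa>) = 1" by (simp flip: powr_add)
    finally show ?thesis by (simp only: mult_1_right)
  qed
  have "(\<lambda>n. integral\<^sup>L lborel (F n)) sums (\<integral>y. (\<Sum>n. F n y) \<partial>lborel)"
  proof (rule sums_integral[OF F_int])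
    show "AE y in lborel. summable (\<lambda>n. norm (F n y))" by (rule AE_I2) (rule series_at(2))
    show "summable (\<lambda>n. \<integral>y. norm (F n y) \<partial>lborel)"
      unfolding norm_F by (intro summable_mult2 lam_summable assms(1))
  qed
  also have "(\<lambda>y. \<Sum>n. F n y) = ?\<Phi>"
    using series_at(1) by (auto simp: sums_iff)
  also have "(\<integral>y. ?\<Phi> y \<partial>lborel) =
      ?M"
    by (simp add: mellin_def set_lebesgue_integral_def)
  finally have "(\<lambda>n. ?c * integral\<^sup>L lborel (F n)) sums
      (?c * ?M)"
    by (rule sums_mult)
  moreover have "?c * integral\<^sup>L lborel (F n) =
      dirichlet_term (\<lambda>n. lam n * ee (of_nat n * of_real x)) s n" for n
  proof -
    define N where "N = complex_of_nat (Suc n)"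
    have N: "N = of_real (real (Suc n))" by (simp add: N_def)
    have "integral\<^sup>L lborel (F n) = \<alpha> n * (Gamma s' * of_real (c n) powr (- s'))"
      unfolding F_def by (simp add: E_val)
    also have "complex_of_real (c n) powr (- s') = of_real (2 * pi) powr (- s') * N powr (- s')"
      unfolding c_def of_real_mult[of "2 * pi"] N by (rule powr_times_real) auto
    also have "N powr (- s') = N powr (- s) * N powr (- of_real \<kappa>)" by (simp add: s' flip: powr_add)
    also have "N powr (- of_real \<kappa>) = of_real (real (Suc n) powr (- \<kappa>))"
      unfolding N using powr_of_real[of "real (Suc n)" "- \<kappa>"] by simp
    also have "\<alpha> n = lam (Suc n) * of_real (real (Suc n) powr \<kappa>) * ee (N * of_real x)"
      unfolding \<alpha>_def lamS N_def ..
    finally have "?c * integral\<^sup>L lborel (F n) =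
        (rGamma s' * Gamma s') * (of_real (2 * pi) powr s' * of_real (2 * pi) powr (- s')) *
        of_real (real (Suc n) powr \<kappa> * real (Suc n) powr (- \<kappa>)) *
        (lam (Suc n) * ee (N * of_real x) * N powr (- s))"
      by (simp only: mult_ac of_real_mult)
    moreover have "real (Suc n) powr \<kappa> * real (Suc n) powr (- \<kappa>) = 1" by (simp flip: powr_add)
    moreover have "complex_of_real (2 * pi) powr s' * of_real (2 * pi) powr (- s') = 1" by (simp flip: powr_add)
    moreover have "rGamma s' * Gamma s' = 1"
    proof -
      have "s' \<notin> \<int>\<^sub>\<le>\<^sub>0" using Re_s' by (auto elim!: nonpos_Ints_cases)
      hence "rGamma s' \<noteq> 0" by (simp add: rGamma_eq_zero_iff)
      thus ?thesis by (simp add: Gamma_def)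
    qed
    ultimately show ?thesis unfolding dirichlet_term_def N_def by (simp only: of_real_1 mult_1_left mult_1_right)
  qed
  ultimately show ?thesis by (simp only:)
qed

text \<open>The entire function \<open>L(s, f, x)\<close>, for rational \<open>x\<close>.\<close>
definition additive_continuation :: "real \<Rightarrow> complex \<Rightarrow> complex" where
  "additive_continuation x s =
     rGamma (s + (of_nat k - 1) / 2) * of_real (2 * pi) powr (s + (of_nat k - 1) / 2) *
     mellin (\<lambda>y. f (of_real x + \<i> * of_real y)) (s + (of_nat k - 1) / 2)"

lemma continues_additive:
  fixes A C :: int
  assumes "coprime A C" "C > 0" and x: "x = of_int A / of_int C"
  shows "continues (\<lambda>n. lam n * ee (of_nat n * of_real x)) (additive_continuation x)"
  unfolding continues_def
proof (intro conjI allI impI)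
  have "mellin (\<lambda>y. f (of_real x + \<i> * of_real y)) holomorphic_on UNIV"
    using mellin_holomorphic[OF rapid_decay_cusp_line[OF assms(1,2)]] by (simp add: x)
  hence "(mellin (\<lambda>y. f (of_real x + \<i> * of_real y)) \<circ> (\<lambda>s. s + (of_nat k - 1) / 2)) holomorphic_on UNIV"
    by (intro holomorphic_on_compose holomorphic_intros) (auto intro: holomorphic_on_subset)
  moreover have "(rGamma \<circ> (\<lambda>s. s + (of_nat k - 1) / 2)) holomorphic_on UNIV"
    by (intro holomorphic_on_compose holomorphic_intros holomorphic_rGamma)
  ultimately show "additive_continuation x holomorphic_on UNIV"
    unfolding additive_continuation_def[abs_def] o_def by (auto intro!: holomorphic_intros)
qed (use mellin_series in \<open>auto simp: additive_continuation_def\<close>)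

definition moment_integral :: "nat \<Rightarrow> real \<Rightarrow> complex" where
  "moment_integral n x = (LINT y:{0<..}|lborel. f (of_real x + \<i> * of_real y) * of_real (y ^ n))"

lemma mellin_of_nat:
  "mellin g (of_nat (Suc n)) = (LINT y:{0<..}|lborel. g y * of_real (y ^ n))"
  unfolding mellin_def by (rule set_lebesgue_integral_cong) (auto simp: powr_nat')

lemma cusp_line_integrable:
  fixes A C :: int
  assumes "coprime A C" "C > 0" and x: "x = of_int A / of_int C"
  shows "set_integrable lborel {0<..} (\<lambda>y. f (of_real x + \<i> * of_real y) * of_real (y ^ n))"
proof -
  have "set_integrable lborel {0<..} (\<lambda>y. f (of_real x + \<i> * of_real y) * of_real y powr (of_nat (Suc n) - 1))"
    using rapid_decay_integrable[OF rapid_decay_cusp_line[OF assms(1,2)], of "of_nat (Suc n)"] by (simp add: x)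
  thus ?thesis
    by (rule set_integrable_cong[OF refl refl, THEN iffD1, rotated]) (auto simp: powr_nat')
qed

lemma additive_continuation_half:
  assumes "k = 2 * m + 2"
  shows "additive_continuation x (1 / 2 + of_nat j) =
           (2 * pi) ^ (m + j + 1) / fact (m + j) * moment_integral (m + j) x"
proof -
  have s: "1 / 2 + of_nat j + (of_nat k - 1) / 2 = (of_nat (Suc (m + j)) :: complex)"
    by (simp add: assms field_simps)
  have "rGamma (of_nat (Suc (m + j))) = (1 / fact (m + j) :: complex)"
    using Gamma_fact[of "m + j", where 'a = complex] by (simp add: rGamma_inverse_Gamma add_ac divide_inverse)
  thus ?thesis
    unfolding additive_continuation_def s mellin_of_nat moment_integral_def
    by (simp add: powr_nat' del: of_nat_Suc)
qed

end


section \<open>Integrals between cusps\<close>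

lemma rapid_decay_mult_linear:
  assumes "rapid_decay g"
  shows "rapid_decay (\<lambda>y. g y * (\<alpha> + \<beta> * of_real y))"
  unfolding rapid_decay_def
proof (intro conjI allI)
  show "continuous_on {0<..} (\<lambda>y. g y * (\<alpha> + \<beta> * of_real y))"
    using assms unfolding rapid_decay_def by (auto intro!: continuous_intros)
  fix N :: real
  obtain K where K: "\<And>N y. y > 0 \<Longrightarrow> norm (g y) \<le> K N * y powr N"
    using assms unfolding rapid_decay_def by metis
  have "norm (g y * (\<alpha> + \<beta> * of_real y)) \<le> (K N * norm \<alpha> + K (N - 1) * norm \<beta>) * y powr N" if y: "y > 0" for y
  proof -
    have "norm (g y * (\<alpha> + \<beta> * of_real y)) \<le> norm (g y) * (norm \<alpha> + norm \<beta> * y)"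
      unfolding norm_mult
      by (intro mult_left_mono order_trans[OF norm_triangle_ineq]) (use y in \<open>auto simp: norm_mult\<close>)
    also have "\<dots> = norm (g y) * norm \<alpha> + norm (g y) * (norm \<beta> * y)" by (rule distrib_left)
    also have "\<dots> \<le> K N * y powr N * norm \<alpha> + K (N - 1) * y powr (N - 1) * (norm \<beta> * y)"
      by (intro add_mono mult_right_mono K y) (use y in auto)
    also have "\<dots> = K N * y powr N * norm \<alpha> + K (N - 1) * norm \<beta> * (y powr (N - 1) * y)" by (simp add: mult_ac)
    also have "y powr (N - 1) * y = y powr N" using y by (simp add: powr_diff)
    finally show ?thesis by (simp add: algebra_simps)
  qed
  thus "\<exists>K. \<forall>y>0. norm (g y * (\<alpha> + \<beta> * of_real y)) \<le> K * y powr N" by blast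
qed

lemma rapid_decay_mult_linear_power:
  assumes "rapid_decay g"
  shows "rapid_decay (\<lambda>y. g y * (\<alpha> + \<beta> * of_real y) ^ n)"
proof (induction n)
  case (Suc n)
  show ?case using rapid_decay_mult_linear[OF Suc.IH, of \<alpha> \<beta>] by (simp add: mult_ac)
qed (use assms in simp)

lemma rapid_decay_set_integrable:
  assumes "rapid_decay g"
  shows "set_integrable lborel {0<..} g"
  using rapid_decay_integrable[OF assms, of 1]
  by (rule set_integrable_cong[OF refl refl, THEN iffD1, rotated]) auto

lemma moebius_upper_half_plane:
  assumes "A * d - b * C = 1" "z \<in> upper_half_plane"
  shows "moebius A b C d z \<in> upper_half_plane"
  using denominator_nonzero[OF assms] Im_moebius[OF assms(1), of z] assms(2)
  by (simp add: upper_half_plane_def moebius_def)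

text \<open>The parameters on the right-hand side are the entries of the matrix product.\<close>
lemma moebius_compose:
  assumes "t * v - u * q = 1" "z \<in> upper_half_plane"
  shows "moebius A b C d (moebius t u q v z) = moebius (A * t + b * q) (A * u + b * v) (C * t + d * q) (C * u + d * v) z"
proof -
  define j where "j = of_int q * z + of_int v"
  have j: "j \<noteq> 0" unfolding j_def by (rule denominator_nonzero[OF assms])
  define X where "X = of_int t * z + of_int u"
  have lin: "of_int a * (X / j) + of_int c = (of_int a * X + of_int c * j) / j" for a c :: int
    using j by (simp add: field_simps)
  have "moebius A b C d (moebius t u q v z) = (of_int A * X + of_int b * j) / (of_int C * X + of_int d * j)"
    unfolding moebius_def X_def[symmetric] j_def[symmetric] lin using j by simp
  moreover have "of_int a * X + of_int c * j = of_int (a * t + c * q) * z + of_int (a * u + c * v)" for a c :: int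
    by (simp add: X_def j_def algebra_simps)
  ultimately show ?thesis by (simp only: moebius_def)
qed

text \<open>
  For a suitable primitive \<open>H\<close> this is its boundary value at the cusp \<open>A/C\<close>, approached along the image of
  the imaginary axis.
\<close>
definition cusp_value :: "(complex \<Rightarrow> complex) \<Rightarrow> int \<Rightarrow> int \<Rightarrow> int \<Rightarrow> int \<Rightarrow> complex" where
  "cusp_value H A b C d = Lim at_top (\<lambda>y::real. H (moebius A b C d (\<i> * of_real y)))"

context eigenform
begin

text \<open>
  The pullback of the form \<open>f(z) (u1 z - v1)\<^sup>m (u2 z - v2)\<^sup>m dz\<close> under the matrix \<open>(A, b; C, d)\<close> when
  \<open>k = 2 m + 2\<close>: the factor \<open>f\<close> contributes \<open>(C w + d)\<^sup>k\<close>, which cancels the \<open>2 m\<close> denominators of the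
  polynomial and the two of \<open>dz\<close>. Two homogeneous linear forms are used instead of two roots so that
  the root at infinity is included, as \<open>u = 0\<close>.
\<close>
definition pullback :: "nat \<Rightarrow> complex \<Rightarrow> complex \<Rightarrow> complex \<Rightarrow> complex \<Rightarrow> int \<Rightarrow> int \<Rightarrow> int \<Rightarrow> int \<Rightarrow> complex \<Rightarrow> complex" where
  "pullback m u1 v1 u2 v2 A b C d w =
     f w * (u1 * (of_int A * w + of_int b) - v1 * (of_int C * w + of_int d)) ^ m *
           (u2 * (of_int A * w + of_int b) - v2 * (of_int C * w + of_int d)) ^ m"

lemma primitive_exists:
  obtains H where "\<And>z. z \<in> upper_half_plane \<Longrightarrow>
    (H has_field_derivative f z * (u1 * z - v1) ^ m * (u2 * z - v2) ^ m) (at z)"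
proof -
  have op: "open upper_half_plane" unfolding upper_half_plane_def by (rule open_halfspace_Im_gt)
  have cv: "convex upper_half_plane" unfolding upper_half_plane_def by (rule convex_halfspace_Im_gt)
  have "(\<lambda>z. f z * (u1 * z - v1) ^ m * (u2 * z - v2) ^ m) holomorphic_on upper_half_plane"
    by (intro holomorphic_intros holo)
  from holomorphic_convex_primitive'[OF cv op this] obtain H where
    "\<And>z. z \<in> upper_half_plane \<Longrightarrow>
      (H has_field_derivative f z * (u1 * z - v1) ^ m * (u2 * z - v2) ^ m) (at z within upper_half_plane)" by blast
  thus ?thesis using that[of H] at_within_open[OF _ op] by metis
qed

context
  fixes m :: nat and u1 v1 u2 v2 :: complex and H :: "complex \<Rightarrow> complex"
  assumes k_eq: "k = 2 * m + 2"
    and H: "\<And>z. z \<in> upper_half_plane \<Longrightarrow>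
      (H has_field_derivative f z * (u1 * z - v1) ^ m * (u2 * z - v2) ^ m) (at z)"
begin

lemma pullback_derivative:
  assumes det: "A * d - b * C = 1" and w: "w \<in> upper_half_plane"
  shows "((\<lambda>w. H (moebius A b C d w)) has_field_derivative pullback m u1 v1 u2 v2 A b C d w) (at w)"
proof -
  define j where "j = of_int C * w + of_int d"
  define n where "n = of_int A * w + of_int b"
  have j: "j \<noteq> 0" unfolding j_def by (rule denominator_nonzero[OF assms])
  note det' = of_int_det[OF det, where 'a = complex]
  have "(moebius A b C d has_field_derivative (of_int A * j - n * of_int C) / (j * j)) (at w)"
    unfolding moebius_def[abs_def] j_def n_def
    by (rule derivative_eq_intros refl j[unfolded j_def])+ simp
  also have "of_int A * j - n * of_int C = complex_of_int A * of_int d - of_int b * of_int C"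
    by (simp add: j_def n_def algebra_simps)
  also note det'
  finally have 1: "(moebius A b C d has_field_derivative 1 / (j * j)) (at w)" .
  have mw: "moebius A b C d w = n / j" by (simp add: moebius_def n_def j_def)
  have fn: "f (n / j) = j ^ (2 * m + 2) * f w"
    using f_transform[OF det w] by (simp add: n_def j_def k_eq)
  have lin: "u * (n / j) - v = (u * n - v * j) / j" for u v using j by (simp add: field_simps)
  from DERIV_chain2[OF H[OF moebius_upper_half_plane[OF assms]] 1]
  have "((\<lambda>w. H (moebius A b C d w)) has_field_derivative
     f (n / j) * (u1 * (n / j) - v1) ^ m * (u2 * (n / j) - v2) ^ m * (1 / (j * j))) (at w)"
    unfolding mw .
  also have "f (n / j) * (u1 * (n / j) - v1) ^ m * (u2 * (n / j) - v2) ^ m * (1 / (j * j)) =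
      f w * (u1 * n - v1 * j) ^ m * (u2 * n - v2 * j) ^ m"
    unfolding fn lin power_divide using j
    by (simp add: power_add mult_2 mult_2_right field_simps power2_eq_square)
  finally show ?thesis unfolding pullback_def n_def j_def .
qed

lemma rapid_decay_pullback:
  fixes t q :: int
  assumes "coprime t q" "q > 0"
  shows "rapid_decay (\<lambda>y. \<i> * pullback m u1 v1 u2 v2 A b C d (of_int t / of_int q + \<i> * of_real y))"
proof -
  define x where "x = (of_int t / of_int q :: complex)"
  define \<alpha> where "\<alpha> = (\<lambda>u v. u * (of_int A * x + of_int b) - v * (of_int C * x + of_int d))"
  define \<beta> where "\<beta> = (\<lambda>u v. (u * of_int A - v * of_int C) * \<i>)"
  have "rapid_decay (\<lambda>y. f (x + \<i> * of_real y) * (\<i> + 0 * of_real y) *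
     (\<alpha> u1 v1 + \<beta> u1 v1 * of_real y) ^ m * (\<alpha> u2 v2 + \<beta> u2 v2 * of_real y) ^ m)"
    unfolding x_def
    by (intro rapid_decay_mult_linear_power rapid_decay_mult_linear rapid_decay_cusp_line assms)
  moreover have "u * (of_int A * (x + \<i> * of_real y) + of_int b) - v * (of_int C * (x + \<i> * of_real y) + of_int d) =
      \<alpha> u v + \<beta> u v * of_real y" for u v y by (simp add: \<alpha>_def \<beta>_def algebra_simps)
  ultimately show ?thesis unfolding pullback_def x_def[symmetric] by (simp add: mult_ac)
qed

lemma vertical_derivative:
  assumes det: "A * d - b * C = 1" and "y > 0"
  shows "((\<lambda>y. H (moebius A b C d (of_real x + \<i> * of_real y))) has_vector_derivative
            \<i> * pullback m u1 v1 u2 v2 A b C d (of_real x + \<i> * of_real y)) (at y)"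
proof -
  have w: "of_real x + \<i> * of_real y \<in> upper_half_plane" using assms by (simp add: upper_half_plane_def)
  have "((\<lambda>y. of_real x + \<i> * complex_of_real y) has_vector_derivative \<i>) (at y)"
    by (auto intro!: derivative_eq_intros)
  from field_vector_diff_chain_at[OF this pullback_derivative[OF det w]]
  show ?thesis by (simp add: o_def)
qed

text \<open>
  High up, the derivative of the primitive is a polynomial times an exponentially decaying factor, so its
  increments over horizontal segments of fixed length tend to zero. Hence the boundary value at
  a cusp does not depend on the vertical line in use.
\<close>
lemma horizontal_limit:
  assumes det: "A * d - b * C = 1"
  shows "((\<lambda>y. H (moebius A b C d (of_real x1 + \<i> * of_real y)) - H (moebius A b C d (of_real x2 + \<i> * of_real y)))
            \<longlongrightarrow> 0) at_top"
proof -
  let ?G = "\<lambda>x y. H (moebius A b C d (of_real x + \<i> * of_real y))"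
  define c where "c = (\<lambda>u v. norm (u * of_int A - v * of_int C) + norm (u * of_int b - v * of_int d :: complex))"
  define R where "R = \<bar>x1\<bar> + \<bar>x2\<bar> + 1"
  define M where "M = (\<lambda>u v. c u v * R * 2)"
  obtain B where B: "B \<ge> 0" "\<And>z. Im z \<ge> 1 \<Longrightarrow> norm (f z) \<le> B * exp (- 2 * pi * Im z)"
    using decay[of 1] by auto
  \<comment> \<open>One power more than the degree \<open>2 m\<close> of the polynomial.\<close>
  obtain K where K: "K \<ge> 0" "\<And>y. y \<ge> 1 \<Longrightarrow> exp (- 2 * pi * y) \<le> K * y powr (- real (2 * m + 1))"
    using exp_decay_bound[of 1 "- real (2 * m + 1)"] by auto
  define L where "L = B * K * M u1 v1 ^ m * M u2 v2 ^ m * \<bar>x1 - x2\<bar>"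
  have M0: "M u v \<ge> 0" for u v by (simp add: M_def c_def R_def)
  have bound: "norm (?G x1 y - ?G x2 y) \<le> L * (1 / y)"
    if y: "y \<ge> 1" for y
  proof -
    define S where "S = closed_segment (of_real x1 + \<i> * of_real y) (of_real x2 + \<i> * complex_of_real y)"
    have S: "Im z = y \<and> norm z \<le> R + y" if "z \<in> S" for z
    proof -
      obtain s where s: "0 \<le> s" "s \<le> 1" and
        z: "z = (1 - s) *\<^sub>R (of_real x1 + \<i> * of_real y) + s *\<^sub>R (of_real x2 + \<i> * complex_of_real y)"
        using \<open>z \<in> S\<close> unfolding S_def in_segment by blast
      have Im: "Im z = y" unfolding z by (simp add: algebra_simps)
      have "\<bar>Re z\<bar> \<le> \<bar>(1 - s) * x1\<bar> + \<bar>s * x2\<bar>" unfolding z by (simp add: abs_triangle_ineq)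
      also have "\<dots> \<le> 1 * \<bar>x1\<bar> + 1 * \<bar>x2\<bar>" unfolding abs_mult using s by (intro add_mono mult_right_mono) auto
      finally have "norm z \<le> R + y" using cmod_le[of z] Im y by (simp add: R_def)
      thus ?thesis using Im by simp
    qed
    have "norm (?G x1 y - ?G x2 y)
      \<le> (B * K * M u1 v1 ^ m * M u2 v2 ^ m * (1 / y)) * norm ((of_real x1 + \<i> * of_real y) - (of_real x2 + \<i> * complex_of_real y))"
    proof (rule field_differentiable_bound[where S = S])
      show "convex S" unfolding S_def by (rule convex_closed_segment)
      fix z assume z: "z \<in> S"
      hence zu: "z \<in> upper_half_plane" using S y by (auto simp: upper_half_plane_def)
      show "((\<lambda>w. H (moebius A b C d w)) has_field_derivative pullback m u1 v1 u2 v2 A b C d z) (at z within S)"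
        using pullback_derivative[OF det zu] by (rule has_field_derivative_at_within)
      have lin: "norm (u * (of_int A * z + of_int b) - v * (of_int C * z + of_int d)) \<le> M u v * y" for u v
      proof -
        have "norm (u * (of_int A * z + of_int b) - v * (of_int C * z + of_int d)) =
          norm ((u * of_int A - v * of_int C) * z + (u * of_int b - v * of_int d))" by (simp add: algebra_simps)
        also have "\<dots> \<le> norm (u * of_int A - v * of_int C) * norm z + norm (u * of_int b - v * of_int d)"
          by (rule order_trans[OF norm_triangle_ineq]) (simp add: norm_mult)
        also have "\<dots> \<le> norm (u * of_int A - v * of_int C) * (R * 2 * y) + norm (u * of_int b - v * of_int d) * (R * 2 * y)"
        proof (intro add_mono mult_left_mono)
          have R1: "R \<ge> 1" by (simp add: R_def)
          have "R \<le> R * y" "y \<le> R * y" using R1 y by (simp_all add: mult_le_cancel_left1 mult_le_cancel_right1)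
          hence 1: "R + y \<le> R * 2 * y" by simp
          thus "norm z \<le> R * 2 * y" using S[OF z] by simp
          have "1 \<le> R * 2 * y" using 1 R1 y by linarith
          thus "norm (u * of_int b - v * of_int d) \<le> norm (u * of_int b - v * of_int d) * (R * 2 * y)"
            by (simp add: mult_le_cancel_left1)
        qed auto
        also have "\<dots> = M u v * y" by (simp add: M_def c_def algebra_simps)
        finally show ?thesis .
      qed
      have "norm (f z) \<le> B * (K * y powr (- real (2 * m + 1)))"
        using B(2)[of z] S[OF z] y mult_left_mono[OF K(2)[OF y] B(1)] by simp
      hence "norm (pullback m u1 v1 u2 v2 A b C d z) \<le>
          (B * (K * y powr (- real (2 * m + 1)))) * (M u1 v1 * y) ^ m * (M u2 v2 * y) ^ m"
        unfolding pullback_def norm_mult norm_power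
        by (intro mult_mono power_mono lin) (use B K M0 y in auto)
      also have "\<dots> = B * K * M u1 v1 ^ m * M u2 v2 ^ m * (y powr (- real (2 * m + 1)) * (y ^ m * y ^ m))"
        by (simp only: power_mult_distrib mult_ac)
      also have "y ^ m * y ^ m = y ^ (2 * m)" by (simp add: mult_2 power_add)
      also have "y ^ (2 * m) = y powr real (2 * m)" by (rule powr_realpow[symmetric]) (use y in simp)
      also have "y powr (- real (2 * m + 1)) * y powr real (2 * m) = y powr (- real (2 * m + 1) + real (2 * m))"
        by (rule powr_add[symmetric])
      also have "- real (2 * m + 1) + real (2 * m) = - 1" by simp
      also have "y powr (- 1) = 1 / y" using y by (simp add: powr_minus_divide)
      finally show "norm (pullback m u1 v1 u2 v2 A b C d z) \<le> B * K * M u1 v1 ^ m * M u2 v2 ^ m * (1 / y)" .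
    qed (auto simp: S_def)
    also have "(of_real x1 + \<i> * of_real y) - (of_real x2 + \<i> * complex_of_real y) = of_real (x1 - x2)" by simp
    finally show ?thesis by (simp only: L_def norm_of_real mult_ac)
  qed
  have "((\<lambda>y::real. L * (1 / y)) \<longlongrightarrow> L * 0) at_top"
    by (intro tendsto_mult_left) real_asymp
  hence "((\<lambda>y::real. L * (1 / y)) \<longlongrightarrow> 0) at_top" by simp
  thus ?thesis
    by (rule Lim_null_comparison[rotated]) (use bound in \<open>auto simp: eventually_at_top_linorder\<close>)
qed

text \<open>
  On the imaginary axis the derivative is integrable, so the limit exists there; \<open>horizontal_limit\<close> moves it
  to the other lines.
\<close>
lemma cusp_value_limit:
  assumes det: "A * d - b * C = 1"
  shows "((\<lambda>y. H (moebius A b C d (of_real x + \<i> * of_real y))) \<longlongrightarrow> cusp_value H A b C d) at_top"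
proof -
  define g where "g = (\<lambda>y. \<i> * pullback m u1 v1 u2 v2 A b C d (of_real 0 + \<i> * of_real y))"
  define G where "G = (\<lambda>y. H (moebius A b C d (of_real 0 + \<i> * of_real y)))"
  have "rapid_decay g" using rapid_decay_pullback[of 0 1] by (simp add: g_def)
  hence int: "set_integrable lborel {1..} g"
    by (intro set_integrable_subset[OF rapid_decay_set_integrable]) auto
  have "((\<lambda>y. G y - G 1) \<longlongrightarrow> (LINT y:{1..}|lborel. g y)) at_top"
  proof (rule Lim_transform_eventually)
    show "((\<lambda>y. LINT t:{1..y}|lborel. g t) \<longlongrightarrow> (LINT y:{1..}|lborel. g y)) at_top"
      by (rule tendsto_set_lebesgue_integral_at_top[OF _ int]) auto
    have "(LINT t:{1..y}|lborel. g t) = G y - G 1" if y: "y \<ge> 1" for y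
    proof -
      have "(g has_integral (G y - G 1)) {1..y}"
      proof (rule fundamental_theorem_of_calculus[OF y])
        fix t assume "t \<in> {1..y}"
        hence "t > 0" by simp
        thus "(G has_vector_derivative g t) (at t within {1..y})"
          unfolding G_def g_def by (intro has_vector_derivative_at_within[OF vertical_derivative[OF det]])
      qed
      moreover have "set_integrable lborel {1..y} g" by (rule set_integrable_subset[OF int]) auto
      ultimately show ?thesis by (simp add: set_borel_integral_eq_integral(2) integral_unique)
    qed
    thus "\<forall>\<^sub>F y in at_top. (LINT t:{1..y}|lborel. g t) = G y - G 1"
      unfolding eventually_at_top_linorder by blast
  qed
  hence "((\<lambda>y. (G y - G 1) + G 1) \<longlongrightarrow> (LINT y:{1..}|lborel. g y) + G 1) at_top"
    by (intro tendsto_intros)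
  hence lim: "(G \<longlongrightarrow> (LINT y:{1..}|lborel. g y) + G 1) at_top" by simp
  hence "cusp_value H A b C d = (LINT y:{1..}|lborel. g y) + G 1"
    unfolding cusp_value_def G_def by (intro tendsto_Lim) auto
  with lim have "(G \<longlongrightarrow> cusp_value H A b C d) at_top" by simp
  from tendsto_add[OF horizontal_limit[OF det, of x 0] this]
  show ?thesis by (simp add: G_def)
qed

text \<open>
  The fundamental theorem of calculus along the vertical line above \<open>x = t/q\<close>. Its lower end is the image
  of \<open>i\<infinity>\<close> under the matrix \<open>(t, u; q, v)\<close>, so after composition the limit there is again a boundary
  value at infinity. Naming cusps by matrices, and reaching a cusp through a product of matrices, avoids
  having to show that a boundary value depends on the cusp alone.
\<close>
lemma period_line:
  fixes t u q v :: int
  assumes det: "A * d - b * C = 1" and det': "t * v - u * q = 1" and q: "q > 0"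
    and x: "x = of_int t / of_int q"
  shows "(LINT y:{0<..}|lborel. \<i> * pullback m u1 v1 u2 v2 A b C d (of_real x + \<i> * of_real y)) =
    cusp_value H A b C d - cusp_value H (A * t + b * q) (A * u + b * v) (C * t + d * q) (C * u + d * v)"
proof -
  define G where "G = (\<lambda>y. H (moebius A b C d (of_real x + \<i> * of_real y)))"
  define g where "g = (\<lambda>y. \<i> * pullback m u1 v1 u2 v2 A b C d (of_real x + \<i> * of_real y))"
  define W where "W = cusp_value H (A * t + b * q) (A * u + b * v) (C * t + d * q) (C * u + d * v)"
  have g: "rapid_decay g" using rapid_decay_pullback[OF det_coprime[OF det'] q] by (simp add: g_def x)
  note detW = det_mult[OF det det']
  have Gy: "G y = H (moebius (A * t + b * q) (A * u + b * v) (C * t + d * q) (C * u + d * v)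
      (of_real (- of_int v / of_int q) + \<i> * of_real (1 / (of_int q ^ 2 * y))))" if y: "y > 0" for y
  proof -
    let ?u = "1 / (of_int q ^ 2 * y)"
    have u: "?u > 0" using y q by simp
    hence w: "- of_int v / of_int q + \<i> * of_real ?u \<in> upper_half_plane"
      using Im_divide_of_real[of "- of_int v" "of_int q"] by (simp add: upper_half_plane_def)
    have "1 / (of_int q ^ 2 * ?u) = y" using y q by simp
    hence "moebius t u q v (- of_int v / of_int q + \<i> * of_real ?u) = of_real x + \<i> * of_real y"
      unfolding moebius_cusp_line(2)[OF det' q u] x by (simp only: of_real_divide of_real_of_int_eq)
    thus ?thesis using moebius_compose[OF det' w, of A b C d] by (simp add: G_def)
  qed
  have A: "(G \<longlongrightarrow> W) (at_right 0)"
  proof -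
    have "filterlim (\<lambda>y. 1 / (of_int q ^ 2 * y)) at_top (at_right (0::real))"
      using q by real_asymp
    from filterlim_compose[OF cusp_value_limit[OF detW] this, of "- of_int v / of_int q"]
    show ?thesis unfolding W_def
      by (rule Lim_transform_eventually) (use Gy in \<open>auto simp: eventually_at_right_field intro!: exI[of _ 1]\<close>)
  qed
  have B: "(G \<longlongrightarrow> cusp_value H A b C d) at_top" unfolding G_def by (rule cusp_value_limit[OF det])
  have ei: "einterval (ereal 0) \<infinity> = {0<..}" by (auto simp: einterval_def)
  have "(LBINT y=ereal 0..\<infinity>. g y) = cusp_value H A b C d - W"
  proof (rule interval_integral_FTC_integrable)
    fix y :: real assume "ereal 0 < ereal y"
    hence y: "y > 0" by simp
    show "(G has_vector_derivative g y) (at y)" unfolding G_def g_def by (rule vertical_derivative[OF det y])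
    show "isCont g y" using g y unfolding rapid_decay_def
      by (auto simp: continuous_on_eq_continuous_at)
  next
    show "set_integrable lborel (einterval (ereal 0) \<infinity>) g" unfolding ei by (rule rapid_decay_set_integrable[OF g])
    show "((G \<circ> real_of_ereal) \<longlongrightarrow> W) (at_right (ereal 0))" using A by (simp only: ereal_tendsto_simps)
    show "((G \<circ> real_of_ereal) \<longlongrightarrow> cusp_value H A b C d) (at_left \<infinity>)" using B by (simp only: ereal_tendsto_simps)
  qed auto
  thus ?thesis by (simp add: interval_lebesgue_integral_def ei g_def W_def)
qed

end

end


section \<open>The functional equation and the three-term relation\<close>
context eigenform
begin

lemma moment_integral_cmult:
  assumes "\<And>y. y > 0 \<Longrightarrow> g y = c * (f (of_real x + \<i> * of_real y) * of_real (y ^ n))"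
  shows "(LINT y:{0<..}|lborel. g y) = c * moment_integral n x"
proof -
  have "(LINT y:{0<..}|lborel. g y) = (LINT y:{0<..}|lborel. c * (f (of_real x + \<i> * of_real y) * of_real (y ^ n)))"
    by (rule set_lebesgue_integral_cong) (use assms in auto)
  also have "\<dots> = c * moment_integral n x"
    unfolding moment_integral_def by (rule set_integral_mult_right)
  finally show ?thesis .
qed

lemma moment_integral_sum:
  fixes A C :: int
  assumes "coprime A C" "C > 0" and x: "x = of_int A / of_int C"
    and g: "\<And>y. y > 0 \<Longrightarrow> g y = (\<Sum>j\<le>m. c j * (f (of_real x + \<i> * of_real y) * of_real (y ^ (n + j))))"
  shows "(LINT y:{0<..}|lborel. g y) = (\<Sum>j\<le>m. c j * moment_integral (n + j) x)"
proof -
  define F where "F = (\<lambda>j y. f (of_real x + \<i> * of_real y) * complex_of_real (y ^ (n + j)))"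
  have int: "set_integrable lborel {0<..} (F j)" for j
    unfolding F_def by (rule cusp_line_integrable[OF assms(1-3)])
  have "(LINT y:{0<..}|lborel. g y) = (LINT y:{0<..}|lborel. (\<Sum>j\<le>m. c j * F j y))"
    by (rule set_lebesgue_integral_cong) (use g in \<open>auto simp: F_def\<close>)
  also have "\<dots> = (\<Sum>j\<le>m. LINT y:{0<..}|lborel. c j * F j y)"
    unfolding set_lebesgue_integral_def scaleR_sum_right
    by (rule Bochner_Integration.integral_sum)
       (use set_integrable_mult_right[OF int] in \<open>simp add: set_integrable_def\<close>)
  also have "\<dots> = (\<Sum>j\<le>m. c j * moment_integral (n + j) x)"
    unfolding moment_integral_def F_def by (simp only: set_integral_mult_right)
  finally show ?thesis .
qed

text \<open>
  The integral of \<open>f(z) (z - \<beta>)\<^sup>m dz\<close> from \<open>\<beta> = A/c\<close> to \<open>i\<infinity>\<close>, computed once directly and once,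
  with the opposite orientation, after pulling it back to the vertical line above \<open>-d/c\<close>.
  There the root at \<open>\<beta>\<close> has moved to infinity and the root at infinity to \<open>-d/c\<close>.
\<close>
lemma moment_functional_equation:
  fixes A b c d :: int
  assumes k: "k = 2 * m + 2" and det: "A * d - b * c = 1" and c: "c > 0"
  shows "moment_integral m (of_int A / of_int c) = (-1) ^ (m + 1) * moment_integral m (- of_int d / of_int c)"
proof -
  define \<beta> where "\<beta> = (of_int A / of_int c :: complex)"
  obtain H where H: "\<And>z. z \<in> upper_half_plane \<Longrightarrow>
      (H has_field_derivative f z * (1 * z - \<beta>) ^ m * (0 * z - (- 1)) ^ m) (at z)"
    using primitive_exists[of 1 \<beta> m 0 "- 1"] by blast
  note line = period_line[OF k H]
  have c0: "(of_int c :: complex) \<noteq> 0" using c by simp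
  note det_c = of_int_det[OF det, where 'a = complex]
  have "cusp_value H 1 0 0 1 - cusp_value H A b c d =
      (LINT y:{0<..}|lborel. \<i> * pullback m 1 \<beta> 0 (- 1) 1 0 0 1
        (of_real (of_int A / of_int c) + \<i> * of_real y))"
    using line[of 1 1 0 0 A d b c, OF _ _ det c refl] by simp
  also have "\<dots> = \<i> ^ (m + 1) * moment_integral m (of_int A / of_int c)"
    by (rule moment_integral_cmult) (simp add: pullback_def \<beta>_def power_mult_distrib)
  finally have 1: "cusp_value H 1 0 0 1 - cusp_value H A b c d = \<i> ^ (m + 1) * moment_integral m (of_int A / of_int c)" .
  have det2: "(- d) * (- A) - b * c = 1" using det by (simp add: mult.commute)
  have e: "A * (- d) + b * c = - 1" "A * b + b * (- A) = 0" "c * (- d) + d * c = 0" "c * b + d * (- A) = - 1"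
    using det by (auto simp: algebra_simps)
  \<comment> \<open>The line above \<open>-d/c\<close> ends at \<open>i\<infinity>\<close>, but named by the matrix \<open>-1\<close> instead of \<open>1\<close>.\<close>
  have V: "cusp_value H (- 1) 0 0 (- 1) = cusp_value H 1 0 0 1" by (simp add: cusp_value_def moebius_def)
  have "cusp_value H A b c d - cusp_value H 1 0 0 1 =
      (LINT y:{0<..}|lborel. \<i> * pullback m 1 \<beta> 0 (- 1) A b c d
        (of_real (of_int (- d) / of_int c) + \<i> * of_real y))"
    using line[OF _ det det2 c refl] unfolding e V by simp
  also have "\<dots> = \<i> * (- \<i>) ^ m * moment_integral m (of_int (- d) / of_int c)"
  proof (rule moment_integral_cmult)
    fix y :: real assume "y > 0"
    define w where "w = complex_of_real (of_int (- d) / of_int c) + \<i> * of_real y"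
    have "1 * (of_int A * w + of_int b) - \<beta> * (of_int c * w + of_int d) =
        - (of_int A * of_int d - of_int b * of_int c) / of_int c"
      using c0 by (simp add: \<beta>_def field_simps)
    hence 1: "1 * (of_int A * w + of_int b) - \<beta> * (of_int c * w + of_int d) = - 1 / of_int c"
      unfolding det_c by simp
    have 2: "0 * (of_int A * w + of_int b) - (- 1) * (of_int c * w + of_int d) = of_int c * \<i> * of_real y"
      using c0 by (simp add: w_def field_simps)
    have "pullback m 1 \<beta> 0 (- 1) A b c d w = f w * ((- 1 / of_int c) * (of_int c * \<i> * of_real y)) ^ m"
      unfolding pullback_def 1 2 power_mult_distrib by (simp only: mult.assoc)
    also have "(- 1 / of_int c) * (of_int c * \<i> * of_real y) = (- \<i>) * of_real y" using c0 by simp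
    finally show "\<i> * pullback m 1 \<beta> 0 (- 1) A b c d w = \<i> * (- \<i>) ^ m * (f w * of_real (y ^ m))"
      by (simp only: power_mult_distrib of_real_power mult_ac)
  qed
  also have "\<i> * (- \<i>) ^ m = (-1) ^ m * \<i> ^ (m + 1)" by (subst power_minus) simp
  finally have 2: "cusp_value H A b c d - cusp_value H 1 0 0 1 =
      (-1) ^ m * \<i> ^ (m + 1) * moment_integral m (of_int (- d) / of_int c)" .
  have "\<i> ^ (m + 1) * moment_integral m (of_int A / of_int c) =
      - ((-1) ^ m * \<i> ^ (m + 1) * moment_integral m (of_int (- d) / of_int c))"
    unfolding 1[symmetric] 2[symmetric] by simp
  also have "\<dots> = \<i> ^ (m + 1) * ((-1) ^ (m + 1) * moment_integral m (of_int (- d) / of_int c))"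
    by simp
  finally have eq: "\<i> ^ (m + 1) * moment_integral m (of_int A / of_int c) =
      \<i> ^ (m + 1) * ((-1) ^ (m + 1) * moment_integral m (of_int (- d) / of_int c))" .
  have "\<i> ^ (m + 1) \<noteq> 0" by simp
  from iffD1[OF mult_left_cancel[OF this] eq] show ?thesis by (simp only: of_int_minus)
qed

text \<open>The coefficients of \<open>y\<^bsup>m+j\<^esup>\<close> in \<open>\<i> (\<i> y)\<^sup>m (\<i> y + c)\<^sup>m\<close>.\<close>
definition three_term_coeff :: "nat \<Rightarrow> complex \<Rightarrow> nat \<Rightarrow> complex" where
  "three_term_coeff m c j = \<i> * of_nat (m choose j) * c ^ (m - j) * \<i> ^ (m + j)"

text \<open>
  The sides of the ideal triangle with cusps \<open>i\<infinity>\<close>, \<open>\<beta>\<close> and \<open>\<beta>'\<close> for the form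
  \<open>f(z) (z - \<beta>)\<^sup>m (z - \<beta>')\<^sup>m dz\<close>. The matrix \<open>(A, B; p, D)\<close> sends \<open>i\<infinity>\<close> to \<open>\<beta>'\<close> and \<open>t/q\<close> to \<open>\<beta>\<close>; the condition
  on \<open>r\<close> says that \<open>r\<close> is the denominator of that image.
\<close>
lemma moment_three_term:
  fixes A B p D t u q v r :: int
  assumes k: "k = 2 * m + 2" and det: "A * D - B * p = 1" and det': "t * v - u * q = 1"
    and pos: "p > 0" "q > 0" "r > 0" and r: "r = p * t + D * q"
  defines "\<beta> \<equiv> of_int (A * t + B * q) / real_of_int r" and "\<beta>' \<equiv> of_int A / real_of_int p"
    and "\<delta> \<equiv> complex_of_int q / (of_int p * of_int r)"
  shows "\<i> * (- \<delta> * \<i>) ^ m * moment_integral m (of_int t / of_int q) =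
    (\<Sum>j\<le>m. three_term_coeff m (- \<delta>) j * moment_integral (m + j) \<beta>) -
    (\<Sum>j\<le>m. three_term_coeff m \<delta> j * moment_integral (m + j) \<beta>')"
proof -
  let ?P = "pullback m 1 (of_real \<beta>) 1 (of_real \<beta>')"
  let ?S = "\<lambda>c x. \<Sum>j\<le>m. three_term_coeff m c j * moment_integral (m + j) x"
  let ?L = "\<lambda>\<beta>\<^sub>1 w. 1 * (of_int A * w + of_int B) - of_real \<beta>\<^sub>1 * (of_int p * w + of_int D)"
  have nz: "(of_int p :: complex) \<noteq> 0" "(of_int q :: complex) \<noteq> 0" "(of_int r :: complex) \<noteq> 0"
    using pos by auto
  note det_c = of_int_det[OF det, where 'a = complex]
  have r_c: "complex_of_int r = of_int p * of_int t + of_int D * of_int q" by (simp add: r)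
  have \<beta>: "complex_of_real \<beta> = (of_int A * of_int t + of_int B * of_int q) / of_int r" by (simp add: \<beta>_def)
  have \<beta>': "complex_of_real \<beta>' = of_int A / of_int p" by (simp add: \<beta>'_def)
  have diff: "complex_of_real \<beta>' - of_real \<beta> = \<delta>"
  proof -
    have "complex_of_real \<beta>' - of_real \<beta> =
        (of_int A * of_int r - of_int p * (of_int A * of_int t + of_int B * of_int q)) / (of_int p * of_int r)"
      unfolding \<beta> \<beta>' using nz by (simp add: field_simps)
    also have "of_int A * of_int r - of_int p * (of_int A * of_int t + of_int B * of_int q) =
        of_int q * (complex_of_int A * of_int D - of_int B * of_int p)"
      unfolding r_c by (simp add: algebra_simps)
    finally show ?thesis by (simp add: det_c \<delta>_def)
  qed
  obtain H where H: "\<And>z. z \<in> upper_half_plane \<Longrightarrow>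
      (H has_field_derivative f z * (1 * z - of_real \<beta>) ^ m * (1 * z - of_real \<beta>') ^ m) (at z)"
    using primitive_exists[of 1 "of_real \<beta>" m 1 "of_real \<beta>'"] by blast
  note line = period_line[OF k H]
  let ?I = "cusp_value H 1 0 0 1"
  let ?V = "cusp_value H (A * t + B * q) (A * u + B * v) r (p * u + D * v)"
  have detW: "(A * t + B * q) * (p * u + D * v) - (A * u + B * v) * r = 1"
    unfolding r by (rule det_mult[OF det det'])
  have id_pullback: "pullback m 1 z1 1 z2 1 0 0 1 w = f w * (w - z1) ^ m * (w - z2) ^ m" for z1 z2 w
    by (simp add: pullback_def)
  have bin: "\<i> * (f w * (\<i> * of_real y) ^ m * (\<i> * of_real y + c) ^ m) =
      (\<Sum>j\<le>m. three_term_coeff m c j * (f w * of_real (y ^ (m + j))))" for w y c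
  proof -
    have "\<i> * (f w * (\<i> * of_real y) ^ m * (\<i> * of_real y + c) ^ m) =
       (\<Sum>j\<le>m. \<i> * (f w * (\<i> * of_real y) ^ m * (of_nat (m choose j) * (\<i> * of_real y) ^ j * c ^ (m - j))))"
      unfolding binomial_ring by (simp only: sum_distrib_left)
    also have "\<dots> = (\<Sum>j\<le>m. three_term_coeff m c j * (f w * of_real (y ^ (m + j))))"
      by (intro sum.cong refl)
         (simp only: three_term_coeff_def power_mult_distrib power_add of_real_mult of_real_power mult_ac)
    finally show ?thesis .
  qed
  have "?I - ?V =
      (LINT y:{0<..}|lborel. \<i> * ?P 1 0 0 1 (of_real \<beta> + \<i> * of_real y))"
    using line[of 1 1 0 0 "A * t + B * q" "p * u + D * v" "A * u + B * v" r \<beta>, OF _ _ detW pos(3)] by (simp add: \<beta>_def)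
  also have "\<dots> = ?S (- \<delta>) \<beta>"
  proof (rule moment_integral_sum[OF det_coprime[OF detW] pos(3)])
    show "\<beta> = real_of_int (A * t + B * q) / real_of_int r" by (simp add: \<beta>_def)
    fix y :: real
    have e: "of_real \<beta> + \<i> * of_real y - of_real \<beta> = \<i> * of_real y" "of_real \<beta> + \<i> * of_real y - of_real \<beta>' = \<i> * of_real y + (- \<delta>)"
      using diff by (auto simp: algebra_simps)
    show "\<i> * ?P 1 0 0 1 (of_real \<beta> + \<i> * of_real y) =
      (\<Sum>j\<le>m. three_term_coeff m (- \<delta>) j * (f (of_real \<beta> + \<i> * of_real y) * of_real (y ^ (m + j))))"
      unfolding id_pullback e by (rule bin)
  qed
  finally have L1: "?I - ?V =
    ?S (- \<delta>) \<beta>" .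
  have "?I - cusp_value H A B p D =
      (LINT y:{0<..}|lborel. \<i> * ?P 1 0 0 1 (of_real \<beta>' + \<i> * of_real y))"
    using line[of 1 1 0 0 A D B p \<beta>', OF _ _ det pos(1)] by (simp add: \<beta>'_def)
  also have "\<dots> = ?S \<delta> \<beta>'"
  proof (rule moment_integral_sum[OF det_coprime[OF det] pos(1)])
    show "\<beta>' = real_of_int A / real_of_int p" by (simp add: \<beta>'_def)
    fix y :: real
    have e: "of_real \<beta>' + \<i> * of_real y - of_real \<beta>' = \<i> * of_real y" "of_real \<beta>' + \<i> * of_real y - of_real \<beta> = \<i> * of_real y + \<delta>"
      using diff by (auto simp: algebra_simps)
    show "\<i> * ?P 1 0 0 1 (of_real \<beta>' + \<i> * of_real y) =
      (\<Sum>j\<le>m. three_term_coeff m \<delta> j * (f (of_real \<beta>' + \<i> * of_real y) * of_real (y ^ (m + j))))"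
      unfolding id_pullback e bin[symmetric] by (simp only: mult_ac)
  qed
  finally have L2: "?I - cusp_value H A B p D =
    ?S \<delta> \<beta>'" .
  have "cusp_value H A B p D - ?V =
      (LINT y:{0<..}|lborel. \<i> * ?P A B p D (of_real (of_int t / of_int q) + \<i> * of_real y))"
    using line[OF _ det det' pos(2) refl] by (simp add: r)
  also have "\<dots> = \<i> * (- \<delta> * \<i>) ^ m * moment_integral m (of_int t / of_int q)"
  proof (rule moment_integral_cmult)
    fix y :: real assume "y > 0"
    define w where "w = complex_of_real (of_int t / of_int q) + \<i> * of_real y"
    have "?L \<beta>' w =
        - (of_int A * of_int D - of_int B * of_int p) / of_int p"
      using nz by (simp add: \<beta>' field_simps)
    hence 1: "?L \<beta>' w = - 1 / of_int p"
      unfolding det_c by simp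
    have den: "of_int p * w + of_int D = of_int p * \<i> * of_real y + of_int r / of_int q"
      unfolding r_c using nz by (simp add: w_def field_simps)
    have "?L \<beta> w =
        (?L \<beta>' w) + \<delta> * (of_int p * w + of_int D)"
      unfolding diff[symmetric] by (simp add: algebra_simps)
    also have "\<dots> = - 1 / of_int p + \<delta> * (of_int p * \<i> * of_real y + of_int r / of_int q)"
      by (subst 1, subst den, rule refl)
    also have "- 1 / of_int p + \<delta> * (of_int p * \<i> * of_real y + of_int r / of_int q) = \<delta> * of_int p * \<i> * of_real y"
      using nz by (simp add: \<delta>_def field_simps)
    finally have 2: "?L \<beta> w = \<delta> * of_int p * \<i> * of_real y" .
    have "?P A B p D w =
        f w * ((\<delta> * of_int p * \<i> * of_real y) * (- 1 / of_int p)) ^ m"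
      unfolding pullback_def 1 2 power_mult_distrib by (simp only: mult.assoc)
    also have "(\<delta> * of_int p * \<i> * of_real y) * (- 1 / of_int p) = (- \<delta> * \<i>) * of_real y" using nz by simp
    finally show "\<i> * ?P A B p D w =
        \<i> * (- \<delta> * \<i>) ^ m * (f w * of_real (y ^ m))"
      by (simp only: power_mult_distrib of_real_power mult_ac)
  qed
  finally have L3: "cusp_value H A B p D - ?V =
    \<i> * (- \<delta> * \<i>) ^ m * moment_integral m (of_int t / of_int q)" .
  show ?thesis unfolding L1[symmetric] L2[symmetric] L3[symmetric] by simp
qed

lemma additive_functional_equation:
  fixes A b c d :: int
  assumes "A * d - b * c = 1" "c > 0"
  shows "additive_continuation (- of_int d / of_int c) (1 / 2) = \<i> ^ k * additive_continuation (of_int A / of_int c) (1 / 2)"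
proof -
  obtain m where k: "k = 2 * m + 2"
  proof
    show "k = 2 * (k div 2 - 1) + 2" using even_k k_pos by (auto elim!: evenE)
  qed
  have ik: "\<i> ^ k = (-1) ^ (m + 1)" unfolding k by (simp add: power_mult power_add)
  have half: "additive_continuation x (1 / 2) = (2 * pi) ^ (m + 1) / fact m * moment_integral m x" for x
    using additive_continuation_half[OF k, of x 0] by simp
  have "(-1 :: complex) ^ (m + 1) * (-1) ^ (m + 1) = 1" by (simp flip: power_mult_distrib)
  thus ?thesis
    unfolding half ik moment_functional_equation[OF k assms] by (simp only: mult.left_commute mult.assoc[symmetric] mult_1_left)
qed

text \<open>
  The three-term relation divided by \<open>\<i> (-\<delta> \<i>)\<^sup>m m! / (2\<pi>)\<^bsup>m+1\<^esup>\<close>, the ratio of the third side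
  to \<open>L(1/2, f, t/q)\<close>.
\<close>
lemma additive_reciprocity:
  fixes A B p D t u q v r :: int
  assumes k: "k = 2 * m + 2" and det: "A * D - B * p = 1" and det': "t * v - u * q = 1"
    and pos: "p > 0" "q > 0" "r > 0" and r: "r = p * t + D * q"
  defines "\<beta> \<equiv> of_int (A * t + B * q) / real_of_int r" and "\<beta>' \<equiv> of_int A / real_of_int p"
    and "\<delta> \<equiv> complex_of_int q / (of_int p * of_int r)"
  shows "additive_continuation (of_int t / of_int q) (1 / 2) =
    (\<Sum>j\<le>m. fact (m + j) / (fact j * fact (m - j)) * (2 * of_real pi * \<i> * \<delta>) powi (- int j) *
       (additive_continuation \<beta> (1 / 2 + of_nat j) + (-1) ^ j * \<i> ^ k * additive_continuation \<beta>' (1 / 2 + of_nat j)))"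
proof -
  define \<pi>2 where "\<pi>2 = complex_of_real (2 * pi)"
  have nz: "\<delta> \<noteq> 0" "\<pi>2 \<noteq> 0" using pos by (auto simp: \<delta>_def \<pi>2_def)
  define c where "c = \<i> * (- \<delta> * \<i>) ^ m * fact m / \<pi>2 ^ (m + 1)"
  have c0: "c \<noteq> 0" using nz by (simp add: c_def)
  have ik: "\<i> ^ k = (-1) ^ (m + 1)" unfolding k by (simp add: power_mult power_add)
  have mom: "moment_integral (m + j) x = fact (m + j) / \<pi>2 ^ (m + j + 1) * additive_continuation x (1 / 2 + of_nat j)" for j x
    unfolding additive_continuation_half[OF k] \<pi>2_def using nz(2) by (simp add: \<pi>2_def)
  have term_eq: "\<i> * of_nat (m choose j) * (- \<delta>) ^ (m - j) * \<i> ^ (m + j) * moment_integral (m + j) \<beta> -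
      \<i> * of_nat (m choose j) * \<delta> ^ (m - j) * \<i> ^ (m + j) * moment_integral (m + j) \<beta>' =
      c * (fact (m + j) / (fact j * fact (m - j)) * (2 * of_real pi * \<i> * \<delta>) powi (- int j) *
       (additive_continuation \<beta> (1 / 2 + of_nat j) + (-1) ^ j * \<i> ^ k * additive_continuation \<beta>' (1 / 2 + of_nat j)))"
    if j: "j \<le> m" for j
  proof -
    define X where "X = additive_continuation \<beta> (1 / 2 + of_nat j)"
    define Y where "Y = additive_continuation \<beta>' (1 / 2 + of_nat j)"
    define w where "w = of_nat (m choose j) * fact (m + j) * \<i> ^ (m + 1) * (- \<delta>) ^ (m - j) * \<i> ^ j / \<pi>2 ^ (m + j + 1)"
    have s: "\<delta> ^ (m - j) = (-1) ^ (m + j) * (- \<delta>) ^ (m - j)"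
    proof -
      have "(-1 :: complex) ^ (m + j) = (-1) ^ (m - j)" using j by (intro minus_one_power_iff[THEN trans]) (simp add: minus_one_power_iff)
      thus ?thesis by (simp flip: power_mult_distrib)
    qed
    have L: "\<i> * of_nat (m choose j) * (- \<delta>) ^ (m - j) * \<i> ^ (m + j) * moment_integral (m + j) \<beta> -
      \<i> * of_nat (m choose j) * \<delta> ^ (m - j) * \<i> ^ (m + j) * moment_integral (m + j) \<beta>' =
      w * (X + (-1) ^ j * \<i> ^ k * Y)"
    proof -
      have 1: "\<i> * of_nat (m choose j) * (- \<delta>) ^ (m - j) * \<i> ^ (m + j) * (fact (m + j) / \<pi>2 ^ (m + j + 1) * Z) = w * Z" for Z
        by (simp add: w_def power_add mult_ac)
      have "\<i> * of_nat (m choose j) * ((-1) ^ (m + j) * (- \<delta>) ^ (m - j)) * \<i> ^ (m + j) * (fact (m + j) / \<pi>2 ^ (m + j + 1) * Y) =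
          (-1) ^ (m + j) * (\<i> * of_nat (m choose j) * (- \<delta>) ^ (m - j) * \<i> ^ (m + j) * (fact (m + j) / \<pi>2 ^ (m + j + 1) * Y))"
        by (simp only: mult_ac)
      also have "\<dots> = (-1) ^ (m + j) * (w * Y)" unfolding 1 ..
      finally show ?thesis
        unfolding s mom X_def[symmetric] Y_def[symmetric] 1 ik by (simp add: power_add algebra_simps)
    qed
    have pw: "(2 * of_real pi * \<i> * \<delta>) powi (- int j) = \<i> ^ j / (\<pi>2 ^ j * (- \<delta>) ^ j)"
    proof -
      have "2 * of_real pi * \<i> * \<delta> = \<pi>2 * \<i> * \<delta>" by (simp add: \<pi>2_def)
      hence "(2 * of_real pi * \<i> * \<delta>) powi (- int j) = (inverse (\<pi>2 * \<i> * \<delta>)) ^ j"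
        by (simp only: power_int_minus power_int_of_nat power_inverse)
      also have "inverse (\<pi>2 * \<i> * \<delta>) = \<i> / (\<pi>2 * (- \<delta>))" using nz by (simp add: field_simps)
      finally show ?thesis by (simp only: power_divide power_mult_distrib)
    qed
    have ch: "fact m / (fact j * fact (m - j)) = (of_nat (m choose j) :: complex)"
      using binomial_fact[OF j, where 'a = complex] by simp
    have dm: "(- \<delta>) ^ m = (- \<delta>) ^ (m - j) * (- \<delta>) ^ j" using j by (simp flip: power_add)
    have "c * (fact (m + j) / (fact j * fact (m - j)) * (2 * of_real pi * \<i> * \<delta>) powi (- int j)) =
        (fact m / (fact j * fact (m - j))) * fact (m + j) * \<i> ^ (m + 1) * (- \<delta>) ^ (m - j) * \<i> ^ j *
          ((- \<delta>) ^ j / (- \<delta>) ^ j) / (\<pi>2 ^ (m + 1) * \<pi>2 ^ j)"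
      unfolding c_def pw power_mult_distrib dm by (simp add: power_add divide_inverse mult_ac)
    also have "(- \<delta>) ^ j / (- \<delta>) ^ j = 1" using nz by simp
    also have "(fact m / (fact j * fact (m - j))) * fact (m + j) * \<i> ^ (m + 1) * (- \<delta>) ^ (m - j) * \<i> ^ j *
          1 / (\<pi>2 ^ (m + 1) * \<pi>2 ^ j) = w"
      unfolding ch w_def by (simp add: power_add mult_ac)
    finally show ?thesis unfolding L X_def[symmetric] Y_def[symmetric] by (simp only: mult.assoc[symmetric])
  qed
  have "c * additive_continuation (of_int t / of_int q) (1 / 2) =
      \<i> * (- \<delta> * \<i>) ^ m * moment_integral m (of_int t / of_int q)"
    using mom[of 0 "of_int t / of_int q"] by (simp add: c_def)
  also have "\<dots> = (\<Sum>j\<le>m. c * (fact (m + j) / (fact j * fact (m - j)) * (2 * of_real pi * \<i> * \<delta>) powi (- int j) *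
       (additive_continuation \<beta> (1 / 2 + of_nat j) + (-1) ^ j * \<i> ^ k * additive_continuation \<beta>' (1 / 2 + of_nat j))))"
    unfolding moment_three_term[OF k det det' pos r, folded \<beta>_def \<beta>'_def \<delta>_def] three_term_coeff_def sum_subtractf[symmetric]
    by (intro sum.cong refl term_eq) simp
  finally show ?thesis using c0 unfolding sum_distrib_left[symmetric] by simp
qed

end


section \<open>Dirichlet characters to a prime modulus\<close>

lemma coprime_add_modulus: "coprime (x + int q) (int q) \<longleftrightarrow> coprime x (int q)"
  by (simp add: coprime_iff_gcd_eq_1)

lemma coprime_prime_int_iff:
  assumes "prime q"
  shows "coprime n (int q) \<longleftrightarrow> \<not> int q dvd n"
proof
  assume cop: "coprime n (int q)"
  show "\<not> int q dvd n"
  proof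
    assume "int q dvd n"
    from coprime_common_divisor[OF cop this dvd_refl] show False
      using prime_gt_1_nat[OF assms] by simp
  qed
next
  assume "\<not> int q dvd n"
  hence "coprime (int q) n" using assms by (intro prime_imp_coprime) auto
  thus "coprime n (int q)" by (simp add: coprime_commute)
qed

lemma character_cong:
  assumes "dirichlet_character q \<psi>" "[x = y] (mod int q)"
  shows "\<psi> x = \<psi> y"
proof -
  have per: "\<psi> (x + int q * int t) = \<psi> x" for x t
  proof (induction t)
    case (Suc t)
    have "\<psi> ((x + int q * int t) + int q) = \<psi> (x + int q * int t)"
      using assms(1) unfolding dirichlet_character_def by blast
    with Suc.IH show ?case by (simp add: algebra_simps)
  qed simp
  obtain t where t: "y = x + int q * t" using assms(2) by (metis cong_iff_lin)
  show ?thesis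
  proof (cases "t \<ge> 0")
    case True
    thus ?thesis using per[of x "nat t"] t by simp
  next
    case False
    thus ?thesis using per[of y "nat (- t)"] t by simp
  qed
qed

lemma character_mult: "dirichlet_character q \<psi> \<Longrightarrow> \<psi> (x * y) = \<psi> x * \<psi> y"
  unfolding dirichlet_character_def by blast

lemma character_eq_0_iff: "dirichlet_character q \<psi> \<Longrightarrow> \<psi> x = 0 \<longleftrightarrow> \<not> coprime x (int q)"
  unfolding dirichlet_character_def by blast

lemma character_1: "dirichlet_character q \<psi> \<Longrightarrow> \<psi> 1 = 1"
  using character_mult[of q \<psi> 1 1] character_eq_0_iff[of q \<psi> 1] by simp

lemma character_power: "dirichlet_character q \<psi> \<Longrightarrow> \<psi> (x ^ i) = \<psi> x ^ i"
  by (induction i) (simp_all add: character_1 character_mult)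

lemma primroot_power_surj:
  assumes "prime q" "residue_primroot q g" "coprime u (int q)"
  obtains i where "[int g ^ i = u] (mod int q)"
proof -
  have q: "q > 1" using assms(1) prime_gt_1_nat by blast
  define x where "x = nat (u mod int q)"
  have x: "int x = u mod int q" using q by (simp add: x_def)
  have "coprime (int x) (int q)" using assms(3) q by (simp add: x coprime_mod_left_iff)
  hence cop: "coprime x q" by simp
  have "x \<noteq> 0" using cop q by (cases "x = 0") auto
  moreover have "int x < int q" unfolding x using q by simp
  ultimately have "x \<in> totatives q" using cop by (simp add: totatives_def)
  moreover have "(\<lambda>i. g ^ i mod q) ` {..<totient q} = totatives q"
    using residue_primroot_is_generator[OF q assms(2)] by (simp add: bij_betw_def)
  ultimately have "x \<in> (\<lambda>i. g ^ i mod q) ` {..<totient q}" by simp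
  then obtain i where i: "g ^ i mod q = x" by blast
  have "int g ^ i mod int q = int (g ^ i mod q)" by (simp add: zmod_int)
  also have "\<dots> = u mod int q" using i x by simp
  finally show ?thesis using that by (simp add: cong_def)
qed

text \<open>
  The group of units is generated by \<open>g\<close>, so a character is determined by its value at \<open>g\<close>, and this value can
  be any root of unity of order dividing \<open>q - 1\<close>.
\<close>
lemma character_bij_roots:
  assumes q: "prime q" and g: "residue_primroot q g"
  shows "bij_betw (\<lambda>\<psi>. \<psi> (int g)) {\<psi>. dirichlet_character q \<psi>} {z. z ^ (q - 1) = 1}"
proof (rule bij_betw_imageI)
  have cop_g: "coprime q g" and ord_g: "ord q g = q - 1"
    using g q by (auto simp: residue_primroot_def totient_prime)
  have q1: "q > 1" using q prime_gt_1_nat by blast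
  have pow_cong: "z ^ i = z ^ j" if "z ^ (q - 1) = 1" "[int g ^ i = int g ^ j] (mod int q)" for z :: complex and i j
  proof -
    have "[g ^ i = g ^ j] (mod q)" using that(2) by (simp flip: cong_int_iff)
    hence c: "[i = j] (mod (q - 1))" using order_divides_expdiff[OF cop_g] ord_g by simp
    have red: "z ^ n = z ^ (n mod (q - 1))" for n
    proof -
      have "z ^ n = z ^ ((q - 1) * (n div (q - 1)) + n mod (q - 1))" by simp
      also have "\<dots> = z ^ (n mod (q - 1))" unfolding power_add power_mult that(1) by simp
      finally show ?thesis .
    qed
    show ?thesis using red[of i] red[of j] c by (simp add: cong_def)
  qed
  show "inj_on (\<lambda>\<psi>. \<psi> (int g)) {\<psi>. dirichlet_character q \<psi>}"
  proof (rule inj_onI)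
    fix \<psi> \<theta> :: "int \<Rightarrow> complex"
    assume "\<psi> \<in> {\<psi>. dirichlet_character q \<psi>}" "\<theta> \<in> {\<psi>. dirichlet_character q \<psi>}" and eq: "\<psi> (int g) = \<theta> (int g)"
    hence chars: "dirichlet_character q \<psi>" "dirichlet_character q \<theta>" by auto
    show "\<psi> = \<theta>"
    proof
      fix u
      show "\<psi> u = \<theta> u"
      proof (cases "coprime u (int q)")
        case True
        then obtain i where i: "[int g ^ i = u] (mod int q)" using primroot_power_surj[OF q g] by blast
        show ?thesis using character_cong[OF chars(1) i] character_cong[OF chars(2) i] eq
          by (simp add: character_power[OF chars(1)] character_power[OF chars(2)])
      next
        case False
        thus ?thesis using character_eq_0_iff[OF chars(1)] character_eq_0_iff[OF chars(2)] by metis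
      qed
    qed
  qed
  show "(\<lambda>\<psi>. \<psi> (int g)) ` {\<psi>. dirichlet_character q \<psi>} = {z. z ^ (q - 1) = 1}"
  proof (intro equalityI subsetI)
    fix z assume "z \<in> (\<lambda>\<psi>. \<psi> (int g)) ` {\<psi>. dirichlet_character q \<psi>}"
    then obtain \<psi> where \<psi>: "dirichlet_character q \<psi>" "z = \<psi> (int g)" by auto
    have "ord q g dvd q - 1" using ord_g by simp
    hence "[g ^ (q - 1) = 1] (mod q)" by (simp only: ord_divides)
    hence "[int g ^ (q - 1) = 1] (mod int q)" by (metis cong_int_iff of_nat_1 of_nat_power)
    from character_cong[OF \<psi>(1) this] show "z \<in> {z. z ^ (q - 1) = 1}"
      using \<psi> by (simp add: character_power character_1)
  next
    fix z :: complex assume "z \<in> {z. z ^ (q - 1) = 1}"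
    hence z: "z ^ (q - 1) = 1" by simp
    \<comment> \<open>Some discrete logarithm; another choice changes it by a multiple of \<open>q - 1\<close>, which \<open>z\<close> does not see.\<close>
    define ind where "ind = (\<lambda>u. SOME i. [int g ^ i = u] (mod int q))"
    have ind: "[int g ^ ind u = u] (mod int q)" if "coprime u (int q)" for u
      unfolding ind_def using primroot_power_surj[OF q g that] by (metis someI)
    define \<psi> where "\<psi> = (\<lambda>u. if coprime u (int q) then z ^ ind u else 0)"
    have z0: "z \<noteq> 0" using z q1 by (auto simp: power_0_left)
    have "dirichlet_character q \<psi>"
      unfolding dirichlet_character_def
    proof (intro conjI allI)
      fix x y
      show "\<psi> (x * y) = \<psi> x * \<psi> y"
      proof (cases "coprime x (int q) \<and> coprime y (int q)")
        case True
        hence "[int g ^ ind x * int g ^ ind y = x * y] (mod int q)" by (intro cong_mult ind) auto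
        moreover have "[int g ^ ind (x * y) = x * y] (mod int q)" using True by (intro ind) simp
        ultimately have "[int g ^ ind (x * y) = int g ^ (ind x + ind y)] (mod int q)"
          unfolding power_add by (metis cong_sym cong_trans)
        from pow_cong[OF z this] show ?thesis using True by (simp add: \<psi>_def power_add)
      qed (auto simp: \<psi>_def)
    next
      fix x
      show "\<psi> (x + int q) = \<psi> x"
      proof (cases "coprime x (int q)")
        case True
        hence cop: "coprime (x + int q) (int q)" by (simp only: coprime_add_modulus)
        have "[x + int q = x] (mod int q)" by (simp add: cong_def)
        with ind[OF cop] ind[OF True] have "[int g ^ ind (x + int q) = int g ^ ind x] (mod int q)"
          by (metis cong_sym cong_trans)
        from pow_cong[OF z this] show ?thesis using True cop by (simp add: \<psi>_def)
      qed (simp add: \<psi>_def coprime_add_modulus)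
    next
      fix x show "(\<psi> x \<noteq> 0) = coprime x (int q)" using z0 by (simp add: \<psi>_def)
    qed
    moreover have "\<psi> (int g) = z"
    proof -
      have cop: "coprime (int g) (int q)" using cop_g by (simp add: coprime_commute)
      from pow_cong[OF z, of "ind (int g)" 1] ind[OF cop] show ?thesis using cop by (simp add: \<psi>_def)
    qed
    ultimately show "z \<in> (\<lambda>\<psi>. \<psi> (int g)) ` {\<psi>. dirichlet_character q \<psi>}" by force
  qed
qed

lemma finite_characters: "prime q \<Longrightarrow> finite {\<psi>. dirichlet_character q \<psi>}"
proof -
  assume q: "prime q"
  obtain g where "residue_primroot q g" using q prime_primitive_root_exists[of q] prime_gt_1_nat[OF q] by blast
  from bij_betw_finite[OF character_bij_roots[OF q this]] show ?thesis
    using q prime_gt_1_nat[OF q] by (simp add: finite_roots_unity)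
qed

lemma sum_characters:
  assumes q: "prime q" and u: "coprime u (int q)"
  shows "(\<Sum>\<psi> | dirichlet_character q \<psi>. \<psi> u) = (if [u = 1] (mod int q) then of_nat (q - 1) else 0)"
proof -
  obtain g where g: "residue_primroot q g" using q prime_primitive_root_exists[of q] prime_gt_1_nat[OF q] by blast
  have cop_g: "coprime q g" and ord_g: "ord q g = q - 1"
    using g q by (auto simp: residue_primroot_def totient_prime)
  have q1: "q - 1 > 0" using prime_gt_1_nat[OF q] by simp
  obtain i where i: "[int g ^ i = u] (mod int q)" using primroot_power_surj[OF q g u] by blast
  have "(\<Sum>\<psi> | dirichlet_character q \<psi>. \<psi> u) = (\<Sum>\<psi> | dirichlet_character q \<psi>. \<psi> (int g) ^ i)"
  proof (intro sum.cong refl)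
    fix \<psi> assume "\<psi> \<in> {\<psi>. dirichlet_character q \<psi>}"
    thus "\<psi> u = \<psi> (int g) ^ i" using character_cong[of q \<psi>, OF _ i] by (simp add: character_power)
  qed
  also have "\<dots> = (\<Sum>z | z ^ (q - 1) = 1. z ^ i)"
    by (rule sum.reindex_bij_betw[OF character_bij_roots[OF q g]])
  also have "\<dots> = (\<Sum>j<q - 1. cis (2 * pi * real j / real (q - 1)) ^ i)"
    by (rule sum.reindex_bij_betw[OF Complex.bij_betw_roots_unity[OF q1], symmetric])
  also have "\<dots> = (\<Sum>j<q - 1. ee (of_int (int i) * of_nat j / of_nat (q - 1)))"
  proof (intro sum.cong refl)
    fix j
    have "cis (2 * pi * real j / real (q - 1)) = ee (of_nat j / of_nat (q - 1))"
      by (simp add: ee_def cis_conv_exp mult_ac)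
    thus "cis (2 * pi * real j / real (q - 1)) ^ i = ee (of_int (int i) * of_nat j / of_nat (q - 1))"
      by (simp add: ee_of_nat_mult[symmetric] del: of_nat_diff)
  qed
  also have "\<dots> = (if int (q - 1) dvd int i then of_nat (q - 1) else 0)" by (rule sum_ee[OF q1])
  also have "int (q - 1) dvd int i \<longleftrightarrow> [u = 1] (mod int q)"
  proof -
    have "int (q - 1) dvd int i \<longleftrightarrow> [g ^ i = 1] (mod q)" using ord_g by (simp only: ord_divides of_nat_dvd_iff)
    also have "\<dots> \<longleftrightarrow> [int g ^ i = 1] (mod int q)" by (metis cong_int_iff of_nat_1 of_nat_power)
    also have "\<dots> \<longleftrightarrow> [u = 1] (mod int q)" using i by (metis cong_sym cong_trans)
    finally show ?thesis .
  qed
  finally show ?thesis .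
qed

lemma character_inverse:
  assumes q: "prime q" and \<psi>: "dirichlet_character q \<psi>" and w: "[w * w' = 1] (mod int q)"
  shows "cnj (\<psi> w) = \<psi> w'"
proof -
  have mult: "\<psi> w * \<psi> w' = 1"
    using character_cong[OF \<psi> w] by (simp add: character_mult[OF \<psi>] character_1[OF \<psi>])
  hence "\<psi> w \<noteq> 0" by auto
  hence cop: "coprime w (int q)" using character_eq_0_iff[OF \<psi>] by blast
  obtain g where g: "residue_primroot q g" using q prime_primitive_root_exists[of q] prime_gt_1_nat[OF q] by blast
  obtain i where i: "[int g ^ i = w] (mod int q)" using primroot_power_surj[OF q g cop] by blast
  have "\<psi> (int g) ^ (q - 1) = 1"
    using bij_betwE[OF character_bij_roots[OF q g]] \<psi> by blast
  hence "norm (\<psi> (int g)) ^ (q - 1) = 1" by (metis norm_one norm_power)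
  hence "norm (\<psi> (int g)) ^ (q - 1) = 1 ^ (q - 1)" by simp
  hence "norm (\<psi> (int g)) = 1" by (rule power_eq_imp_eq_base) (use prime_gt_1_nat[OF q] in auto)
  hence "norm (\<psi> w) = 1"
    unfolding character_cong[OF \<psi> i, symmetric] character_power[OF \<psi>] norm_power by simp
  hence "cnj (\<psi> w) * \<psi> w = 1" by (simp add: mult.commute[of "cnj _"] complex_norm_square[symmetric])
  hence "cnj (\<psi> w) * (\<psi> w * \<psi> w') = \<psi> w'" by (simp add: mult.assoc[symmetric])
  thus ?thesis by (simp add: mult)
qed

lemma character_orthogonality:
  assumes q: "prime q"
  shows "(\<Sum>\<psi> | dirichlet_character q \<psi>. \<psi> x * cnj (\<psi> w)) =
    (if coprime w (int q) \<and> [x = w] (mod int q) then of_nat (q - 1) else 0)"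
proof (cases "coprime w (int q) \<and> coprime x (int q)")
  case False
  have "(\<Sum>\<psi> | dirichlet_character q \<psi>. \<psi> x * cnj (\<psi> w)) = 0"
    by (intro sum.neutral) (use False character_eq_0_iff in auto)
  moreover have n: "\<not> (coprime w (int q) \<and> [x = w] (mod int q))"
    using False by (metis cong_imp_coprime cong_sym)
  ultimately show ?thesis by (simp only: if_False)
next
  case True
  obtain w' where w': "[w * w' = 1] (mod int q)" using True cong_solve_coprime_int by blast
  have cop': "coprime w' (int q)" using w' by (metis coprime_iff_invertible_int mult.commute)
  have "(\<Sum>\<psi> | dirichlet_character q \<psi>. \<psi> x * cnj (\<psi> w)) = (\<Sum>\<psi> | dirichlet_character q \<psi>. \<psi> (x * w'))"
    using character_inverse[OF q _ w'] by (intro sum.cong refl) (simp add: character_mult)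
  also have "\<dots> = (if [x * w' = 1] (mod int q) then of_nat (q - 1) else 0)"
    by (rule sum_characters[OF q]) (use True cop' in simp)
  also have "[x * w' = 1] (mod int q) \<longleftrightarrow> [x = w] (mod int q)"
  proof
    assume "[x * w' = 1] (mod int q)"
    hence "[x * w' = w * w'] (mod int q)" using w' by (metis cong_sym cong_trans)
    thus "[x = w] (mod int q)" using cop' by (simp add: cong_mult_rcancel)
  next
    assume "[x = w] (mod int q)"
    hence "[x * w' = w * w'] (mod int q)" by (rule cong_scalar_right)
    thus "[x * w' = 1] (mod int q)" using w' by (rule cong_trans)
  qed
  finally show ?thesis using True by simp
qed

definition principal_character :: "nat \<Rightarrow> int \<Rightarrow> complex" where
  "principal_character q u = (if coprime u (int q) then 1 else 0)"

lemma principal_character: "dirichlet_character q (principal_character q)"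
  by (auto simp: dirichlet_character_def principal_character_def coprime_add_modulus)

lemma primitive_characters_prime:
  assumes q: "prime q"
  shows "{\<psi>. primitive_character q \<psi>} = {\<psi>. dirichlet_character q \<psi>} - {principal_character q}"
proof (intro equalityI subsetI)
  have q1: "q > 1" using q prime_gt_1_nat by blast
  {
    fix \<psi> assume "\<psi> \<in> {\<psi>. primitive_character q \<psi>}"
    hence \<psi>: "dirichlet_character q \<psi>" and "\<exists>a. coprime a (int q) \<and> [a = 1] (mod int 1) \<and> \<psi> a \<noteq> 1"
      using q1 unfolding primitive_character_def by auto
    then obtain a where "coprime a (int q)" "\<psi> a \<noteq> 1" by blast
    hence "\<psi> \<noteq> principal_character q" by (auto simp: principal_character_def)
    thus "\<psi> \<in> {\<psi>. dirichlet_character q \<psi>} - {principal_character q}" using \<psi> by simp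
  next
    fix \<psi> assume "\<psi> \<in> {\<psi>. dirichlet_character q \<psi>} - {principal_character q}"
    hence \<psi>: "dirichlet_character q \<psi>" "\<psi> \<noteq> principal_character q" by auto
    then obtain u where u: "\<psi> u \<noteq> principal_character q u" by blast
    hence cop: "coprime u (int q)"
      using character_eq_0_iff[OF \<psi>(1), of u] by (auto simp: principal_character_def)
    have "\<exists>a. coprime a (int q) \<and> [a = 1] (mod int d) \<and> \<psi> a \<noteq> 1" if "d dvd q" "d < q" for d
    proof -
      have "d = 1" using q that by (auto simp: prime_nat_iff)
      thus ?thesis using u cop by (intro exI[of _ u]) (simp add: principal_character_def)
    qed
    thus "\<psi> \<in> {\<psi>. primitive_character q \<psi>}" using \<psi> by (simp add: primitive_character_def)
  }
qed

lemma gauss_sum_principal: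
  assumes q: "prime q"
  shows "gauss_sum q (principal_character q) = -1"
proof -
  have q1: "q > 1" using q prime_gt_1_nat by blast
  have all: "(\<Sum>n\<in>{0..<int q}. ee (of_int n / of_nat q)) = 0"
  proof -
    have "(\<Sum>n\<in>{0..<int q}. ee (of_int n / of_nat q)) = (\<Sum>n<q. ee (of_int (int n) / of_nat q))"
      by (rule sum.reindex_bij_witness[of _ int nat]) auto
    also have "\<dots> = (\<Sum>n<q. ee (of_int 1 * of_nat n / of_nat q))" by simp
    also have "\<dots> = 0" using sum_ee[of q 1] q1 by simp
    finally show ?thesis .
  qed
  have "gauss_sum q (principal_character q) = (\<Sum>n\<in>{0..<int q} - {0}. ee (of_int n / of_nat q))"
    unfolding gauss_sum_def
  proof (rule sum.mono_neutral_cong_right)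
    show "\<forall>i\<in>{0..<int q} - ({0..<int q} - {0}). principal_character q i * ee (of_int i / of_nat q) = 0"
      using q1 by (auto simp: principal_character_def)
    fix n assume n: "n \<in> {0..<int q} - {0}"
    have "\<not> int q dvd n" using n zdvd_not_zless by auto
    thus "principal_character q n * ee (of_int n / of_nat q) = ee (of_int n / of_nat q)"
      by (simp add: principal_character_def coprime_prime_int_iff[OF q])
  qed auto
  also have "\<dots> = (\<Sum>n\<in>{0..<int q}. ee (of_int n / of_nat q)) - ee (of_int 0 / of_nat q)"
    using q1 by (subst sum_diff1) auto
  finally show ?thesis unfolding all by (simp add: ee_def)
qed

text \<open>
  Over all characters, orthogonality selects from the Gauss sum the single residue \<open>x \<equiv> t n\<close>, provided
  that \<open>n\<close> is prime to \<open>q\<close>. Modulo a prime only the principal character is imprimitive; its Gauss sum is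
  \<open>-1\<close>, and removing it adds \<open>1\<close>.
\<close>
lemma sum_primitive_gauss:
  assumes q: "prime q" and cop: "coprime a (int q)" "coprime b (int q)" and t: "[t * a = b] (mod int q)"
  shows "(\<Sum>\<psi> | primitive_character q \<psi>. gauss_sum q \<psi> * \<psi> a * cnj (\<psi> b) * cnj (\<psi> n)) =
    (if int q dvd n then 0 else of_nat (q - 1) * ee (of_int (t * n) / of_nat q) + 1)"
proof -
  let ?G = "if int q dvd n then 0 else of_nat (q - 1) * ee (of_int (t * n) / of_nat q)"
  define X where "X = {\<psi>. dirichlet_character q \<psi>}"
  define S where "S = (\<lambda>\<psi>. gauss_sum q \<psi> * \<psi> a * cnj (\<psi> b) * cnj (\<psi> n))"
  have q0: "q > 0" using prime_gt_0_nat[OF q] .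
  note cop_n = coprime_prime_int_iff[OF q]
  have "sum S X = (\<Sum>\<psi>\<in>X. \<Sum>x\<in>{0..<int q}. ee (of_int x / of_nat q) * (\<psi> (x * a) * cnj (\<psi> (b * n))))"
    unfolding S_def gauss_sum_def sum_distrib_right
    by (intro sum.cong refl) (simp add: X_def character_mult mult_ac)
  also have "\<dots> = (\<Sum>x\<in>{0..<int q}. \<Sum>\<psi>\<in>X. ee (of_int x / of_nat q) * (\<psi> (x * a) * cnj (\<psi> (b * n))))"
    by (rule sum.swap)
  also have "\<dots> = (\<Sum>x\<in>{0..<int q}. ee (of_int x / of_nat q) *
      (if coprime (b * n) (int q) \<and> [x * a = b * n] (mod int q) then of_nat (q - 1) else 0))"
    unfolding sum_distrib_left[symmetric] X_def character_orthogonality[OF q] ..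
  also have "\<dots> = (\<Sum>x\<in>{0..<int q}. if x = (t * n) mod int q
      then ?G else 0)"
  proof (intro sum.cong refl)
    fix x assume x: "x \<in> {0..<int q}"
    have "[x * a = b * n] (mod int q) \<longleftrightarrow> [x * a = (t * n) * a] (mod int q)"
    proof -
      have "[(t * n) * a = b * n] (mod int q)" using cong_scalar_right[OF t, of n] by (simp add: mult_ac)
      thus ?thesis by (metis cong_sym cong_trans)
    qed
    also have "\<dots> \<longleftrightarrow> [x = t * n] (mod int q)" using cop(1) by (rule cong_mult_rcancel)
    also have "\<dots> \<longleftrightarrow> x = (t * n) mod int q" using x by (auto simp: cong_def)
    finally have iff: "[x * a = b * n] (mod int q) \<longleftrightarrow> x = (t * n) mod int q" .
    have cop_bn: "coprime (b * n) (int q) \<longleftrightarrow> \<not> int q dvd n"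
      unfolding cop_n[symmetric] using cop(2) by (simp only: coprime_mult_left_iff simp_thms)
    have "ee (of_int ((t * n) mod int q) / of_nat q) = ee (of_int (t * n) / of_nat q)"
      by (rule ee_cong_mod[OF _ q0]) (simp add: cong_def)
    thus "ee (of_int x / of_nat q) *
      (if coprime (b * n) (int q) \<and> [x * a = b * n] (mod int q) then of_nat (q - 1) else 0) =
      (if x = (t * n) mod int q then ?G else 0)"
      unfolding iff cop_bn by simp
  qed
  also have "\<dots> = ?G"
    using q0 by (subst sum.delta) auto
  finally have all: "sum S X = ?G" .
  have "S (principal_character q) = (if int q dvd n then 0 else -1)"
    unfolding S_def gauss_sum_principal[OF q] using cop by (simp add: principal_character_def cop_n)
  moreover have "sum S {\<psi>. primitive_character q \<psi>} = sum S X - S (principal_character q)"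
    unfolding primitive_characters_prime[OF q] X_def
    using finite_characters[OF q] principal_character by (subst sum_diff1) auto
  ultimately show ?thesis using all unfolding S_def by simp
qed

section \<open>The moment as an additive twist\<close>

lemma continues_lincomb:
  assumes "continues a F" "continues b G"
  shows "continues (\<lambda>n. x * a n + y * b n) (\<lambda>s. x * F s + y * G s)"
  using continues_sum[of "{True, False}" "\<lambda>i. if i then a else b" "\<lambda>i. if i then F else G" "\<lambda>i. if i then x else y"] assms
  by simp

context eigenform
begin

lemma continues_additive_fraction:
  assumes "q > 0"
  shows "continues (\<lambda>n. lam n * ee (of_int (b * int n) / of_nat q)) (additive_continuation (of_int b / of_nat q))"
proof -
  define g where "g = gcd b (int q)"
  have g0: "g > 0" using assms by (simp add: g_def)
  have cop: "coprime (b div g) (int q div g)" unfolding g_def using assms by (intro div_gcd_coprime) auto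
  have d: "b = (b div g) * g" "int q = (int q div g) * g" by (simp_all add: g_def)
  have pos: "int q div g > 0" using d(2) assms g0 by (metis of_nat_0_less_iff zero_less_mult_pos2)
  have "real_of_int b / of_nat q = of_int ((b div g) * g) / of_int ((int q div g) * g)"
    using d by (metis of_int_of_nat_eq)
  also have "\<dots> = of_int (b div g) / of_int (int q div g)" using g0 by simp
  finally have x: "real_of_int b / of_nat q = of_int (b div g) / of_int (int q div g)" .
  have "of_nat n * complex_of_real (of_int b / of_nat q) = of_int (b * int n) / of_nat q" for n
    by simp
  thus ?thesis using continues_additive[OF cop pos x] by (simp add: mult_ac)
qed

lemma continues_lam: "continues lam (additive_continuation 0)"
  using continues_additive_fraction[of 1 0] by (simp add: ee_def)

lemma additive_continuation_cong:
  assumes "[b = c] (mod int q)" "q > 0"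
  shows "additive_continuation (of_int b / of_nat q) = additive_continuation (of_int c / of_nat q)"
proof -
  have "ee (of_int (b * int n) / of_nat q) = ee (of_int (c * int n) / of_nat q)" for n
    by (intro ee_cong_mod cong_scalar_right assms)
  thus ?thesis
    using continues_unique[OF continues_additive_fraction[OF assms(2), of b]] continues_additive_fraction[OF assms(2), of c]
    by simp
qed

text \<open>
  A periodic function is a combination of additive characters, so every twist by one inherits
  a continuation from the additive twists. This gives the continuation of \<open>L(s, f \<otimes> \<chi>)\<close>.
\<close>
lemma continues_periodic:
  assumes q: "q > 0" and c: "\<And>x y. [x = y] (mod int q) \<Longrightarrow> c x = c y"
  shows "\<exists>F. continues (\<lambda>n. lam n * c (int n)) F"
proof -
  define h where "h = (\<lambda>b::nat. (\<Sum>m<q. c (int m) * ee (- (of_nat m * of_nat b / of_nat q))) / of_nat q)"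
  have "(\<Sum>b<q. h b * (lam n * ee (of_int (int b * int n) / of_nat q))) = lam n * c (int n)" for n
  proof -
    have ee_diff: "ee (of_int (int n - int m) * of_nat b / of_nat q) =
        ee (- (of_nat m * of_nat b / of_nat q)) * ee (of_int (int b * int n) / of_nat q)" for m b
      by (simp add: ee_add[symmetric] diff_divide_distrib left_diff_distrib right_diff_distrib mult_ac)
    have "(\<Sum>b<q. h b * (lam n * ee (of_int (int b * int n) / of_nat q))) =
       (\<Sum>b<q. \<Sum>m<q. lam n / of_nat q * c (int m) * ee (of_int (int n - int m) * of_nat b / of_nat q))"
      unfolding h_def sum_divide_distrib sum_distrib_right
      unfolding ee_diff by (intro sum.cong refl) (simp add: divide_inverse mult_ac)
    also have "\<dots> = (\<Sum>m<q. \<Sum>b<q. lam n / of_nat q * c (int m) * ee (of_int (int n - int m) * of_nat b / of_nat q))"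
      by (rule sum.swap)
    also have "\<dots> = (\<Sum>m<q. if m = n mod q then lam n * c (int n) else 0)"
    proof (intro sum.cong refl)
      fix m assume m: "m \<in> {..<q}"
      have "int q dvd int n - int m \<longleftrightarrow> [n = m] (mod q)" by (simp flip: cong_iff_dvd_diff add: cong_int_iff)
      also have "\<dots> \<longleftrightarrow> m = n mod q" using m by (auto simp: cong_def)
      finally have iff: "int q dvd int n - int m \<longleftrightarrow> m = n mod q" .
      have "c (int (n mod q)) = c (int n)" by (rule c) (simp add: cong_def zmod_int)
      thus "(\<Sum>b<q. lam n / of_nat q * c (int m) * ee (of_int (int n - int m) * of_nat b / of_nat q)) =
          (if m = n mod q then lam n * c (int n) else 0)"
        unfolding sum_distrib_left[symmetric] sum_ee[OF q] iff using q by simp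
    qed
    also have "\<dots> = lam n * c (int n)" using q by (subst sum.delta) auto
    finally show ?thesis .
  qed
  moreover have "continues (\<lambda>n. \<Sum>b<q. h b * (lam n * ee (of_int (int b * int n) / of_nat q)))
      (\<lambda>s. \<Sum>b<q. h b * additive_continuation (of_int (int b) / of_nat q) s)"
    by (intro continues_sum continues_additive_fraction q) auto
  ultimately show ?thesis by auto
qed

text \<open>The Hecke relation \<open>\<lambda>\<^sub>f(q m) = \<lambda>\<^sub>f(q) \<lambda>\<^sub>f(m) - \<lambda>\<^sub>f(m/q)\<close> summed over \<open>m\<close>.\<close>
lemma continues_multiples:
  assumes q: "prime q"
  shows "continues (\<lambda>n. if q dvd n then lam n else 0)
    (\<lambda>s. of_nat q powr (- s) * (lam q * additive_continuation 0 s + (- 1) * (of_nat q powr (- s) * additive_continuation 0 s)))"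
proof -
  have q0: "q > 0" using prime_gt_0_nat[OF q] .
  define c where "c = (\<lambda>n. if q dvd n then lam q * lam (n div q) + (- 1) * (if q dvd n div q then lam (n div q div q) else 0) else 0)"
  have "continues c
    (\<lambda>s. of_nat q powr (- s) * (lam q * additive_continuation 0 s + (- 1) * (of_nat q powr (- s) * additive_continuation 0 s)))"
    unfolding c_def
    by (intro continues_dilate[OF q0, where a = "\<lambda>n. lam q * lam n + (- 1) * (if q dvd n then lam (n div q) else 0)"]
        continues_lincomb continues_lam continues_dilate[OF q0, where a = lam])
  also have "continues c =
      continues (\<lambda>n. if q dvd n then lam n else 0)"
  proof (rule continues_cong)
    fix n :: nat assume n: "n > 0"
    show "c n = (if q dvd n then lam n else 0)"
    proof (cases "q dvd n")
      case True
      then obtain m where m: "n = q * m" by auto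
      hence "m > 0" using n by auto
      from lam_hecke_relation[OF q this] show ?thesis using m q0 by (simp add: c_def)
    qed (simp add: c_def)
  qed
  finally show ?thesis .
qed

text \<open>
  By \<open>sum_primitive_gauss\<close> the sum over primitive characters has coefficients
  \<open>\<lambda>\<^sub>f(n) ((q-1) e(tn/q) + 1 - q [q | n])\<close>. At \<open>s = 1/2\<close> the last two terms contribute
  \<open>(1 - (\<lambda>\<^sub>f(q) \<surd>q - 1)) L(1/2, f)\<close>, that is \<open>- c\<^sub>f(q) L(1/2, f)\<close>. The continuations are compared as entire
  functions, since the series need not converge at \<open>1/2\<close>.
\<close>
lemma M_moment_eq:
  assumes q: "prime q" and cop: "coprime a' (int q)" "coprime b (int q)" and t: "[t * a' = b] (mod int q)"
  shows "M_moment k f a' b q = additive_continuation (of_int t / of_nat q) (1 / 2)"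
proof -
  let ?c = "\<lambda>n. 1 * (of_nat (q - 1) * (lam n * ee (of_int (t * int n) / of_nat q)) + 1 * lam n) + (- of_nat q) * (if q dvd n then lam n else 0)"
  let ?\<alpha> = "additive_continuation (of_int t / of_nat q)"
  have q1: "q > 1" using prime_gt_1_nat[OF q] .
  define P where "P = {\<psi>. primitive_character q \<psi>}"
  define w where "w = (\<lambda>\<psi>. gauss_sum q \<psi> * \<psi> a' * cnj (\<psi> b))"
  define A where "A = (\<lambda>\<psi> n. lam n * cnj (\<psi> (int n)))"
  define L where "L = additive_continuation 0 (1 / 2)"
  have P: "dirichlet_character q \<psi>" if "\<psi> \<in> P" for \<psi>
    using that by (simp add: P_def primitive_character_def)
  have fin: "finite P" unfolding P_def primitive_characters_prime[OF q] using finite_characters[OF q] by simp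
  have A: "continues (A \<psi>) (entire_L (A \<psi>))" if "\<psi> \<in> P" for \<psi>
  proof -
    have "\<exists>F. continues (\<lambda>n. lam n * cnj (\<psi> (int n))) F"
      by (rule continues_periodic[of q "\<lambda>n. cnj (\<psi> n)"]) (use q1 character_cong[OF P[OF that]] in auto)
    thus ?thesis unfolding A_def by (auto intro: continues_entire_L)
  qed
  have twist: "L_twist k f (\<lambda>n. cnj (\<psi> n)) = entire_L (A \<psi>)" for \<psi>
    unfolding L_twist_def A_def by (rule entire_L_cong) (simp add: hecke_eigenvalue_eq)
  have form: "L_form k f (1 / 2) = L"
  proof -
    have "L_form k f = entire_L lam" unfolding L_form_def by (rule entire_L_cong) (simp add: hecke_eigenvalue_eq)
    thus ?thesis by (simp add: L_def entire_L_eq[OF continues_lam])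
  qed
  \<comment> \<open>Two continuations of the same coefficients.\<close>
  have 1: "continues (\<lambda>n. \<Sum>\<psi>\<in>P. w \<psi> * A \<psi> n) (\<lambda>s. \<Sum>\<psi>\<in>P. w \<psi> * entire_L (A \<psi>) s)"
    by (rule continues_sum[OF fin A])
  let ?\<Sigma> = "\<Sum>\<psi>\<in>P. w \<psi> * entire_L (A \<psi>) (1 / 2)"
  define M where "M = (\<lambda>s. of_nat q powr (- s) * (lam q * additive_continuation 0 s + (- 1) * (of_nat q powr (- s) * additive_continuation 0 s)))"
  have 2: "continues ?c
     (\<lambda>s. 1 * (of_nat (q - 1) * ?\<alpha> s + 1 * additive_continuation 0 s) + (- of_nat q) * M s)"
    unfolding M_def using q1
    by (intro continues_lincomb continues_additive_fraction continues_lam continues_multiples[OF q]) auto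
  have "(\<Sum>\<psi>\<in>P. w \<psi> * A \<psi> n) = ?c n" for n
  proof -
    have "(\<Sum>\<psi>\<in>P. w \<psi> * A \<psi> n) = lam n * (\<Sum>\<psi>\<in>P. gauss_sum q \<psi> * \<psi> a' * cnj (\<psi> b) * cnj (\<psi> (int n)))"
      unfolding w_def A_def sum_distrib_left by (intro sum.cong refl) (simp only: mult_ac)
    also have "\<dots> = lam n * (if int q dvd int n then 0 else of_nat (q - 1) * ee (of_int (t * int n) / of_nat q) + 1)"
      unfolding P_def sum_primitive_gauss[OF q cop t] ..
    also have "\<dots> = ?c n"
    proof (cases "q dvd n")
      case True
      then obtain l where "n = q * l" by auto
      hence "complex_of_int (t * int n) / of_nat q = of_int (t * int l)" using q1 by simp
      hence "ee (of_int (t * int n) / of_nat q) = 1" by (simp only: ee_of_int)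
      thus ?thesis using True q1 by (simp add: of_nat_diff algebra_simps)
    qed (simp add: algebra_simps)
    finally show ?thesis .
  qed
  hence "(\<lambda>s. \<Sum>\<psi>\<in>P. w \<psi> * entire_L (A \<psi>) s) =
     (\<lambda>s. 1 * (of_nat (q - 1) * ?\<alpha> s + 1 * additive_continuation 0 s) + (- of_nat q) * M s)"
    using continues_unique[OF 1] 2 by simp
  from fun_cong[OF this, of "1 / 2"]
  have main: "?\<Sigma> =
     of_nat (q - 1) * ?\<alpha> (1 / 2) + L - of_nat q * M (1 / 2)"
    by (simp add: L_def)
  have sq: "complex_of_nat q powr (- (1 / 2)) = of_real (1 / sqrt (real q))"
  proof -
    have "complex_of_nat q powr (- (1 / 2)) = of_real (real q powr (- (1 / 2)))"
      using powr_of_real[of "real q" "- (1 / 2)"] by simp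
    also have "real q powr (- (1 / 2)) = 1 / sqrt (real q)"
      unfolding powr_minus powr_half_sqrt[OF of_nat_0_le_iff] by (rule inverse_eq_divide)
    finally show ?thesis .
  qed
  have "sqrt (real q) * sqrt (real q) = real q" by simp
  hence "complex_of_real (sqrt (real q) * sqrt (real q)) = of_real (real q)" by (rule arg_cong)
  hence qs: "complex_of_nat q = of_real (sqrt (real q)) * of_real (sqrt (real q))"
    by (simp only: of_real_mult of_real_of_nat_eq)
  have s0: "complex_of_real (sqrt (real q)) \<noteq> 0" using q1 by simp
  have "of_nat q * M (1 / 2) = (lam q * of_real (sqrt (real q)) - 1) * L"
  proof -
    define \<rho> where "\<rho> = complex_of_real (sqrt (real q))"
    have "\<rho> \<noteq> 0" using s0 by (simp add: \<rho>_def)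
    hence "\<rho> * \<rho> * (1 / \<rho> * (lam q * L + (- 1) * (1 / \<rho> * L))) = (lam q * \<rho> - 1) * L"
      by (simp add: field_simps)
    moreover have "M (1 / 2) = 1 / \<rho> * (lam q * L + (- 1) * (1 / \<rho> * L))"
      unfolding M_def sq L_def[symmetric] \<rho>_def by simp
    ultimately show ?thesis unfolding qs \<rho>_def by (simp only:)
  qed
  with main have main': "?\<Sigma> =
     of_nat (q - 1) * ?\<alpha> (1 / 2) - (lam q * of_real (sqrt (real q)) - 2) * L"
    by (simp add: algebra_simps)
  have "M_moment k f a' b q = 1 / of_nat (q - 1) *
      (?\<Sigma> + (lam q * of_real (sqrt (real q)) - 2) * L)"
    unfolding M_moment_def P_def[symmetric] twist form c_moment_def w_def totient_prime[OF q]
    using q1 by (simp add: hecke_eigenvalue_eq mult_ac)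
  also have "\<dots> = ?\<alpha> (1 / 2)"
    unfolding main' using q1 by simp
  finally show ?thesis .
qed

end


section \<open>The reciprocity relation\<close>

context eigenform
begin

lemma L_additive_eq:
  assumes "q > 0" "\<alpha> = of_int b / of_nat q"
  shows "L_additive k f \<alpha> = additive_continuation (of_int b / of_nat q)"
proof -
  have "of_nat n * of_rat \<alpha> = complex_of_int (b * int n) / of_nat q" for n
    by (simp add: assms(2) of_rat_divide)
  hence "additive_coeff k f \<alpha> n = lam n * ee (of_int (b * int n) / of_nat q)" if "n > 0" for n
    using that by (simp add: additive_coeff_def hecke_eigenvalue_eq)
  hence "L_additive k f \<alpha> = entire_L (\<lambda>n. lam n * ee (of_int (b * int n) / of_nat q))"
    unfolding L_additive_def by (rule entire_L_cong)
  also have "\<dots> = additive_continuation (of_int b / of_nat q)"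
    by (rule entire_L_eq[OF continues_additive_fraction[OF assms(1)]])
  finally show ?thesis .
qed

lemma norm_dirichlet_term:
  assumes "\<And>n. n > 0 \<Longrightarrow> norm (c n) = norm (lam n)"
  shows "norm (dirichlet_term c s n) = norm (lam (Suc n)) * real (Suc n) powr (- Re s)"
proof -
  have "norm (complex_of_nat (Suc n) powr (- s)) = real (Suc n) powr (- Re s)"
    using norm_powr_real_powr[of "complex_of_nat (Suc n)" "- s"] by (simp del: of_nat_Suc)
  thus ?thesis using assms[of "Suc n"] by (simp add: dirichlet_term_def norm_mult)
qed

lemma abs_convergence_additive:
  assumes "q > 0" "\<alpha> = of_int b / of_nat q" "Re s > 1"
  shows "s \<in> abs_convergence_region (additive_coeff k f \<alpha>)"
proof -
  have "of_nat n * of_rat \<alpha> = complex_of_real (of_int b * real n / real q)" for n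
    by (simp add: assms(2) of_rat_divide)
  hence "norm (ee (of_nat n * of_rat \<alpha>)) = 1" for n by (simp only: norm_ee Im_complex_of_real) simp
  hence "norm (additive_coeff k f \<alpha> n) = norm (lam n)" if "n > 0" for n
    using that by (simp add: additive_coeff_def hecke_eigenvalue_eq norm_mult)
  from norm_dirichlet_term[OF this] lam_summable[OF assms(3)] show ?thesis
    by (simp add: abs_convergence_region_def del: of_nat_Suc)
qed

text \<open>
  For \<open>j \<ge> 1\<close> the point lies in the region of absolute convergence, and the additive character has absolute
  value \<open>1\<close>. The resulting bound depends neither on the fraction nor on \<open>j\<close>.
\<close>
lemma additive_continuation_bound:
  assumes "q > 0" "j \<ge> 1"
  shows "norm (additive_continuation (of_int b / of_nat q) (1 / 2 + of_nat j)) \<le>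
    (\<Sum>n. norm (lam (Suc n)) * real (Suc n) powr (- (3 / 2)))"
proof -
  define s where "s = (1 / 2 + of_nat j :: complex)"
  define c where "c = (\<lambda>n. lam n * ee (of_int (b * int n) / of_nat q))"
  have s: "Re s \<ge> 3 / 2" using assms(2) by (simp add: s_def)
  have nc: "norm (c n) = norm (lam n)" for n
  proof -
    have "complex_of_int (b * int n) / of_nat q = of_real (of_int b * real n / real q)" by simp
    hence "norm (ee (complex_of_int (b * int n) / of_nat q)) = 1" by (simp only: norm_ee Im_complex_of_real) simp
    thus ?thesis by (simp add: c_def norm_mult)
  qed
  have nt: "norm (dirichlet_term c s n) = norm (lam (Suc n)) * real (Suc n) powr (- Re s)" for n
    by (rule norm_dirichlet_term) (rule nc)
  have sm: "summable (\<lambda>n. norm (dirichlet_term c s n))" unfolding nt by (rule lam_summable) (use s in simp)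
  have sm': "summable (\<lambda>n. norm (lam (Suc n)) * real (Suc n) powr (- (3 / 2)))" by (rule lam_summable) simp
  have "dirichlet_term c s sums additive_continuation (of_int b / of_nat q) s"
    using continues_additive_fraction[OF assms(1), of b] s unfolding continues_def c_def by simp
  hence "norm (additive_continuation (of_int b / of_nat q) s) = norm (\<Sum>n. dirichlet_term c s n)" by (simp add: sums_iff)
  also have "\<dots> \<le> (\<Sum>n. norm (dirichlet_term c s n))" by (rule summable_norm[OF sm])
  also have "\<dots> \<le> (\<Sum>n. norm (lam (Suc n)) * real (Suc n) powr (- (3 / 2)))"
  proof (rule suminf_le[OF _ sm sm'])
    fix n
    show "norm (dirichlet_term c s n) \<le> norm (lam (Suc n)) * real (Suc n) powr (- (3 / 2))"
      unfolding nt using s by (intro mult_left_mono powr_mono) auto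
  qed
  finally show ?thesis by (simp add: s_def)
qed

abbreviation moment_defect :: "nat \<Rightarrow> nat \<Rightarrow> nat \<Rightarrow> complex" where
  "moment_defect p q r \<equiv>
     M_moment k f (int p) (int r) q - M_moment k f (- int q) (int r) p - M_moment k f (- int p) (int q) r"

text \<open>
  With \<open>A = q r\<^sup>-\<^sup>1\<close> modulo \<open>p\<close> and \<open>D\<close> an inverse of \<open>A\<close>, the numbers \<open>D q\<close> and \<open>r\<close> agree modulo \<open>p\<close>, so
  \<open>r = p t + D q\<close> for an integer \<open>t\<close>, and \<open>additive_reciprocity\<close> applies. Its three fractions
  \<open>t/q\<close>, \<open>E/r\<close> and \<open>A/p\<close> are those of the three moments, the last one by way of the functional
  equation, which replaces \<open>A/p\<close> by \<open>-D/p\<close>.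
\<close>
lemma moment_reciprocity:
  fixes p q r :: nat and pbar rbar :: int
  assumes k: "k = 2 * m + 2" and primes: "prime p" "prime q" "prime r"
    and distinct: "p \<noteq> q" "p \<noteq> r" "q \<noteq> r"
    and pbar: "[int p * pbar = 1] (mod int r)" and rbar: "[int r * rbar = 1] (mod int p)"
  shows "moment_defect p q r =
    (\<Sum>j = 1..m. fact (m + j) / (fact j * fact (m - j)) *
       (2 * of_real pi * \<i> * of_nat q / (of_nat p * of_nat r)) powi (- int j) *
       (additive_continuation (of_int (- (pbar * int q)) / of_nat r) (1 / 2 + of_nat j) +
        (-1) ^ j * \<i> ^ k * additive_continuation (of_int (int q * rbar) / of_nat p) (1 / 2 + of_nat j)))"
proof -
  have pos: "p > 0" "q > 0" "r > 0" using primes prime_gt_0_nat by auto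
  have cop: "coprime (int x) (int y)" if "prime x" "prime y" "x \<noteq> y" for x y :: nat
    using primes_coprime[OF that] by simp
  define A where "A = int q * rbar"
  have "coprime rbar (int p)" using rbar by (metis coprime_iff_invertible_int mult.commute)
  hence "coprime A (int p)" using cop[OF primes(2,1)] distinct unfolding A_def by simp
  then obtain D where AD: "[A * D = 1] (mod int p)" using cong_solve_coprime_int by blast
  then obtain B where "A * D = 1 + int p * B" by (metis cong_iff_lin cong_sym)
  hence det: "A * D - B * int p = 1" by (simp add: mult.commute)
  have Ar: "[A * int r = int q] (mod int p)"
    using cong_scalar_left[OF rbar, of "int q"] by (simp add: A_def mult_ac)
  have Dq: "[D * int q = int r] (mod int p)"
  proof -
    have "[D * int q = D * (A * int r)] (mod int p)" by (intro cong_scalar_left cong_sym[OF Ar])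
    also have "D * (A * int r) = (A * D) * int r" by simp
    also have "[(A * D) * int r = 1 * int r] (mod int p)" by (rule cong_scalar_right[OF AD])
    finally show ?thesis by simp
  qed
  then obtain t where "int r = D * int q + int p * t" by (metis cong_iff_lin)
  hence rt: "int r = int p * t + D * int q" by simp
  have tq: "coprime t (int q)"
    unfolding coprime_prime_int_iff[OF primes(2)]
  proof
    assume "int q dvd t"
    hence "int q dvd int r" unfolding rt by simp
    thus False using cop[OF primes(3,2)] distinct coprime_prime_int_iff[OF primes(2)] by auto
  qed
  obtain u' v where "t * v + int q * u' = 1" using tq by (metis bezout_int coprime_iff_gcd_eq_1 mult.commute)
  hence det': "t * v - (- u') * int q = 1" by (simp add: mult.commute)
  define E where "E = A * t + B * int q"
  have Ep: "int p * E = A * int r - int q"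
  proof -
    have "int p * E = A * (int p * t) + int q * (B * int p)" by (simp add: E_def algebra_simps)
    also have "int p * t = int r - D * int q" using rt by simp
    also have "B * int p = A * D - 1" using det by simp
    finally show ?thesis by (simp add: algebra_simps)
  qed
  define W where "W = (\<lambda>j. additive_continuation (of_int E / of_nat r) (1 / 2 + of_nat j))"
  define Z where "Z = (\<lambda>j. additive_continuation (of_int A / of_nat p) (1 / 2 + of_nat j))"
  define cf where "cf = (\<lambda>j. fact (m + j) / (fact j * fact (m - j)) *
       (2 * of_real pi * \<i> * of_nat q / (of_nat p * of_nat r)) powi (- int j) * (W j + (-1) ^ j * \<i> ^ k * Z j) :: complex)"
  have M1: "M_moment k f (int p) (int r) q = additive_continuation (of_int t / of_nat q) (1 / 2)"
  proof (rule M_moment_eq[OF primes(2)])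
    show "coprime (int p) (int q)" "coprime (int r) (int q)" using cop primes distinct by auto
    show "[t * int p = int r] (mod int q)" by (simp add: rt cong_iff_dvd_diff mult.commute)
  qed
  have M2: "M_moment k f (- int q) (int r) p = \<i> ^ k * Z 0"
  proof -
    have "M_moment k f (- int q) (int r) p = additive_continuation (of_int (- D) / of_nat p) (1 / 2)"
    proof (rule M_moment_eq[OF primes(1)])
      show "coprime (- int q) (int p)" "coprime (int r) (int p)" using cop primes distinct by auto
      show "[- D * - int q = int r] (mod int p)" using Dq by simp
    qed
    thus ?thesis using additive_functional_equation[OF det] pos by (simp add: Z_def)
  qed
  have M3: "M_moment k f (- int p) (int q) r = W 0"
  proof -
    have "M_moment k f (- int p) (int q) r = additive_continuation (of_int E / of_nat r) (1 / 2)"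
    proof (rule M_moment_eq[OF primes(3)])
      show "coprime (- int p) (int r)" "coprime (int q) (int r)" using cop primes distinct by auto
      have "E * - int p = int q - A * int r" using Ep by (simp add: mult.commute)
      thus "[E * - int p = int q] (mod int r)" by (simp add: cong_iff_dvd_diff)
    qed
    thus ?thesis by (simp add: W_def)
  qed
  have "M_moment k f (int p) (int r) q = (\<Sum>j\<le>m. cf j)"
    unfolding M1 using additive_reciprocity[OF k det det' _ _ _ rt] pos
    by (simp add: cf_def W_def Z_def E_def mult.assoc)
  also have "\<dots> = cf 0 + (\<Sum>j = 1..m. cf j)"
    by (simp add: atMost_atLeast0 sum.atLeast_Suc_atMost)
  also have "cf 0 = W 0 + \<i> ^ k * Z 0" by (simp add: cf_def)
  finally have main: "moment_defect p q r =
    (\<Sum>j = 1..m. cf j)" unfolding M2 M3 by simp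
  have "[E = - (pbar * int q)] (mod int r)"
  proof -
    have "[int p * E = - int q] (mod int r)" unfolding Ep by (simp add: cong_iff_dvd_diff)
    from cong_scalar_left[OF this, of pbar]
    have 1: "[(int p * pbar) * E = - (pbar * int q)] (mod int r)" by (simp add: mult_ac)
    have "[(int p * pbar) * E = 1 * E] (mod int r)" by (rule cong_scalar_right[OF pbar])
    thus ?thesis using 1 by (metis cong_sym cong_trans mult_1)
  qed
  hence "additive_continuation (of_int E / of_nat r) = additive_continuation (of_int (- (pbar * int q)) / of_nat r)"
    using pos by (intro additive_continuation_cong)
  thus ?thesis unfolding main cf_def W_def Z_def A_def by simp
qed

text \<open>
  The \<open>j\<close>-th term is at most a constant times \<open>y\<^sup>j\<close> with \<open>y = pr/q\<close>, and \<open>y\<^sup>j \<le> C'\<^sup>m y\<close> for \<open>1 \<le> j \<le> m\<close>,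
  since \<open>y \<le> C'\<close> and \<open>C' \<ge> 1\<close>.
\<close>
lemma moment_bound:
  fixes C :: real
  assumes k: "k = 2 * m + 2"
  obtains K where "\<And>p q r :: nat. prime p \<Longrightarrow> prime q \<Longrightarrow> prime r \<Longrightarrow> p \<noteq> q \<Longrightarrow> p \<noteq> r \<Longrightarrow> q \<noteq> r \<Longrightarrow>
    real p * real r < C * real q \<Longrightarrow>
    norm (moment_defect p q r)
      \<le> K * (real p * real r / real q)"
proof -
  define S where "S = (\<Sum>n. norm (lam (Suc n)) * real (Suc n) powr (- (3 / 2)))"
  define C' where "C' = max 1 C"
  define co where "co = (\<lambda>j. fact (m + j) / (fact j * fact (m - j)) :: real)"
  define K where "K = (\<Sum>j = 1..m. co j * C' ^ m * (2 * S))"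
  have S0: "S \<ge> 0" unfolding S_def by (intro suminf_nonneg lam_summable) auto
  have "norm (moment_defect p q r)
      \<le> K * (real p * real r / real q)"
    if primes: "prime p" "prime q" "prime r" and distinct: "p \<noteq> q" "p \<noteq> r" "q \<noteq> r"
      and small: "real p * real r < C * real q" for p q r :: nat
  proof -
    have pos: "p > 0" "q > 0" "r > 0" using primes prime_gt_0_nat by auto
    have cop: "coprime (int p) (int r)" "coprime (int r) (int p)"
      using primes_coprime[OF primes(1,3)] distinct by (auto simp: coprime_commute)
    obtain pbar where pbar: "[int p * pbar = 1] (mod int r)" using cong_solve_coprime_int[OF cop(1)] by blast
    obtain rbar where rbar: "[int r * rbar = 1] (mod int p)" using cong_solve_coprime_int[OF cop(2)] by blast
    define y where "y = real p * real r / real q"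
    have "y < C" using pos small by (simp add: y_def divide_less_eq)
    hence y: "y > 0" "y \<le> C'" using pos by (simp_all add: y_def C'_def)
    define X where "X = (\<lambda>j. additive_continuation (of_int (- (pbar * int q)) / of_nat r) (1 / 2 + of_nat j))"
    define Y where "Y = (\<lambda>j. additive_continuation (of_int (int q * rbar) / of_nat p) (1 / 2 + of_nat j))"
    let ?w = "2 * of_real pi * \<i> * of_nat q / (of_nat p * of_nat r) :: complex"
    have term_bound: "norm (fact (m + j) / (fact j * fact (m - j)) *
       ?w powi (- int j) *
       (X j + (-1) ^ j * \<i> ^ k * Y j))
      \<le> co j * C' ^ m * (2 * S) * y" if j: "j \<in> {1..m}" for j
    proof -
      have nw: "norm ?w = 2 * pi / y"
        by (simp add: norm_mult norm_divide y_def)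
      have "norm (?w powi (- int j)) = inverse ((2 * pi / y) ^ j)"
        unfolding power_int_minus power_int_of_nat norm_inverse norm_power nw ..
      also have "\<dots> = (y / (2 * pi)) ^ j" by (simp only: power_inverse[symmetric] inverse_divide)
      also have "\<dots> \<le> y ^ j"
        using y pi_gt3 by (intro power_mono) (auto simp: field_simps mult_le_cancel_left1)
      also have "y ^ j = y ^ (j - 1) * y" using j by (cases j) auto
      also have "\<dots> \<le> C' ^ m * y"
      proof (intro mult_right_mono)
        have "y ^ (j - 1) \<le> C' ^ (j - 1)" using y by (intro power_mono) auto
        also have "\<dots> \<le> C' ^ m" using j by (intro power_increasing) (auto simp: C'_def)
        finally show "y ^ (j - 1) \<le> C' ^ m" .
      qed (use y in simp)
      finally have pw: "norm (?w powi (- int j)) \<le> C' ^ m * y" .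
      have "norm (X j + (-1) ^ j * \<i> ^ k * Y j) \<le> norm (X j) + norm ((-1) ^ j * \<i> ^ k * Y j)" by (rule norm_triangle_ineq)
      also have "norm ((-1) ^ j * \<i> ^ k * Y j) = norm (Y j)" by (simp add: norm_mult norm_power)
      also have "norm (X j) + norm (Y j) \<le> S + S"
        unfolding X_def Y_def S_def using j pos by (intro add_mono additive_continuation_bound) auto
      finally have XY: "norm (X j + (-1) ^ j * \<i> ^ k * Y j) \<le> S + S" .
      have co: "norm (fact (m + j) / (fact j * fact (m - j)) :: complex) = co j"
        by (simp add: co_def norm_mult norm_divide)
      have "norm (fact (m + j) / (fact j * fact (m - j)) *
         ?w powi (- int j) * (X j + (-1) ^ j * \<i> ^ k * Y j))
        \<le> co j * (C' ^ m * y) * (S + S)"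
        unfolding norm_mult[of "_ * _"] norm_mult[of "fact _ / _"] co
        by (intro mult_mono pw XY) (use y S0 in \<open>auto simp: co_def C'_def\<close>)
      thus ?thesis by (simp add: mult_ac)
    qed
    have "norm (moment_defect p q r)
      \<le> (\<Sum>j = 1..m. co j * C' ^ m * (2 * S) * y)"
      unfolding moment_reciprocity[OF k primes distinct pbar rbar]
      by (intro sum_norm_le term_bound[unfolded X_def Y_def])
    thus ?thesis unfolding K_def y_def[symmetric] sum_distrib_right .
  qed
  thus ?thesis using that by blast
qed

end

theorem theorem1p1:
  fixes k :: nat and f :: "complex \<Rightarrow> complex"
  assumes "even k" and "k \<ge> 12" and "hecke_cusp_form k f"
  shows
    "(\<forall>(p::nat) (q::nat) (r::nat) (pbar::int) (rbar::int).
       prime p \<and> prime q \<and> prime r \<and> odd p \<and> odd q \<and> odd r \<and> p \<noteq> q \<and> p \<noteq> r \<and> q \<noteq> r \<and>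
       [int p * pbar = 1] (mod int r) \<and> [int r * rbar = 1] (mod int p) \<longrightarrow>
       M_moment k f (int p) (int r) q - M_moment k f (- int q) (int r) p - M_moment k f (- int p) (int q) r
         = (\<Sum>j = 1..k div 2 - 1.
              1 / fact j * (Gamma (of_nat k / 2 + of_nat j) / Gamma (of_nat k / 2 - of_nat j)) *
              (2 * of_real pi * \<i> * of_nat q / (of_nat p * of_nat r)) powi (- int j) *
              (L_additive k f (- (of_int pbar * of_nat q / of_nat r)) (1/2 + of_nat j)
               + (-1) ^ j * \<i> ^ k * L_additive k f (of_nat q * of_int rbar / of_nat p) (1/2 + of_nat j)))
       \<and> (\<forall>j\<in>{1..k div 2 - 1}.
              1/2 + of_nat j \<in> abs_convergence_region (additive_coeff k f (- (of_int pbar * of_nat q / of_nat r))) \<and>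
              1/2 + of_nat j \<in> abs_convergence_region (additive_coeff k f (of_nat q * of_int rbar / of_nat p))))
    \<and>
     (\<forall>C::real. \<exists>K::real. \<forall>(p::nat) (q::nat) (r::nat).
       prime p \<and> prime q \<and> prime r \<and> odd p \<and> odd q \<and> odd r \<and> p \<noteq> q \<and> p \<noteq> r \<and> q \<noteq> r \<and>
       real p * real r < C * real q \<longrightarrow>
       norm (M_moment k f (int p) (int r) q - M_moment k f (- int q) (int r) p - M_moment k f (- int p) (int q) r)
         \<le> K * (real p * real r / real q))"
proof -
  obtain a where "eigenform k f a"
    using hecke_cusp_form_eigenform[OF assms(1) _ assms(3)] assms(2) by auto
  then interpret eigenform k f a .
  define m where "m = k div 2 - 1"
  have k: "k = 2 * m + 2" using assms(1,2) by (auto simp: m_def elim!: evenE)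
  have \<alpha>1: "- (of_int pbar * of_nat q / of_nat r) = (of_int (- (pbar * int q)) / of_nat r :: rat)" for pbar q r by simp
  have \<alpha>2: "of_nat q * of_int rbar / of_nat p = (of_int (int q * rbar) / of_nat p :: rat)" for q rbar p by simp
  show ?thesis
  proof (intro conjI allI impI ballI, goal_cases)
    case (1 p q r pbar rbar)
    have pos: "p > 0" "r > 0" using 1 prime_gt_0_nat by auto
    have Gamma_quotient: "1 / fact j * (Gamma (of_nat k / 2 + of_nat j) / Gamma (of_nat k / 2 - of_nat j)) =
        (fact (m + j) / (fact j * fact (m - j)) :: complex)" if "j \<in> {1..m}" for j
    proof -
      have "of_nat k / 2 + of_nat j = (1 + of_nat (m + j) :: complex)" by (simp add: k field_simps)
      moreover have "of_nat k / 2 - of_nat j = (1 + of_nat (m - j) :: complex)"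
        using that by (simp add: k field_simps of_nat_diff)
      ultimately show ?thesis by (simp only: Gamma_fact) simp
    qed
    show ?case
      unfolding m_def[symmetric] L_additive_eq[OF pos(2) \<alpha>1] L_additive_eq[OF pos(1) \<alpha>2]
      by (subst moment_reciprocity[OF k, of p q r pbar rbar])
         (use 1 in \<open>auto simp only: Gamma_quotient intro!: sum.cong\<close>)
  next
    case (2 p q r pbar rbar j)
    hence "r > 0" "Re (1 / 2 + of_nat j) > 1" using prime_gt_0_nat by auto
    thus ?case by (intro abs_convergence_additive[OF _ \<alpha>1])
  next
    case (3 p q r pbar rbar j)
    hence "p > 0" "Re (1 / 2 + of_nat j) > 1" using prime_gt_0_nat by auto
    thus ?case by (intro abs_convergence_additive[OF _ \<alpha>2])
  next
    case (4 C)
    show ?case by (rule moment_bound[OF k, of C]) blast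
  qed
qed

end
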